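(* Let $\Omega\subset\mathbb{R}^2$ be an open, bounded, simply connected domain with Lipschitz boundary, and let $\nu>0$, $\alpha>0$, $\beta>0$, $\delta\ge 1$, $\gamma\in(0,1)$. Then for every $f\in H^{-1}(\Omega)$ there exists at least one weak solution of the Dirichlet problem $$-\nu\Delta u+\alpha u^{\delta}\sum_{i=1}^2\frac{\partial u}{\partial x_i}-\beta u(1-u^{\delta})(u^{\delta}-\gamma)=f\ \text{ in }\Omega,\qquad u=0\ \text{ on }\partial\Omega,$$ that is, there exists $u\in H_0^1(\Omega)$ such that $$\nu(\nabla u,\nabla v)+\alpha\int_\Omega u^{\delta}\sum_{i=1}^2\frac{\partial u}{\partial x_i}\,v\,dx-\beta\int_\Omega u(1-u^{\delta})(u^{\delta}-\gamma)\,v\,dx=\langle f,v\rangle\quad\text{for all } v\in H_0^1(\Omega).$$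
   Context: $(\cdot,\cdot)$ is the $L^2(\Omega)$ inner product, $H^{-1}(\Omega)$ is the dual of $H_0^1(\Omega)$, and $\langle\cdot,\cdot\rangle$ is the corresponding duality pairing. Power convention: if $\delta$ is an integer, $s^\delta$ is the usual power; if $\delta$ is not an integer, $s^{\delta}$ means $|s|^{\delta}$ for $s\in\mathbb{R}$. *)

theory Defs
  imports "HOL-Analysis.Analysis"
begin

text \<open>
  Elements of the spaces below are represented by functions rather than by almost-everywhere
  classes. Every notion is invariant under changing a representative on a null set; in particular
  a functional in \<open>H_minus1\<close> is, because it is bounded by the seminorm \<open>H1_norm\<close>.
\<close>

definition L2 :: "(real^'n) set \<Rightarrow> (real^'n \<Rightarrow> real) set" where
  "L2 \<Omega> = {u \<in> borel_measurable (lebesgue_on \<Omega>). integrable (lebesgue_on \<Omega>) (\<lambda>x. (u x)\<^sup>2)}"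

definition L2_inner :: "(real^'n) set \<Rightarrow> (real^'n \<Rightarrow> real) \<Rightarrow> (real^'n \<Rightarrow> real) \<Rightarrow> real" where
  "L2_inner \<Omega> u v = (\<integral>x. u x * v x \<partial>lebesgue_on \<Omega>)"

definition partial_deriv :: "'n \<Rightarrow> (real^'n \<Rightarrow> real) \<Rightarrow> real^'n \<Rightarrow> real" where
  "partial_deriv i f x = frechet_derivative f (at x) (axis i 1)"

primrec Ck :: "nat \<Rightarrow> (real^'n \<Rightarrow> real) \<Rightarrow> bool" where
  "Ck 0 f \<longleftrightarrow> continuous_on UNIV f"
| "Ck (Suc k) f \<longleftrightarrow> (\<forall>x. f differentiable (at x)) \<and> (\<forall>i. Ck k (partial_deriv i f))"

definition test_functions :: "(real^'n) set \<Rightarrow> (real^'n \<Rightarrow> real) set" where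
  "test_functions \<Omega> =
    {\<phi>. (\<forall>k. Ck k \<phi>) \<and> compact (closure {x. \<phi> x \<noteq> 0}) \<and> closure {x. \<phi> x \<noteq> 0} \<subseteq> \<Omega>}"

definition has_weak_deriv ::
  "(real^'n) set \<Rightarrow> 'n \<Rightarrow> (real^'n \<Rightarrow> real) \<Rightarrow> (real^'n \<Rightarrow> real) \<Rightarrow> bool" where
  "has_weak_deriv \<Omega> i u g \<longleftrightarrow>
    (\<forall>\<phi>\<in>test_functions \<Omega>. L2_inner \<Omega> u (partial_deriv i \<phi>) = - L2_inner \<Omega> g \<phi>)"

definition H1 :: "(real^'n) set \<Rightarrow> (real^'n \<Rightarrow> real) set" where
  "H1 \<Omega> = {u \<in> L2 \<Omega>. \<forall>i. \<exists>g\<in>L2 \<Omega>. has_weak_deriv \<Omega> i u g}"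

text \<open>For \<open>u \<in> H1 \<Omega>\<close> the choice below is unique up to a null set.\<close>

definition weak_deriv :: "(real^'n) set \<Rightarrow> 'n \<Rightarrow> (real^'n \<Rightarrow> real) \<Rightarrow> real^'n \<Rightarrow> real" where
  "weak_deriv \<Omega> i u = (SOME g. g \<in> L2 \<Omega> \<and> has_weak_deriv \<Omega> i u g)"

definition grad_inner :: "(real^'n) set \<Rightarrow> (real^'n \<Rightarrow> real) \<Rightarrow> (real^'n \<Rightarrow> real) \<Rightarrow> real" where
  "grad_inner \<Omega> u v = (\<Sum>i\<in>UNIV. L2_inner \<Omega> (weak_deriv \<Omega> i u) (weak_deriv \<Omega> i v))"

definition H1_norm :: "(real^'n) set \<Rightarrow> (real^'n \<Rightarrow> real) \<Rightarrow> real" where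
  "H1_norm \<Omega> u = sqrt (L2_inner \<Omega> u u + grad_inner \<Omega> u u)"

definition H10 :: "(real^'n) set \<Rightarrow> (real^'n \<Rightarrow> real) set" where
  "H10 \<Omega> = {u \<in> H1 \<Omega>. \<exists>\<phi>. (\<forall>n::nat. \<phi> n \<in> test_functions \<Omega>) \<and>
      (\<lambda>n. H1_norm \<Omega> (\<lambda>x. \<phi> n x - u x)) \<longlonglongrightarrow> 0}"

text \<open>The dual of \<open>H10 \<Omega>\<close>; the duality pairing of \<open>F\<close> and \<open>v\<close> is the application \<open>F v\<close>.\<close>

definition H_minus1 :: "(real^'n) set \<Rightarrow> ((real^'n \<Rightarrow> real) \<Rightarrow> real) set" where
  "H_minus1 \<Omega> = {F.
      (\<forall>u\<in>H10 \<Omega>. \<forall>v\<in>H10 \<Omega>. \<forall>a b. F (\<lambda>x. a * u x + b * v x) = a * F u + b * F v) \<and>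
      (\<exists>C. \<forall>u\<in>H10 \<Omega>. \<bar>F u\<bar> \<le> C * H1_norm \<Omega> u)}"

text \<open>
  Near each boundary point, after an orthogonal change of coordinates, the set is the strict
  epigraph of a Lipschitz function.
\<close>

definition lipschitz_boundary :: "(real^2) set \<Rightarrow> bool" where
  "lipschitz_boundary \<Omega> \<longleftrightarrow>
    (\<forall>p\<in>frontier \<Omega>. \<exists>r>0. \<exists>(T :: real^2 \<Rightarrow> real^2) (h :: real \<Rightarrow> real) L. orthogonal_transformation T \<and> L-lipschitz_on UNIV h \<and>
      \<Omega> \<inter> ball p r = {x \<in> ball p r. T x $ 2 > h (T x $ 1)})"

definition gpow :: "real \<Rightarrow> real \<Rightarrow> real" where
  "gpow s \<delta> = (if \<delta> \<in> \<int> then s powi \<lfloor>\<delta>\<rfloor> else \<bar>s\<bar> powr \<delta>)"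

text \<open>
  The Bochner integral of a non-integrable function is \<open>0\<close> by convention, so that the two
  nonlinear integrals are well defined has to be said explicitly.
\<close>

definition weak_solution ::
  "(real^2) set \<Rightarrow> real \<Rightarrow> real \<Rightarrow> real \<Rightarrow> real \<Rightarrow> real \<Rightarrow> ((real^2 \<Rightarrow> real) \<Rightarrow> real) \<Rightarrow> (real^2 \<Rightarrow> real) \<Rightarrow> bool"
where
  "weak_solution \<Omega> \<nu> \<alpha> \<beta> \<delta> \<gamma> f u \<longleftrightarrow> u \<in> H10 \<Omega> \<and>
    (\<forall>v\<in>H10 \<Omega>.
      let convection = (\<lambda>x. gpow (u x) \<delta> * (\<Sum>i\<in>UNIV. weak_deriv \<Omega> i u x) * v x);
          reaction = (\<lambda>x. u x * (1 - gpow (u x) \<delta>) * (gpow (u x) \<delta> - \<gamma>) * v x)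
      in integrable (lebesgue_on \<Omega>) convection \<and> integrable (lebesgue_on \<Omega>) reaction \<and>
         \<nu> * grad_inner \<Omega> u v + \<alpha> * (\<integral>x. convection x \<partial>lebesgue_on \<Omega>)
           - \<beta> * (\<integral>x. reaction x \<partial>lebesgue_on \<Omega>) = f v)"

end

theory Submission
  imports Defs
begin

text \<open>
  Galerkin's method. For a test function \<open>u\<close> the convection term tested with \<open>u\<close> is the integral
  of a divergence, hence zero, and the reaction term is bounded above because
  \<open>s\<^sup>2 (1 - s\<^sup>\<delta>) (s\<^sup>\<delta> - \<gamma>) \<le> 1\<close>; this bounds the energy of the Galerkin solutions, which exist by
  Brouwer's theorem. By Rellich's theorem a subsequence converges in \<open>L\<^sup>2\<close> and almost everywhere to
  some \<open>u\<close>. In the plane all moments of functions of bounded energy are bounded (the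
  Gagliardo--Nirenberg inequality applied to powers), so every nonlinearity of polynomial growth
  converges in \<open>L\<^sup>2\<close>.

  Weak compactness is avoided. In the equation of the approximations all derivatives are moved to the
  smooth test function, which also removes them from the convection term, so strong \<open>L\<^sup>2\<close> convergence
  suffices for the limit. Energy-minimizing iterated midpoints of the approximations converge to \<open>u\<close>
  strongly in \<open>H1\<close>; hence \<open>u\<close> lies in \<open>H10\<close>, and the derivatives can be moved back.
\<close>

section \<open>Square-integrable functions\<close>

text \<open>The obstacle is that the Galerkin gradients converge at best weakly, while the
  convection term multiplies them by a nonlinear function of the solution. The term is nevertheless
  harmless: if \<Gamma> is an antiderivative of s^\<delta>, then u^\<delta> times the i-th
  derivative of u is the i-th derivative of \<Gamma>(u), and after integration by parts only u
  itself occurs. No exponent \<delta> is critical in the plane, because the L1 Sobolev inequality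
  for u^(k+1) bounds each even moment by the preceding one times the energy.

  The convergence principle is of Vitali type: on a set of finite measure, an L2 bound together with
  convergence almost everywhere gives convergence in L1. Applied to squared differences, which again
  have polynomial growth, it gives L2 convergence of the nonlinearities.

  The Galerkin spaces are spanned by a countable family that is dense in the C1 norm rather than by
  an orthonormal basis. One subsequence then serves all members of the family, and uniform closeness
  of a function and its derivatives implies closeness in H1 because the domain is bounded.\<close>

definition sq_integrable :: "'a measure \<Rightarrow> ('a \<Rightarrow> real) \<Rightarrow> bool" where
  "sq_integrable M f \<longleftrightarrow> f \<in> borel_measurable M \<and> integrable M (\<lambda>x. (f x)\<^sup>2)"

definition l2norm :: "'a measure \<Rightarrow> ('a \<Rightarrow> real) \<Rightarrow> real" where
  "l2norm M f = sqrt (\<integral>x. (f x)\<^sup>2 \<partial>M)"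

lemma L2_iff: "u \<in> L2 \<Omega> \<longleftrightarrow> sq_integrable (lebesgue_on \<Omega>) u"
  by (auto simp: L2_def sq_integrable_def)

lemma sq_integrable_measurable [measurable_dest]: "sq_integrable M f \<Longrightarrow> f \<in> borel_measurable M"
  by (simp add: sq_integrable_def)

lemma sq_integrable_sq: "sq_integrable M f \<Longrightarrow> integrable M (\<lambda>x. (f x)\<^sup>2)"
  by (simp add: sq_integrable_def)

lemma sq_integrable_mult:
  assumes "sq_integrable M f" "sq_integrable M g"
  shows "integrable M (\<lambda>x. f x * g x)"
proof (rule Bochner_Integration.integrable_bound)
  show "integrable M (\<lambda>x. (f x)\<^sup>2 + (g x)\<^sup>2)"
    using assms by (intro Bochner_Integration.integrable_add sq_integrable_sq)
  show "(\<lambda>x. f x * g x) \<in> borel_measurable M"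
    using assms by (intro borel_measurable_times sq_integrable_measurable)
  have "\<bar>a * b\<bar> \<le> a\<^sup>2 + b\<^sup>2" for a b :: real
    using sum_squares_bound[of "\<bar>a\<bar>" "\<bar>b\<bar>"] mult_nonneg_nonneg[of "\<bar>a\<bar>" "\<bar>b\<bar>"]
    unfolding power2_abs abs_mult by linarith
  then show "AE x in M. norm (f x * g x) \<le> norm ((f x)\<^sup>2 + (g x)\<^sup>2)"
    by (intro AE_I2) simp
qed

lemma sq_integrable_cmult: "sq_integrable M f \<Longrightarrow> sq_integrable M (\<lambda>x. c * f x)"
  by (auto simp: sq_integrable_def power_mult_distrib)

lemma sq_integrable_add:
  assumes "sq_integrable M f" "sq_integrable M g"
  shows "sq_integrable M (\<lambda>x. f x + g x)"
proof -
  have "integrable M (\<lambda>x. (f x)\<^sup>2 + (g x)\<^sup>2 + 2 * (f x * g x))"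
    using assms by (intro Bochner_Integration.integrable_add integrable_mult_right
        sq_integrable_sq sq_integrable_mult)
  also have "(\<lambda>x. (f x)\<^sup>2 + (g x)\<^sup>2 + 2 * (f x * g x)) = (\<lambda>x. (f x + g x)\<^sup>2)"
    by (auto simp: power2_eq_square algebra_simps)
  finally show ?thesis using assms by (auto simp: sq_integrable_def)
qed

lemma sq_integrable_uminus: "sq_integrable M f \<Longrightarrow> sq_integrable M (\<lambda>x. - f x)"
  using sq_integrable_cmult[of M f "-1"] by simp

lemma sq_integrable_diff:
  "sq_integrable M f \<Longrightarrow> sq_integrable M g \<Longrightarrow> sq_integrable M (\<lambda>x. f x - g x)"
  using sq_integrable_add[of M f "\<lambda>x. - g x"] sq_integrable_uminus[of M g] by simp

lemma sq_integrable_abs: "sq_integrable M f \<Longrightarrow> sq_integrable M (\<lambda>x. \<bar>f x\<bar>)"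
  by (auto simp: sq_integrable_def)

lemma sq_integrable_sum:
  "(\<And>i. i \<in> I \<Longrightarrow> sq_integrable M (f i)) \<Longrightarrow> sq_integrable M (\<lambda>x. \<Sum>i\<in>I. f i x)"
  by (induction I rule: infinite_finite_induct)
    (auto intro!: sq_integrable_add simp: sq_integrable_def[of M "\<lambda>x. 0"])

lemma nonneg_tendsto_0:
  fixes a b :: "nat \<Rightarrow> real"
  assumes "\<And>n. 0 \<le> a n" "\<And>n. a n \<le> b n" "b \<longlonglongrightarrow> 0"
  shows "a \<longlonglongrightarrow> 0"
  by (rule tendsto_sandwich[OF _ _ tendsto_const assms(3)]) (auto simp: assms(1,2))

lemma l2norm_nonneg [simp]: "l2norm M f \<ge> 0"
  by (simp add: l2norm_def)

lemma l2norm_sq: "(l2norm M f)\<^sup>2 = (\<integral>x. (f x)\<^sup>2 \<partial>M)"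
  by (simp add: l2norm_def)

lemma l2norm_cmult: "l2norm M (\<lambda>x. c * f x) = \<bar>c\<bar> * l2norm M f"
  by (simp add: l2norm_def power_mult_distrib real_sqrt_mult)

lemma l2norm_minus_commute: "l2norm M (\<lambda>x. f x - g x) = l2norm M (\<lambda>x. g x - f x)"
  by (simp add: l2norm_def power2_commute)

lemma l2norm_cong_AE:
  assumes "AE x in M. f x = g x" "f \<in> borel_measurable M" "g \<in> borel_measurable M"
  shows "l2norm M f = l2norm M g"
  unfolding l2norm_def using assms by (intro arg_cong[of _ _ sqrt] integral_cong_AE) auto

lemma Cauchy_Schwarz_integral:
  assumes f: "sq_integrable M f" and g: "sq_integrable M g"
  shows "\<bar>\<integral>x. f x * g x \<partial>M\<bar> \<le> l2norm M f * l2norm M g"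
proof -
  define a where "a = (\<integral>x. (f x)\<^sup>2 \<partial>M)"
  define b where "b = (\<integral>x. f x * g x \<partial>M)"
  define c where "c = (\<integral>x. (g x)\<^sup>2 \<partial>M)"
  \<comment> \<open>The discriminant argument: the integral of the square of f + t g is a
    nonnegative quadratic polynomial in t.\<close>
  have nonneg: "a + 2 * t * b + t\<^sup>2 * c \<ge> 0" for t
  proof -
    have "0 \<le> (\<integral>x. (f x + t * g x)\<^sup>2 \<partial>M)" by simp
    also have "(\<lambda>x. (f x + t * g x)\<^sup>2) = (\<lambda>x. (f x)\<^sup>2 + (2 * t) * (f x * g x) + t\<^sup>2 * (g x)\<^sup>2)"
      by (auto simp: power2_eq_square algebra_simps)
    also have "(\<integral>x. (f x)\<^sup>2 + (2 * t) * (f x * g x) + t\<^sup>2 * (g x)\<^sup>2 \<partial>M) = a + 2 * t * b + t\<^sup>2 * c"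
      unfolding a_def b_def c_def
      using sq_integrable_sq[OF f] sq_integrable_sq[OF g] sq_integrable_mult[OF f g] by simp
    finally show ?thesis .
  qed
  have "c \<ge> 0" "a \<ge> 0" by (auto simp: a_def c_def)
  have "b\<^sup>2 \<le> a * c"
  proof (cases "c = 0")
    case True
    have "b = 0"
    proof (rule ccontr)
      assume "b \<noteq> 0"
      \<comment> \<open>For c = 0 the polynomial is affine in t, and at this t it takes the value
        -1.\<close>
      then show False using nonneg[of "- (a + 1) / (2 * b)"] True by (simp add: field_simps)
    qed
    then show ?thesis using True by simp
  next
    case False
    then have "c > 0" using \<open>c \<ge> 0\<close> by simp
    \<comment> \<open>The minimizer of the quadratic polynomial.\<close>
    then show ?thesis using nonneg[of "- b / c"] by (simp add: field_simps power2_eq_square)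
  qed
  then have "sqrt (b\<^sup>2) \<le> sqrt (a * c)" by (simp only: real_sqrt_le_iff)
  then show ?thesis by (simp add: l2norm_def a_def b_def c_def real_sqrt_mult)
qed

lemma Cauchy_Schwarz_integral_abs:
  assumes f: "sq_integrable M f" and g: "sq_integrable M g"
  shows "(\<integral>x. \<bar>f x * g x\<bar> \<partial>M) \<le> l2norm M f * l2norm M g"
  using Cauchy_Schwarz_integral[OF sq_integrable_abs[OF f] sq_integrable_abs[OF g]]
  by (simp add: abs_mult l2norm_def)

lemma l2norm_triangle:
  assumes f: "sq_integrable M f" and g: "sq_integrable M g"
  shows "l2norm M (\<lambda>x. f x + g x) \<le> l2norm M f + l2norm M g"
proof (rule power2_le_imp_le)
  have "(l2norm M (\<lambda>x. f x + g x))\<^sup>2 = (\<integral>x. (f x)\<^sup>2 + (g x)\<^sup>2 + 2 * (f x * g x) \<partial>M)"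
    by (simp add: l2norm_sq power2_sum mult.assoc)
  also have "\<dots> = (l2norm M f)\<^sup>2 + (l2norm M g)\<^sup>2 + 2 * (\<integral>x. f x * g x \<partial>M)"
    using sq_integrable_sq[OF f] sq_integrable_sq[OF g] sq_integrable_mult[OF f g]
    by (simp add: l2norm_sq)
  also have "\<dots> \<le> (l2norm M f + l2norm M g)\<^sup>2"
    using Cauchy_Schwarz_integral[OF f g] by (simp add: power2_sum)
  finally show "(l2norm M (\<lambda>x. f x + g x))\<^sup>2 \<le> (l2norm M f + l2norm M g)\<^sup>2" .
qed simp

lemma l2norm_triangle_diff:
  assumes f: "sq_integrable M f" and g: "sq_integrable M g" and h: "sq_integrable M h"
  shows "l2norm M (\<lambda>x. f x - h x) \<le> l2norm M (\<lambda>x. f x - g x) + l2norm M (\<lambda>x. g x - h x)"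
  using l2norm_triangle[OF sq_integrable_diff[OF f g] sq_integrable_diff[OF g h]] by simp

lemma l2norm_triangle_sub:
  assumes f: "sq_integrable M f" and g: "sq_integrable M g"
  shows "l2norm M f \<le> l2norm M (\<lambda>x. f x - g x) + l2norm M g"
  using l2norm_triangle[OF sq_integrable_diff[OF f g] g] by simp

text \<open>Fatou's lemma for real integrals; the bound supplies the integrability of the limit as
  well. It is asked only from \<open>N\<close> on, because Cauchy estimates hold only from some
  index on.\<close>

lemma integral_Fatou_bound:
  fixes f :: "nat \<Rightarrow> 'a \<Rightarrow> real"
  assumes int: "\<And>n. integrable M (f n)" and nonneg: "\<And>n x. 0 \<le> f n x"
    and lim: "AE x in M. (\<lambda>n. f n x) \<longlonglongrightarrow> g x" and g: "g \<in> borel_measurable M"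
    and bound: "\<And>n. n \<ge> N \<Longrightarrow> (\<integral>x. f n x \<partial>M) \<le> C"
  shows "integrable M g" "(\<integral>x. g x \<partial>M) \<le> C"
proof -
  \<comment> \<open>Needed for the way back from \<open>ennreal\<close>, which sends negative reals
    to 0.\<close>
  have C: "C \<ge> 0" using bound[of N] Bochner_Integration.integral_nonneg[of M "f N"] nonneg
    by (meson order_refl order_trans)
  have g0: "AE x in M. 0 \<le> g x"
    using lim by eventually_elim (auto intro!: LIMSEQ_le_const nonneg)
  have "(\<integral>\<^sup>+x. ennreal (g x) \<partial>M) = (\<integral>\<^sup>+x. liminf (\<lambda>n. ennreal (f n x)) \<partial>M)"
    using lim
  proof (intro nn_integral_cong_AE, eventually_elim)
    case (elim x)
    then have "(\<lambda>n. ennreal (f n x)) \<longlonglongrightarrow> ennreal (g x)" by (intro tendsto_ennrealI)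
    then show ?case by (simp add: lim_imp_Liminf)
  qed
  also have "\<dots> \<le> liminf (\<lambda>n. \<integral>\<^sup>+x. ennreal (f n x) \<partial>M)"
    using int by (intro nn_integral_liminf) auto
  also have "\<dots> \<le> liminf (\<lambda>n::nat. ennreal C)"
  proof (rule Liminf_mono)
    show "\<forall>\<^sub>F n in sequentially. (\<integral>\<^sup>+x. ennreal (f n x) \<partial>M) \<le> ennreal C"
      using eventually_ge_at_top[of N]
      by eventually_elim (use bound int nonneg in \<open>auto simp: nn_integral_eq_integral intro!: ennreal_leI\<close>)
  qed
  also have "\<dots> = ennreal C" by (simp add: Liminf_const)
  finally have le: "(\<integral>\<^sup>+x. ennreal (g x) \<partial>M) \<le> ennreal C" .
  then show "integrable M g"
    using g g0 by (intro integrableI_nonneg) (auto simp: le_less_trans[OF _ ennreal_less_top])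
  then have "ennreal (\<integral>x. g x \<partial>M) \<le> ennreal C"
    using le g0 by (simp add: nn_integral_eq_integral)
  then show "(\<integral>x. g x \<partial>M) \<le> C" using C by (simp add: ennreal_le_iff)
qed

text \<open>The squares tend to zero in L1, so they do so almost everywhere along a
  subsequence.\<close>

lemma l2norm_tendsto_0_AE_subseq:
  assumes u: "\<And>n. sq_integrable M (u n)" and lim: "(\<lambda>n. l2norm M (u n)) \<longlonglongrightarrow> 0"
  shows "\<exists>r::nat\<Rightarrow>nat. strict_mono r \<and> (AE x in M. (\<lambda>n. u (r n) x) \<longlonglongrightarrow> 0)"
proof -
  have "(\<lambda>n. (l2norm M (u n))\<^sup>2) \<longlonglongrightarrow> 0\<^sup>2" by (intro tendsto_power lim)
  then have "(\<lambda>n. \<integral>x. norm ((u n x)\<^sup>2) \<partial>M) \<longlonglongrightarrow> 0" by (simp add: l2norm_sq)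
  from tendsto_L1_AE_subseq[OF sq_integrable_sq[OF u] this]
  obtain r :: "nat \<Rightarrow> nat" where r: "strict_mono r" "AE x in M. (\<lambda>n. (u (r n) x)\<^sup>2) \<longlonglongrightarrow> 0" by auto
  have "AE x in M. (\<lambda>n. u (r n) x) \<longlonglongrightarrow> 0"
    using r(2)
  proof eventually_elim
    case (elim x)
    from tendsto_real_sqrt[OF this] show ?case by (simp add: tendsto_rabs_zero_iff)
  qed
  with r(1) show ?thesis by blast
qed

lemma (in finite_measure) l1_le_l2norm:
  assumes "sq_integrable M f"
  shows "integrable M f" "(\<integral>x. \<bar>f x\<bar> \<partial>M) \<le> sqrt (measure M (space M)) * l2norm M f"
proof -
  have 1: "sq_integrable M (\<lambda>x. 1)" by (simp add: sq_integrable_def)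
  show "integrable M f" using sq_integrable_mult[OF assms 1] by simp
  show "(\<integral>x. \<bar>f x\<bar> \<partial>M) \<le> sqrt (measure M (space M)) * l2norm M f"
    using Cauchy_Schwarz_integral_abs[OF assms 1] by (simp add: l2norm_def mult.commute)
qed

text \<open>The Riesz-Fischer argument. Along a fast Cauchy subsequence the increments are summable
  in L2, hence in L1 as the measure is finite, and the telescoping series converges almost
  everywhere.\<close>

lemma (in finite_measure) sq_integrable_complete:
  assumes u: "\<And>n. sq_integrable M (u n)"
    and Cauchy: "\<And>e. e > 0 \<Longrightarrow> \<exists>N. \<forall>m\<ge>N. \<forall>n\<ge>N. l2norm M (\<lambda>x. u m x - u n x) < e"
  shows "\<exists>v. sq_integrable M v \<and> (\<lambda>n. l2norm M (\<lambda>x. u n x - v x)) \<longlonglongrightarrow> 0"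
proof -
  have "\<exists>N. \<forall>k. (\<forall>m\<ge>N k. \<forall>n\<ge>N k. l2norm M (\<lambda>x. u m x - u n x) < (1/2)^k)"
    by (intro choice allI Cauchy) simp
  then obtain N where N: "\<And>k m n. m \<ge> N k \<Longrightarrow> n \<ge> N k \<Longrightarrow> l2norm M (\<lambda>x. u m x - u n x) < (1/2)^k"
    by blast
  \<comment> \<open>Summing all thresholds up to k makes \<open>r\<close> monotone as well as at
    least \<open>N\<close>.\<close>
  define r where "r k = (\<Sum>j\<le>k. N j) + k" for k
  have rN: "r k \<ge> N k" for k unfolding r_def by (induction k) auto
  have rmono: "r k \<le> r (Suc k)" for k by (simp add: r_def)
  define d where "d k x = u (r (Suc k)) x - u (r k) x" for k x
  have [measurable]: "u n \<in> borel_measurable M" for n using u by (rule sq_integrable_measurable)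
  have d: "sq_integrable M (d k)" for k unfolding d_def using u by (intro sq_integrable_diff)
  have dk: "l2norm M (d k) \<le> (1/2)^k" for k
    unfolding d_def using N[of k "r (Suc k)" "r k"] rN rmono order_trans by (meson less_imp_le)
  have [measurable]: "d n \<in> borel_measurable M" for n using d by (rule sq_integrable_measurable)
  define S where "S = sqrt (measure M (space M))"
  have "S \<ge> 0" by (simp add: S_def)
  have "(\<integral>\<^sup>+x. (\<Sum>k. ennreal \<bar>d k x\<bar>) \<partial>M) = (\<Sum>k. \<integral>\<^sup>+x. ennreal \<bar>d k x\<bar> \<partial>M)"
    by (intro nn_integral_suminf) auto
  also have "\<dots> \<le> (\<Sum>k. ennreal (S * (1/2)^k))"
  proof (intro suminf_le allI)
    fix k
    have "(\<integral>\<^sup>+x. ennreal \<bar>d k x\<bar> \<partial>M) = ennreal (\<integral>x. \<bar>d k x\<bar> \<partial>M)"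
      using l1_le_l2norm(1)[OF d] by (intro nn_integral_eq_integral) auto
    also have "\<dots> \<le> ennreal (S * l2norm M (d k))"
      using l1_le_l2norm(2)[OF d] by (intro ennreal_leI) (simp add: S_def)
    also have "\<dots> \<le> ennreal (S * (1/2)^k)"
      by (intro ennreal_leI mult_left_mono dk \<open>S \<ge> 0\<close>)
    finally show "(\<integral>\<^sup>+x. ennreal \<bar>d k x\<bar> \<partial>M) \<le> ennreal (S * (1/2)^k)" .
  qed auto
  also have "\<dots> = ennreal (\<Sum>k. S * (1/2)^k)"
    using \<open>S \<ge> 0\<close> by (intro suminf_ennreal2 summable_mult summable_geometric) auto
  also have "\<dots> < \<infinity>" by simp
  finally have "AE x in M. (\<Sum>k. ennreal \<bar>d k x\<bar>) \<noteq> \<infinity>"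
    by (intro nn_integral_PInf_AE) auto
  then have conv: "AE x in M. convergent (\<lambda>k. u (r k) x)"
  proof eventually_elim
    case (elim x)
    then have "summable (\<lambda>k. \<bar>d k x\<bar>)"
      by (intro summable_suminf_not_top) auto
    then have "summable (\<lambda>k. d k x)" by (rule summable_rabs_cancel)
    then have "convergent (\<lambda>n. \<Sum>k<n. d k x)" by (simp add: summable_iff_convergent)
    also have "(\<lambda>n. \<Sum>k<n. d k x) = (\<lambda>n. u (r n) x - u (r 0) x)"
      unfolding d_def by (rule ext) (rule sum_lessThan_telescope)
    finally have "convergent (\<lambda>n. u (r n) x - u (r 0) x + u (r 0) x)"
      by (intro convergent_add convergent_const)
    then show ?case by simp
  qed
  define v where "v x = lim (\<lambda>k. u (r k) x)" for x
  have v [measurable]: "v \<in> borel_measurable M" unfolding v_def by measurable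
  have lim: "AE x in M. (\<lambda>k. u (r k) x) \<longlonglongrightarrow> v x"
    using conv by eventually_elim (simp add: v_def convergent_LIMSEQ_iff)
  \<comment> \<open>Fatou in the second index: the Cauchy bound between \<open>u n\<close> and
    \<open>u (r j)\<close> survives the limit in j. It holds for all large n, so the whole sequence
    converges and not only the subsequence.\<close>
  have key: "integrable M (\<lambda>x. (u n x - v x)\<^sup>2) \<and> (\<integral>x. (u n x - v x)\<^sup>2 \<partial>M) \<le> ((1/2)^k)\<^sup>2"
    if "n \<ge> N k" for n k
  proof -
    have i1: "integrable M (\<lambda>x. (u n x - u (r j) x)\<^sup>2)" for j
      using u by (intro sq_integrable_sq sq_integrable_diff)
    have i2: "AE x in M. (\<lambda>j. (u n x - u (r j) x)\<^sup>2) \<longlonglongrightarrow> (u n x - v x)\<^sup>2"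
      using lim by eventually_elim (intro tendsto_intros)
    have i3: "(\<integral>x. (u n x - u (r j) x)\<^sup>2 \<partial>M) \<le> ((1/2)^k)\<^sup>2" if "j \<ge> k" for j
    proof -
      have "r j \<ge> r k" using that by (induction rule: dec_induct) (use rmono order_trans in blast)+
      then have "l2norm M (\<lambda>x. u n x - u (r j) x) < (1/2)^k"
        using \<open>n \<ge> N k\<close> rN[of k] by (intro N) auto
      then have "(l2norm M (\<lambda>x. u n x - u (r j) x))\<^sup>2 \<le> ((1/2)^k)\<^sup>2"
        by (intro power_mono) auto
      then show ?thesis by (simp add: l2norm_sq)
    qed
    have i4: "(\<lambda>x. (u n x - v x)\<^sup>2) \<in> borel_measurable M" by measurable
    have "integrable M (\<lambda>x. (u n x - v x)\<^sup>2)"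
      by (rule integral_Fatou_bound(1)[where f="\<lambda>j x. (u n x - u (r j) x)\<^sup>2" and N=k and C="((1/2)^k)\<^sup>2"])
        (fact i1 zero_le_power2 i2 i4 i3)+
    moreover have "(\<integral>x. (u n x - v x)\<^sup>2 \<partial>M) \<le> ((1/2)^k)\<^sup>2"
      by (rule integral_Fatou_bound(2)[where f="\<lambda>j x. (u n x - u (r j) x)\<^sup>2" and N=k and C="((1/2)^k)\<^sup>2"])
        (fact i1 zero_le_power2 i2 i4 i3)+
    ultimately show ?thesis ..
  qed
  have "sq_integrable M (\<lambda>x. u (N 0) x - v x)" using key[of 0 "N 0"] by (simp add: sq_integrable_def)
  from sq_integrable_diff[OF u[of "N 0"] this] have sv: "sq_integrable M v" by simp
  have "(\<lambda>n. l2norm M (\<lambda>x. u n x - v x)) \<longlonglongrightarrow> 0"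
  proof (rule LIMSEQ_I)
    fix e :: real assume "e > 0"
    have "(1/2::real) < 1" by simp
    from real_arch_pow_inv[OF \<open>e > 0\<close> this] obtain k where k: "(1/2)^k < e" by blast
    have "norm (l2norm M (\<lambda>x. u n x - v x) - 0) < e" if "n \<ge> N k" for n
    proof -
      have "l2norm M (\<lambda>x. u n x - v x) \<le> (1/2)^k"
        using conjunct2[OF key[OF that]] unfolding l2norm_sq[symmetric]
        by (rule power2_le_imp_le) simp
      then show ?thesis using k by simp
    qed
    then show "\<exists>no. \<forall>n\<ge>no. norm (l2norm M (\<lambda>x. u n x - v x) - 0) < e" by blast
  qed
  with sv show ?thesis by blast
qed

text \<open>Truncation at height \<open>K\<close>: the part above contributes at most \<open>C / K\<close>.\<close>

lemma (in finite_measure) l1_tendsto_0_of_l2_bounded: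
  assumes h: "\<And>n. sq_integrable M (h n)" and bound: "\<And>n. (\<integral>x. (h n x)\<^sup>2 \<partial>M) \<le> C"
    and lim: "AE x in M. (\<lambda>n. h n x) \<longlonglongrightarrow> 0"
  shows "(\<lambda>n. \<integral>x. \<bar>h n x\<bar> \<partial>M) \<longlonglongrightarrow> 0"
proof (rule LIMSEQ_I)
  fix e :: real assume "e > 0"
  have "C \<ge> 0" using bound[of 0] by (meson Bochner_Integration.integral_nonneg order_trans zero_le_power2)
  \<comment> \<open>The part above height K costs at most C / K, which this choice makes smaller
    than e / 2; the added 1 keeps K positive when C = 0.\<close>
  define K where "K = (2 * C + 1) / e"
  have "K > 0" using \<open>C \<ge> 0\<close> \<open>e > 0\<close> by (simp add: K_def)
  have CK: "C / K < e / 2" using \<open>C \<ge> 0\<close> \<open>e > 0\<close> by (simp add: K_def field_simps)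
  have [measurable]: "h n \<in> borel_measurable M" for n using h by (rule sq_integrable_measurable)
  have "(\<lambda>n. \<integral>x. min \<bar>h n x\<bar> K \<partial>M) \<longlonglongrightarrow> (\<integral>x. 0 \<partial>M)"
  proof (rule integral_dominated_convergence[where w="\<lambda>x. K"])
    show "AE x in M. (\<lambda>n. min \<bar>h n x\<bar> K) \<longlonglongrightarrow> 0"
      using lim
    proof eventually_elim
      case (elim x)
      have "(\<lambda>n. min \<bar>h n x\<bar> K) \<longlonglongrightarrow> min \<bar>0\<bar> K" by (intro tendsto_intros elim)
      then show ?case using \<open>K > 0\<close> by simp
    qed
    show "AE x in M. norm (min \<bar>h n x\<bar> K) \<le> K" for n using \<open>K > 0\<close> by auto
  qed auto
  then have "\<forall>\<^sub>F n in sequentially. (\<integral>x. min \<bar>h n x\<bar> K \<partial>M) < e / 2"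
    using \<open>e > 0\<close> by (intro order_tendstoD(2)) auto
  then obtain N where N: "\<And>n. n \<ge> N \<Longrightarrow> (\<integral>x. min \<bar>h n x\<bar> K \<partial>M) < e / 2"
    by (auto simp: eventually_sequentially)
  have "norm ((\<integral>x. \<bar>h n x\<bar> \<partial>M) - 0) < e" if "n \<ge> N" for n
  proof -
    have imin: "integrable M (\<lambda>x. min \<bar>h n x\<bar> K)"
      using \<open>K > 0\<close> by (intro integrable_const_bound[where B=K]) auto
    have "(\<integral>x. \<bar>h n x\<bar> \<partial>M) \<le> (\<integral>x. min \<bar>h n x\<bar> K + (h n x)\<^sup>2 / K \<partial>M)"
    proof (rule integral_mono)
      show "integrable M (\<lambda>x. \<bar>h n x\<bar>)" using l1_le_l2norm(1)[OF h] by auto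
      show "integrable M (\<lambda>x. min \<bar>h n x\<bar> K + (h n x)\<^sup>2 / K)"
        using imin sq_integrable_sq[OF h] by auto
      show "\<bar>h n x\<bar> \<le> min \<bar>h n x\<bar> K + (h n x)\<^sup>2 / K" for x
      proof (cases "\<bar>h n x\<bar> \<le> K")
        case False
        then have "K * \<bar>h n x\<bar> \<le> \<bar>h n x\<bar> * \<bar>h n x\<bar>" by (intro mult_right_mono) auto
        then have "K * \<bar>h n x\<bar> \<le> (h n x)\<^sup>2" by (simp add: power2_eq_square)
        then have "\<bar>h n x\<bar> \<le> (h n x)\<^sup>2 / K" using \<open>K > 0\<close> by (simp add: field_simps)
        then show ?thesis using \<open>K > 0\<close> by linarith
      qed (use \<open>K > 0\<close> in auto)
    qed
    also have "\<dots> = (\<integral>x. min \<bar>h n x\<bar> K \<partial>M) + (\<integral>x. (h n x)\<^sup>2 \<partial>M) / K"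
      using imin sq_integrable_sq[OF h] by simp
    also have "\<dots> < e / 2 + e / 2"
      using N[OF that] CK divide_right_mono[OF bound[of n] less_imp_le[OF \<open>K > 0\<close>]] by linarith
    finally show ?thesis by simp
  qed
  then show "\<exists>no. \<forall>n\<ge>no. norm ((\<integral>x. \<bar>h n x\<bar> \<partial>M) - 0) < e" by blast
qed

text \<open>Expanding the product around its limit leaves three terms, each controlled by
  Cauchy-Schwarz. All later limits of the equation are pairings of this kind; a factor that does not
  vary enters as a constant sequence.\<close>

lemma integral_mult_tendsto:
  assumes "\<And>n. sq_integrable M (f n)" "sq_integrable M f'" "\<And>n. sq_integrable M (g n)" "sq_integrable M g'"
    and lf: "(\<lambda>n. l2norm M (\<lambda>x. f n x - f' x)) \<longlonglongrightarrow> 0"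
    and lg: "(\<lambda>n. l2norm M (\<lambda>x. g n x - g' x)) \<longlonglongrightarrow> 0"
  shows "(\<lambda>n. \<integral>x. f n x * g n x \<partial>M) \<longlonglongrightarrow> (\<integral>x. f' x * g' x \<partial>M)"
proof -
  define F where "F n = l2norm M (\<lambda>x. f n x - f' x)" for n
  define G where "G n = l2norm M (\<lambda>x. g n x - g' x)" for n
  have "(\<lambda>n. (\<integral>x. f n x * g n x \<partial>M) - (\<integral>x. f' x * g' x \<partial>M)) \<longlonglongrightarrow> 0"
  proof (rule Lim_null_comparison)
    show "(\<lambda>n. F n * G n + F n * l2norm M g' + l2norm M f' * G n) \<longlonglongrightarrow> 0"
      using lf lg unfolding F_def G_def by (auto intro!: tendsto_eq_intros)
    have "norm ((\<integral>x. f n x * g n x \<partial>M) - (\<integral>x. f' x * g' x \<partial>M))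
        \<le> F n * G n + F n * l2norm M g' + l2norm M f' * G n" for n
    proof -
      note s = sq_integrable_diff[OF assms(1)[of n] assms(2)] sq_integrable_diff[OF assms(3)[of n] assms(4)]
      have "(\<integral>x. f n x * g n x \<partial>M) - (\<integral>x. f' x * g' x \<partial>M)
          = (\<integral>x. f n x * g n x - f' x * g' x \<partial>M)"
        by (intro Bochner_Integration.integral_diff[symmetric] sq_integrable_mult assms)
      also have "\<dots> = (\<integral>x. (f n x - f' x) * (g n x - g' x) + (f n x - f' x) * g' x + f' x * (g n x - g' x) \<partial>M)"
        by (intro arg_cong[of _ _ "lebesgue_integral M"] ext) (simp add: algebra_simps)
      also have "\<dots> = (\<integral>x. (f n x - f' x) * (g n x - g' x) \<partial>M) + (\<integral>x. (f n x - f' x) * g' x \<partial>M)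
          + (\<integral>x. f' x * (g n x - g' x) \<partial>M)"
        using sq_integrable_mult[OF s] sq_integrable_mult[OF s(1) assms(4)] sq_integrable_mult[OF assms(2) s(2)]
        by (subst Bochner_Integration.integral_add, simp, simp, subst Bochner_Integration.integral_add) auto
      finally show ?thesis
        using Cauchy_Schwarz_integral[OF s] Cauchy_Schwarz_integral[OF s(1) assms(4)]
          Cauchy_Schwarz_integral[OF assms(2) s(2)]
        unfolding F_def G_def by (simp add: abs_le_iff)
    qed
    then show "\<forall>\<^sub>F n in sequentially. norm ((\<integral>x. f n x * g n x \<partial>M) - (\<integral>x. f' x * g' x \<partial>M))
        \<le> F n * G n + F n * l2norm M g' + l2norm M f' * G n" by simp
  qed
  then show ?thesis by (simp add: LIM_zero_iff)
qed

section \<open>Partial derivatives and test functions\<close>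

lemma partial_deriv_eqI: "(f has_derivative D) (at x) \<Longrightarrow> partial_deriv i f x = D (axis i 1)"
  using frechet_derivative_at[of f D x] by (simp add: partial_deriv_def)

lemma has_derivative_frechet:
  "f differentiable (at x) \<Longrightarrow> (f has_derivative frechet_derivative f (at x)) (at x)"
  by (simp add: frechet_derivative_works)

lemma partial_deriv_const [simp]: "partial_deriv i (\<lambda>x. c) = (\<lambda>x. 0)"
  by (simp add: partial_deriv_def fun_eq_iff)

lemma partial_deriv_add:
  assumes "f differentiable (at x)" "g differentiable (at x)"
  shows "partial_deriv i (\<lambda>x. f x + g x) x = partial_deriv i f x + partial_deriv i g x"
proof -
  have "((\<lambda>x. f x + g x) has_derivative
      (\<lambda>h. frechet_derivative f (at x) h + frechet_derivative g (at x) h)) (at x)"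
    by (rule has_derivative_add[OF has_derivative_frechet[OF assms(1)] has_derivative_frechet[OF assms(2)]])
  from partial_deriv_eqI[OF this, of i] show ?thesis by (simp add: partial_deriv_def)
qed

lemma partial_deriv_mult:
  fixes f g :: "real^'n \<Rightarrow> real"
  assumes "f differentiable (at x)" "g differentiable (at x)"
  shows "partial_deriv i (\<lambda>x. f x * g x) x = partial_deriv i f x * g x + f x * partial_deriv i g x"
proof -
  have "((\<lambda>x. f x * g x) has_derivative
      (\<lambda>h. f x * frechet_derivative g (at x) h + frechet_derivative f (at x) h * g x)) (at x)"
    by (rule has_derivative_mult[OF has_derivative_frechet[OF assms(1)] has_derivative_frechet[OF assms(2)]])
  from partial_deriv_eqI[OF this, of i] show ?thesis by (simp add: partial_deriv_def)
qed

lemma has_derivative_scalar_chain: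
  fixes f :: "'a::real_normed_vector \<Rightarrow> real"
  assumes "f differentiable (at x)" "(g has_real_derivative d) (at (f x))"
  shows "((\<lambda>x. g (f x)) has_derivative (\<lambda>h. d * frechet_derivative f (at x) h)) (at x)"
  using has_derivative_compose[OF has_derivative_frechet[OF assms(1)] has_field_derivative_imp_has_derivative[OF assms(2)]]
  .

lemma partial_deriv_chain:
  assumes "f differentiable (at x)" "(g has_real_derivative d) (at (f x))"
  shows "partial_deriv i (\<lambda>x. g (f x)) x = d * partial_deriv i f x"
  by (subst partial_deriv_eqI[OF has_derivative_scalar_chain[OF assms]]) (simp add: partial_deriv_def)

lemma partial_deriv_cong_open:
  assumes "open S" "x \<in> S" "f differentiable (at x)" "\<And>y. y \<in> S \<Longrightarrow> f y = g y"
  shows "partial_deriv i f x = partial_deriv i g x"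
proof -
  have "(g has_derivative frechet_derivative f (at x)) (at x)"
    by (rule has_derivative_transform_within_open[OF has_derivative_frechet[OF assms(3)] assms(1,2)]) (rule assms(4))
  from partial_deriv_eqI[OF this, of i] show ?thesis by (simp add: partial_deriv_def)
qed

lemma Ck_Suc_imp_Ck: "Ck (Suc k) f \<Longrightarrow> Ck k f"
proof (induction k arbitrary: f)
  case 0
  then have "f differentiable_on UNIV" by (simp add: differentiable_on_def)
  then show ?case by (simp add: differentiable_imp_continuous_on)
next
  case (Suc k)
  show ?case
    unfolding Ck.simps(2)[of k]
  proof (intro conjI allI)
    show "f differentiable (at x)" for x using Suc.prems by simp
    have "\<forall>i. Ck (Suc k) (partial_deriv i f)"
      using Suc.prems unfolding Ck.simps(2)[of "Suc k"] by (rule conjunct2)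
    then show "Ck k (partial_deriv i f)" for i by (intro Suc.IH) (rule spec)
  qed
qed

lemma Ck_const: "Ck k (\<lambda>x. c)"
  by (induction k arbitrary: c) auto

lemma Ck_add: "Ck k f \<Longrightarrow> Ck k g \<Longrightarrow> Ck k (\<lambda>x. f x + g x)"
proof (induction k arbitrary: f g)
  case (Suc k)
  have eq: "partial_deriv i (\<lambda>x. f x + g x) = (\<lambda>x. partial_deriv i f x + partial_deriv i g x)" for i
    using Suc.prems by (intro ext partial_deriv_add) auto
  show ?case using Suc by (simp add: eq)
qed (simp add: continuous_on_add)

lemma Ck_mult: "Ck k f \<Longrightarrow> Ck k g \<Longrightarrow> Ck k (\<lambda>x. f x * g x)"
proof (induction k arbitrary: f g)
  case (Suc k)
  have eq: "partial_deriv i (\<lambda>x. f x * g x) = (\<lambda>x. partial_deriv i f x * g x + f x * partial_deriv i g x)" for i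
    using Suc.prems by (intro ext partial_deriv_mult) auto
  have "Ck k f" "Ck k g" using Suc.prems by (auto intro: Ck_Suc_imp_Ck)
  then show ?case using Suc by (simp add: eq Ck_add)
qed (simp add: continuous_on_mult)

lemma Ck_prod: "(\<And>j. j \<in> J \<Longrightarrow> Ck k (f j)) \<Longrightarrow> Ck k (\<lambda>x. \<Prod>j\<in>J. f j x)"
  by (induction J rule: infinite_finite_induct) (auto intro!: Ck_mult simp: Ck_const)

text \<open>The function comes together with all its derivatives, as the family \<open>d\<close>, so
  that the induction over k can pass from \<open>d m\<close> to \<open>d (Suc m)\<close>.\<close>

lemma Ck_smooth_comp_coordinate:
  assumes "\<And>m t. (d m has_real_derivative d (Suc m) t) (at t)"
  shows "Ck k (\<lambda>x::real^'n. d m (a * x $ j + b))"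
proof (induction k arbitrary: m)
  case 0
  have "continuous_on UNIV (d m)"
    using assms DERIV_isCont continuous_at_imp_continuous_on by blast
  then show ?case
    by (auto intro!: continuous_on_compose2[of UNIV "d m"] continuous_intros)
next
  case (Suc k)
  have D: "((\<lambda>x::real^'n. d m (a * x $ j + b)) has_derivative (\<lambda>h. d (Suc m) (a * x $ j + b) * (a * h $ j))) (at x)" for x
  proof -
    have "((\<lambda>x::real^'n. a * x $ j + b) has_derivative (\<lambda>h. a * h $ j)) (at x)"
      by (auto intro!: derivative_eq_intros bounded_linear_imp_has_derivative bounded_linear_vec_nth)
    from has_derivative_compose[OF this has_field_derivative_imp_has_derivative[OF assms]]
    show ?thesis by simp
  qed
  have eq: "partial_deriv i (\<lambda>x::real^'n. d m (a * x $ j + b)) = (\<lambda>x. (a * axis i 1 $ j) * d (Suc m) (a * x $ j + b))" for i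
    by (rule ext, subst partial_deriv_eqI[OF D]) simp
  have "(\<lambda>x::real^'n. d m (a * x $ j + b)) differentiable (at x)" for x
    using D by (auto simp: differentiable_def)
  then show ?case using Suc by (simp add: eq Ck_mult Ck_const)
qed

text \<open>This class, unlike the smooth test functions, is stable under composition with C1
  functions that vanish at 0. Such compositions occur with the antiderivatives of the nonlinearity,
  which are not smooth for non-integer \<delta>.\<close>

definition C1c :: "(real^'n) set \<Rightarrow> (real^'n \<Rightarrow> real) set" where
  "C1c \<Omega> = {\<phi>. (\<forall>x. \<phi> differentiable (at x)) \<and> (\<forall>i. continuous_on UNIV (partial_deriv i \<phi>)) \<and>
     (\<exists>K. compact K \<and> K \<subseteq> \<Omega> \<and> (\<forall>x. x \<notin> K \<longrightarrow> \<phi> x = 0))}"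

lemma C1c_differentiable: "\<phi> \<in> C1c \<Omega> \<Longrightarrow> \<phi> differentiable (at x)"
  by (simp add: C1c_def)

lemma C1c_continuous_partial: "\<phi> \<in> C1c \<Omega> \<Longrightarrow> continuous_on UNIV (partial_deriv i \<phi>)"
  by (simp add: C1c_def)

lemma C1c_continuous: "\<phi> \<in> C1c \<Omega> \<Longrightarrow> continuous_on UNIV \<phi>"
  by (intro differentiable_imp_continuous_on) (simp add: differentiable_on_def C1c_def)

lemma C1c_borel_measurable: "\<phi> \<in> C1c \<Omega> \<Longrightarrow> \<phi> \<in> borel_measurable borel"
  by (intro borel_measurable_continuous_onI C1c_continuous)

lemma C1c_partial_borel_measurable: "\<phi> \<in> C1c \<Omega> \<Longrightarrow> partial_deriv i \<phi> \<in> borel_measurable borel"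
  by (intro borel_measurable_continuous_onI C1c_continuous_partial)

lemma partial_deriv_outside:
  assumes "compact K" "\<And>x. x \<notin> K \<Longrightarrow> \<phi> x = 0" "\<phi> differentiable (at x)" "x \<notin> K"
  shows "partial_deriv i \<phi> x = 0"
  using partial_deriv_cong_open[of "- K" x \<phi> "\<lambda>x. 0" i] assms by (simp add: compact_imp_closed open_Compl)

lemma C1c_support:
  assumes "\<phi> \<in> C1c \<Omega>"
  obtains K where "compact K" "K \<subseteq> \<Omega>" "\<And>x. x \<notin> K \<Longrightarrow> \<phi> x = 0" "\<And>x i. x \<notin> K \<Longrightarrow> partial_deriv i \<phi> x = 0"
proof -
  obtain K where K: "compact K" "K \<subseteq> \<Omega>" "\<And>x. x \<notin> K \<Longrightarrow> \<phi> x = 0"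
    using assms unfolding C1c_def by blast
  moreover have "partial_deriv i \<phi> x = 0" if "x \<notin> K" for x i
    using partial_deriv_outside[OF K(1,3) C1c_differentiable[OF assms] that] by blast
  ultimately show ?thesis using that by blast
qed

lemma C1c_zero_outside: "\<phi> \<in> C1c \<Omega> \<Longrightarrow> x \<notin> \<Omega> \<Longrightarrow> \<phi> x = 0"
  by (erule C1c_support) blast

lemma C1c_partial_zero_outside: "\<phi> \<in> C1c \<Omega> \<Longrightarrow> x \<notin> \<Omega> \<Longrightarrow> partial_deriv i \<phi> x = 0"
  by (erule C1c_support) blast

lemma bounded_of_compact_support:
  fixes f :: "'a::topological_space \<Rightarrow> real"
  assumes "continuous_on UNIV f" "compact K" "\<And>x. x \<notin> K \<Longrightarrow> f x = 0"
  obtains B where "B > 0" "\<And>x. \<bar>f x\<bar> \<le> B"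
proof -
  have "compact (f ` K)" using assms by (intro compact_continuous_image continuous_on_subset[OF assms(1)]) auto
  then have "bounded (f ` K)" by (rule compact_imp_bounded)
  then obtain B where B: "B > 0" "\<And>y. y \<in> f ` K \<Longrightarrow> norm y \<le> B" by (auto simp: bounded_pos)
  have "\<bar>f x\<bar> \<le> B" for x using B assms(3)[of x] by (cases "x \<in> K") auto
  with B(1) that show ?thesis by blast
qed

lemma C1c_bounded:
  assumes "\<phi> \<in> C1c \<Omega>"
  obtains B where "B > 0" "\<And>x. \<bar>\<phi> x\<bar> \<le> B"
proof -
  obtain K where K: "compact K" "\<And>x. x \<notin> K \<Longrightarrow> \<phi> x = 0" using C1c_support[OF assms] by metis
  show ?thesis by (rule bounded_of_compact_support[OF C1c_continuous[OF assms] K]) (use that in auto)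
qed

lemma C1c_bounded_partial:
  assumes "\<phi> \<in> C1c \<Omega>"
  obtains B where "B > 0" "\<And>x. \<bar>partial_deriv i \<phi> x\<bar> \<le> B"
proof -
  obtain K where K: "compact K" "\<And>x. x \<notin> K \<Longrightarrow> partial_deriv i \<phi> x = 0" using C1c_support[OF assms] by metis
  show ?thesis
    by (rule bounded_of_compact_support[OF C1c_continuous_partial[OF assms] K]) (use that in auto)
qed

lemma C1c_add:
  assumes f: "f \<in> C1c \<Omega>" and g: "g \<in> C1c \<Omega>"
  shows "(\<lambda>x. f x + g x) \<in> C1c \<Omega>"
proof -
  obtain K where K: "compact K" "K \<subseteq> \<Omega>" "\<And>x. x \<notin> K \<Longrightarrow> f x = 0" using f unfolding C1c_def by blast
  obtain L where L: "compact L" "L \<subseteq> \<Omega>" "\<And>x. x \<notin> L \<Longrightarrow> g x = 0" using g unfolding C1c_def by blast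
  have eq: "partial_deriv i (\<lambda>x. f x + g x) = (\<lambda>x. partial_deriv i f x + partial_deriv i g x)" for i
    using f g by (intro ext partial_deriv_add) (auto simp: C1c_def)
  have "compact (K \<union> L)" "K \<union> L \<subseteq> \<Omega>" "\<forall>x. x \<notin> K \<union> L \<longrightarrow> f x + g x = 0" using K L by auto
  then have "\<exists>K. compact K \<and> K \<subseteq> \<Omega> \<and> (\<forall>x. x \<notin> K \<longrightarrow> f x + g x = 0)" by blast
  then show ?thesis using f g by (auto simp: C1c_def eq continuous_on_add)
qed

lemma C1c_mult:
  assumes f: "f \<in> C1c \<Omega>" and g: "\<And>x. g differentiable (at x)" "\<And>i. continuous_on UNIV (partial_deriv i g)"
  shows "(\<lambda>x. f x * g x) \<in> C1c \<Omega>"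
proof -
  obtain K where K: "compact K" "K \<subseteq> \<Omega>" "\<And>x. x \<notin> K \<Longrightarrow> f x = 0" using f unfolding C1c_def by blast
  have eq: "partial_deriv i (\<lambda>x. f x * g x) = (\<lambda>x. partial_deriv i f x * g x + f x * partial_deriv i g x)" for i
    using f g by (intro ext partial_deriv_mult) (auto simp: C1c_def)
  have "\<exists>K. compact K \<and> K \<subseteq> \<Omega> \<and> (\<forall>x. x \<notin> K \<longrightarrow> f x * g x = 0)" using K by auto
  moreover have "continuous_on UNIV f" "continuous_on UNIV g"
    using C1c_continuous[OF f] differentiable_imp_continuous_on[of g UNIV] g by (auto simp: differentiable_on_def)
  ultimately show ?thesis using f g by (auto simp: C1c_def eq intro!: continuous_intros)
qed

lemma C1c_cmult: "f \<in> C1c \<Omega> \<Longrightarrow> (\<lambda>x. c * f x) \<in> C1c \<Omega>"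
  using C1c_mult[of f \<Omega> "\<lambda>x. c"] by (simp add: mult.commute)

lemma C1c_diff: "f \<in> C1c \<Omega> \<Longrightarrow> g \<in> C1c \<Omega> \<Longrightarrow> (\<lambda>x. f x - g x) \<in> C1c \<Omega>"
  using C1c_add[of f \<Omega> "\<lambda>x. -1 * g x"] C1c_cmult[of g \<Omega> "-1"] by simp

text \<open>The condition \<open>g 0 = 0\<close> is what keeps the composition supported in the same
  compact set.\<close>

lemma C1c_chain:
  assumes f: "f \<in> C1c \<Omega>" and g: "\<And>t. (g has_real_derivative g' t) (at t)" "continuous_on UNIV g'" "g 0 = 0"
  shows "(\<lambda>x. g (f x)) \<in> C1c \<Omega>" "partial_deriv i (\<lambda>x. g (f x)) x = g' (f x) * partial_deriv i f x"
proof -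
  show eq: "partial_deriv i (\<lambda>x. g (f x)) x = g' (f x) * partial_deriv i f x" for i x
    by (intro partial_deriv_chain C1c_differentiable[OF f] g)
  have "(\<lambda>x. g (f x)) differentiable (at x)" for x
    using has_derivative_scalar_chain[OF C1c_differentiable[OF f] g(1)] by (auto simp: differentiable_def)
  moreover have "continuous_on UNIV (\<lambda>x. g' (f x) * partial_deriv i f x)" for i
    by (intro continuous_on_mult C1c_continuous_partial[OF f] continuous_on_compose2[OF g(2) C1c_continuous[OF f]]) auto
  moreover have "partial_deriv i (\<lambda>x. g (f x)) = (\<lambda>x. g' (f x) * partial_deriv i f x)" for i
    using eq by (intro ext)
  moreover have "\<exists>K. compact K \<and> K \<subseteq> \<Omega> \<and> (\<forall>x. x \<notin> K \<longrightarrow> g (f x) = 0)"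
    using f g(3) unfolding C1c_def by auto
  ultimately show "(\<lambda>x. g (f x)) \<in> C1c \<Omega>" by (simp add: C1c_def)
qed

section \<open>Smooth test functions as a linear space\<close>

lemma test_functions_subset_C1c: "test_functions \<Omega> \<subseteq> C1c (\<Omega> :: (real^'n) set)"
proof
  fix \<phi> :: "real^'n \<Rightarrow> real" assume \<phi>: "\<phi> \<in> test_functions \<Omega>"
  then have "Ck 1 \<phi>" unfolding test_functions_def by blast
  moreover have "\<exists>K. compact K \<and> K \<subseteq> \<Omega> \<and> (\<forall>x. x \<notin> K \<longrightarrow> \<phi> x = 0)"
    using \<phi> closure_subset[of "{x. \<phi> x \<noteq> 0}"] unfolding test_functions_def
    by (intro exI[of _ "closure {x. \<phi> x \<noteq> 0}"]) auto
  ultimately show "\<phi> \<in> C1c \<Omega>" by (simp add: C1c_def)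
qed

lemma test_functionsD: "\<phi> \<in> test_functions \<Omega> \<Longrightarrow> \<phi> \<in> C1c \<Omega>"
  using test_functions_subset_C1c by blast

lemma test_functionsI:
  assumes "\<And>k. Ck k \<phi>" "compact K" "K \<subseteq> \<Omega>" "\<And>x. x \<notin> K \<Longrightarrow> \<phi> x = 0"
  shows "\<phi> \<in> test_functions \<Omega>"
proof -
  have "closure {x. \<phi> x \<noteq> 0} \<subseteq> K"
    using assms by (intro closure_minimal compact_imp_closed) auto
  moreover from this have "compact (closure {x. \<phi> x \<noteq> 0})"
    using assms(2) by (intro compact_closure[THEN iffD2] bounded_subset[OF compact_imp_bounded[OF assms(2)]])
      (meson closure_subset order_trans)
  ultimately show ?thesis using assms by (auto simp: test_functions_def)
qed

lemma test_functions_Ck: "\<phi> \<in> test_functions \<Omega> \<Longrightarrow> Ck k \<phi>"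
  by (simp add: test_functions_def)

lemma test_functions_zero: "(\<lambda>x. 0) \<in> test_functions \<Omega>"
  by (rule test_functionsI[of _ "{}"]) (auto simp: Ck_const)

lemma test_functions_add:
  assumes "f \<in> test_functions \<Omega>" "g \<in> test_functions \<Omega>"
  shows "(\<lambda>x. f x + g x) \<in> test_functions \<Omega>"
proof -
  obtain K where K: "compact K" "K \<subseteq> \<Omega>" "\<And>x. x \<notin> K \<Longrightarrow> f x + g x = 0"
    using C1c_add[OF assms[THEN test_functionsD]] unfolding C1c_def by blast
  show ?thesis
  proof (rule test_functionsI)
    show "Ck k (\<lambda>x. f x + g x)" for k by (rule Ck_add[OF test_functions_Ck[OF assms(1)] test_functions_Ck[OF assms(2)]])
  qed (use K in auto)
qed

lemma test_functions_cmult: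
  assumes "f \<in> test_functions \<Omega>"
  shows "(\<lambda>x. c * f x) \<in> test_functions \<Omega>"
proof -
  obtain K where K: "compact K" "K \<subseteq> \<Omega>" "\<And>x. x \<notin> K \<Longrightarrow> c * f x = 0"
    using C1c_cmult[OF assms[THEN test_functionsD], of c] unfolding C1c_def by blast
  show ?thesis
  proof (rule test_functionsI)
    show "Ck k (\<lambda>x. c * f x)" for k by (rule Ck_mult[OF Ck_const test_functions_Ck[OF assms]])
  qed (use K in auto)
qed

lemma test_functions_diff:
  "f \<in> test_functions \<Omega> \<Longrightarrow> g \<in> test_functions \<Omega> \<Longrightarrow> (\<lambda>x. f x - g x) \<in> test_functions \<Omega>"
  using test_functions_add[of f \<Omega> "\<lambda>x. -1 * g x"] test_functions_cmult[of g \<Omega> "-1"] by simp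

lemma test_functions_sum:
  "(\<And>i. i \<in> I \<Longrightarrow> f i \<in> test_functions \<Omega>) \<Longrightarrow> (\<lambda>x. \<Sum>i\<in>I. c i * f i x) \<in> test_functions \<Omega>"
  by (induction I rule: infinite_finite_induct)
    (auto intro!: test_functions_add test_functions_cmult simp: test_functions_zero)

lemma test_functions_partial_deriv:
  assumes "\<phi> \<in> test_functions \<Omega>"
  shows "partial_deriv i \<phi> \<in> test_functions \<Omega>"
proof -
  have "Ck k (partial_deriv i \<phi>)" for k using test_functions_Ck[OF assms, of "Suc k"] by simp
  moreover obtain K where "compact K" "K \<subseteq> \<Omega>" "\<And>x. x \<notin> K \<Longrightarrow> partial_deriv i \<phi> x = 0"
    using C1c_support[OF test_functionsD[OF assms]] by metis
  ultimately show ?thesis by (intro test_functionsI[of _ K])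
qed

lemma C1c_partial_cmult:
  fixes f :: "real^'n \<Rightarrow> real"
  assumes "f \<in> C1c \<Omega>"
  shows "partial_deriv i (\<lambda>x. c * f x) = (\<lambda>x. c * partial_deriv i f x)"
proof
  fix x
  show "partial_deriv i (\<lambda>x. c * f x) x = c * partial_deriv i f x"
    using partial_deriv_mult[of "\<lambda>x. c" x f i] C1c_differentiable[OF assms, of x] by simp
qed

lemma C1c_partial_add:
  "f \<in> C1c \<Omega> \<Longrightarrow> g \<in> C1c \<Omega> \<Longrightarrow>
    partial_deriv i (\<lambda>x. f x + g x) = (\<lambda>x. partial_deriv i f x + partial_deriv i g x)"
  by (intro ext partial_deriv_add C1c_differentiable)

lemma C1c_partial_diff:
  "f \<in> C1c \<Omega> \<Longrightarrow> g \<in> C1c \<Omega> \<Longrightarrow>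
    partial_deriv i (\<lambda>x. f x - g x) = (\<lambda>x. partial_deriv i f x - partial_deriv i g x)"
  using C1c_partial_add[of f \<Omega> "\<lambda>x. -1 * g x" i] C1c_cmult[of g \<Omega> "-1"] C1c_partial_cmult[of g \<Omega> i "-1"]
  by simp

lemma C1c_sum: "(\<And>i. i \<in> I \<Longrightarrow> f i \<in> C1c \<Omega>) \<Longrightarrow> (\<lambda>x. \<Sum>i\<in>I. c i * f i x) \<in> C1c \<Omega>"
  by (induction I rule: infinite_finite_induct)
    (auto intro!: C1c_add C1c_cmult simp: test_functions_zero[THEN test_functionsD])

lemma C1c_partial_sum:
  assumes "\<And>j. j \<in> J \<Longrightarrow> f j \<in> C1c \<Omega>"
  shows "partial_deriv i (\<lambda>x. \<Sum>j\<in>J. c j * f j x) = (\<lambda>x. \<Sum>j\<in>J. c j * partial_deriv i (f j) x)"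
  using assms
proof (induction J rule: infinite_finite_induct)
  case (insert a J)
  have "partial_deriv i (\<lambda>x. c a * f a x + (\<Sum>j\<in>J. c j * f j x))
      = (\<lambda>x. partial_deriv i (\<lambda>x. c a * f a x) x + partial_deriv i (\<lambda>x. \<Sum>j\<in>J. c j * f j x) x)"
    using insert.prems by (intro C1c_partial_add[of _ \<Omega>] C1c_cmult C1c_sum) auto
  then show ?case
    using insert C1c_partial_cmult[of "f a" \<Omega> i "c a"] by simp
qed auto

section \<open>Integrals of partial derivatives\<close>

lemma has_real_derivative_line:
  fixes \<phi> :: "real^'n \<Rightarrow> real"
  assumes "\<phi> differentiable (at (x + t *\<^sub>R axis i 1))"
  shows "((\<lambda>t. \<phi> (x + t *\<^sub>R axis i 1)) has_real_derivative partial_deriv i \<phi> (x + t *\<^sub>R axis i 1)) (at t)"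
proof -
  have "((\<lambda>t. x + t *\<^sub>R axis i (1::real)) has_derivative (\<lambda>h. h *\<^sub>R axis i 1)) (at t)"
    by (auto intro!: derivative_eq_intros)
  from has_derivative_compose[OF this has_derivative_frechet[OF assms]]
  have "((\<lambda>t. \<phi> (x + t *\<^sub>R axis i 1)) has_derivative
      (\<lambda>h. frechet_derivative \<phi> (at (x + t *\<^sub>R axis i 1)) (h *\<^sub>R axis i 1))) (at t)" .
  also have "(\<lambda>h. frechet_derivative \<phi> (at (x + t *\<^sub>R axis i 1)) (h *\<^sub>R axis i 1))
      = (*) (partial_deriv i \<phi> (x + t *\<^sub>R axis i 1))"
    using linear_frechet_derivative[OF assms] by (auto simp: partial_deriv_def linear_scale fun_eq_iff)
  finally show ?thesis by (simp add: has_field_derivative_def)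
qed

lemma integral_lborel_translate:
  fixes f :: "'a::euclidean_space \<Rightarrow> real"
  assumes "f \<in> borel_measurable borel"
  shows "(\<integral>x. f (c + x) \<partial>lborel) = (\<integral>x. f x \<partial>lborel)"
proof -
  have "(\<integral>x. f x \<partial>lborel) = (\<integral>x. f x \<partial>distr lborel borel ((+) c))"
    by (simp add: lborel_distr_plus)
  also have "\<dots> = (\<integral>x. f (c + x) \<partial>lborel)"
    using assms by (subst integral_distr) auto
  finally show ?thesis by simp
qed

lemma integrable_lborel_compact_support:
  fixes f :: "'a::euclidean_space \<Rightarrow> real"
  assumes "f \<in> borel_measurable borel" "compact K" "\<And>x. \<bar>f x\<bar> \<le> B" "\<And>x. x \<notin> K \<Longrightarrow> f x = 0"
  shows "integrable lborel f"
proof (rule Bochner_Integration.integrable_bound)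
  show "integrable lborel (\<lambda>x. B * indicator K x :: real)"
    using assms(2) by (intro integrable_mult_right integrable_real_indicator)
      (use emeasure_bounded_finite[OF compact_imp_bounded[OF assms(2)]] in \<open>auto simp: compact_imp_closed\<close>)
  have "B \<ge> 0" using assms(3) by (meson abs_ge_zero order_trans)
  then show "AE x in lborel. norm (f x) \<le> norm (B * indicator K x :: real)"
    using assms(3,4) by (intro AE_I2) (auto simp: indicator_def)
qed (use assms in auto)

text \<open>The difference quotients have integral zero by translation invariance.\<close>

lemma C1c_integral_partial_deriv:
  fixes w :: "real^'n::finite \<Rightarrow> real"
  assumes w: "w \<in> C1c \<Omega>"
  shows "(\<integral>x. partial_deriv i w x \<partial>lborel) = 0"
proof -
  obtain K where K: "compact K" "\<And>x. x \<notin> K \<Longrightarrow> w x = 0" using C1c_support[OF w] by metis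
  obtain B where B: "B > 0" "\<And>x. \<bar>partial_deriv i w x\<bar> \<le> B" using C1c_bounded_partial[OF w] by metis
  obtain C where C: "C > 0" "\<And>x. \<bar>w x\<bar> \<le> C" using C1c_bounded[OF w] by metis
  obtain R where R: "\<And>x. x \<in> K \<Longrightarrow> norm x \<le> R" using compact_imp_bounded[OF K(1)] by (auto simp: bounded_iff)
  define h where "h n = 1 / real (Suc n)" for n
  have h: "h n > 0" "h n \<le> 1" for n by (auto simp: h_def)
  define e :: "real^'n" where "e = axis i 1"
  note [measurable] = C1c_borel_measurable[OF w] C1c_partial_borel_measurable[OF w]
  have iw: "integrable lborel w"
    by (rule integrable_lborel_compact_support[OF _ K(1) C(2) K(2)]) auto
  \<comment> \<open>The shifts have length at most 1, so every translate is supported in the ball of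
    radius R + 1.\<close>
  have iw': "integrable lborel (\<lambda>x. w (h n *\<^sub>R e + x))" for n
  proof (rule integrable_lborel_compact_support[where K="cball 0 (R + 1)"])
    show "\<bar>w (h n *\<^sub>R e + x)\<bar> \<le> C" for x by (rule C)
    fix x :: "real^'n" assume "x \<notin> cball 0 (R + 1)"
    then have "norm (h n *\<^sub>R e + x) > R"
      using norm_triangle_ineq2[of x "- h n *\<^sub>R e"] h[of n] by (auto simp: e_def add.commute)
    then show "w (h n *\<^sub>R e + x) = 0" using R K(2) by (meson not_le)
  qed auto
  have lim: "(\<lambda>n. \<integral>x. (w (h n *\<^sub>R e + x) - w x) / h n \<partial>lborel) \<longlonglongrightarrow> (\<integral>x. partial_deriv i w x \<partial>lborel)"
  proof (rule integral_dominated_convergence[where w="\<lambda>x. B * indicator (cball 0 (R + 1)) x"])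
    show "integrable lborel (\<lambda>x::real^'n. B * indicator (cball 0 (R + 1)) x :: real)"
      by (intro integrable_mult_right integrable_real_indicator) (use emeasure_bounded_finite[of "cball (0::real^'n) (R + 1)"] in auto)
    show "AE x in lborel. (\<lambda>n. (w (h n *\<^sub>R e + x) - w x) / h n) \<longlonglongrightarrow> partial_deriv i w x"
    proof (rule AE_I2)
      fix x
      have "((\<lambda>t. w (x + t *\<^sub>R axis i 1)) has_real_derivative partial_deriv i w x) (at 0)"
        using has_real_derivative_line[OF C1c_differentiable[OF w], where t=0] by simp
      then have "((\<lambda>t. (w (x + t *\<^sub>R e) - w x) / t) \<longlongrightarrow> partial_deriv i w x) (at 0)"
        by (simp add: DERIV_def e_def)
      moreover have "filterlim h (at 0) sequentially"
        unfolding filterlim_at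
      proof
        show "\<forall>\<^sub>F n in sequentially. h n \<in> UNIV \<and> h n \<noteq> 0" using h(1) by (simp add: less_imp_neq[symmetric] h_def)
        show "h \<longlonglongrightarrow> 0" unfolding h_def by (rule lim_inverse_n'[THEN LIMSEQ_Suc])
      qed
      ultimately have "(\<lambda>n. (w (x + h n *\<^sub>R e) - w x) / h n) \<longlonglongrightarrow> partial_deriv i w x"
        by (rule filterlim_compose)
      then show "(\<lambda>n. (w (h n *\<^sub>R e + x) - w x) / h n) \<longlonglongrightarrow> partial_deriv i w x"
        by (simp add: add.commute)
    qed
    show "AE x in lborel. norm ((w (h n *\<^sub>R e + x) - w x) / h n) \<le> B * indicator (cball 0 (R + 1)) x" for n
    proof (rule AE_I2)
      fix x :: "real^'n"
      show "norm ((w (h n *\<^sub>R e + x) - w x) / h n) \<le> B * indicator (cball 0 (R + 1)) x"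
      proof (cases "x \<in> cball 0 (R + 1)")
        case False
        then have "norm (h n *\<^sub>R e + x) > R"
          using norm_triangle_ineq2[of x "- h n *\<^sub>R e"] h[of n] by (auto simp: e_def add.commute)
        moreover have "norm x > R" using False by simp
        ultimately have "h n *\<^sub>R e + x \<notin> K" "x \<notin> K" using R not_le by blast+
        then show ?thesis using K(2) False by simp
      next
        case True
        \<comment> \<open>The mean value theorem bounds the difference quotient by the bound B of
          the derivative, which provides the dominating function.\<close>
        have "\<exists>z>0. z < h n \<and> w (x + h n *\<^sub>R e) - w (x + 0 *\<^sub>R e) = (h n - 0) * partial_deriv i w (x + z *\<^sub>R e)"
          unfolding e_def
          by (rule MVT2[OF h(1)[of n]]) (rule has_real_derivative_line[OF C1c_differentiable[OF w]])
        then obtain z where "w (x + h n *\<^sub>R e) - w x = h n * partial_deriv i w (x + z *\<^sub>R e)" by auto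
        then show ?thesis using h(1)[of n] B True by (simp add: add.commute[of x])
      qed
    qed
  qed auto
  have "(\<integral>x. (w (h n *\<^sub>R e + x) - w x) / h n \<partial>lborel) = 0" for n
    using iw iw'[of n] integral_lborel_translate[of w "h n *\<^sub>R e"] by simp
  with lim show ?thesis by (simp only: LIMSEQ_const_iff)
qed

section \<open>Bump functions and the fundamental lemma\<close>

text \<open>Differentiating p(1/t) exp(-1/t) gives (1/t)^2 (p - p')(1/t) exp(-1/t). The recursion is
  this rule, with \<open>[:0, 0, 1:]\<close> the square of the variable 1/t.\<close>

primrec flat_poly :: "nat \<Rightarrow> real poly" where
  "flat_poly 0 = 1"
| "flat_poly (Suc k) = [:0, 0, 1:] * (flat_poly k - pderiv (flat_poly k))"

text \<open>The derivatives of the function \<open>exp (-1/t)\<close>, extended by zero to the half-line \<open>t \<le> 0\<close>.\<close>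

definition flat_deriv :: "nat \<Rightarrow> real \<Rightarrow> real" where
  "flat_deriv k t = (if t > 0 then poly (flat_poly k) (1/t) * exp (- (1/t)) else 0)"

text \<open>Used with y = 1/h as h decreases to 0, where it makes the difference quotients of
  \<open>flat_deriv\<close> at 0 vanish in the limit.\<close>

lemma poly_mult_exp_neg_tendsto_0: "((\<lambda>y::real. poly p y * exp (- y)) \<longlongrightarrow> 0) at_top"
proof -
  have "((\<lambda>y::real. \<Sum>i\<le>degree p. coeff p i * (y ^ i / exp y)) \<longlongrightarrow> (\<Sum>i\<le>degree p. coeff p i * 0)) at_top"
    by (intro tendsto_sum tendsto_mult tendsto_const tendsto_power_div_exp_0)
  then show ?thesis by (simp add: poly_altdef sum_distrib_right exp_minus divide_inverse mult.assoc)
qed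

lemma has_real_derivative_flat_deriv: "(flat_deriv k has_real_derivative flat_deriv (Suc k) t) (at t)"
proof (cases "t = 0")
  case False
  show ?thesis
  proof (cases "t > 0")
    case True
    have "((\<lambda>t. poly (flat_poly k) (1/t) * exp (- (1/t))) has_real_derivative
        (1/t)\<^sup>2 * (poly (flat_poly k) (1/t) - poly (pderiv (flat_poly k)) (1/t)) * exp (- (1/t))) (at t)"
      using True
      by (auto intro!: derivative_eq_intros DERIV_chain2[OF poly_DERIV] simp: field_simps power2_eq_square)
    then have "(flat_deriv k has_real_derivative
        (1/t)\<^sup>2 * (poly (flat_poly k) (1/t) - poly (pderiv (flat_poly k)) (1/t)) * exp (- (1/t))) (at t)"
      by (rule has_field_derivative_transform_within_open[where S="{0<..}"])
        (use True in \<open>auto simp: flat_deriv_def\<close>)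
    then show ?thesis using True by (simp add: flat_deriv_def power2_eq_square mult.assoc)
  next
    case neg: False
    have "((\<lambda>t. 0) has_real_derivative 0) (at t)" by simp
    then have "(flat_deriv k has_real_derivative 0) (at t)"
      by (rule has_field_derivative_transform_within_open[where S="{..<0}"])
        (use neg False in \<open>auto simp: flat_deriv_def\<close>)
    then show ?thesis using neg by (simp add: flat_deriv_def)
  qed
next
  case True
  have "((\<lambda>h. flat_deriv k h / h) \<longlongrightarrow> 0) (at 0)"
  proof (rule filterlim_split_at)
    show "((\<lambda>h. flat_deriv k h / h) \<longlongrightarrow> 0) (at_left 0)"
      by (rule tendsto_eventually) (auto simp: eventually_at_left_field flat_deriv_def intro: exI[of _ "-1"])
    \<comment> \<open>\<open>pCons 0\<close> multiplies the polynomial by its variable 1/h; this is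
      the division by h in the difference quotient.\<close>
    have "((\<lambda>h. poly (pCons 0 (flat_poly k)) (inverse h) * exp (- inverse h)) \<longlongrightarrow> 0) (at_right (0::real))"
      by (rule filterlim_compose[OF poly_mult_exp_neg_tendsto_0 filterlim_inverse_at_top_right])
    moreover have "\<forall>\<^sub>F h in at_right 0. poly (pCons 0 (flat_poly k)) (inverse h) * exp (- inverse h) = flat_deriv k h / h"
      by (auto simp: eventually_at_right_field flat_deriv_def field_simps intro!: exI[of _ 1])
    ultimately show "((\<lambda>h. flat_deriv k h / h) \<longlongrightarrow> 0) (at_right 0)"
      by (rule Lim_transform_eventually)
  qed
  then show ?thesis using True by (simp add: DERIV_def flat_deriv_def)
qed

lemma flat_deriv_0: "0 \<le> flat_deriv 0 t" "flat_deriv 0 t \<le> 1" "t \<le> 0 \<Longrightarrow> flat_deriv 0 t = 0"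
  by (auto simp: flat_deriv_def)

text \<open>A bump for the open box from a to b with steepness s. The shifts by 1 make it vanish
  within distance 1/s of the faces, so that its support is compact in the box. The arguments are
  expanded to the affine form required by \<open>Ck_smooth_comp_coordinate\<close>.\<close>

definition box_bump :: "real^'n \<Rightarrow> real^'n \<Rightarrow> real \<Rightarrow> real^'n \<Rightarrow> real" where
  "box_bump a b s x = (\<Prod>j\<in>UNIV. flat_deriv 0 (s * x $ j + (- s * a $ j - 1)) * flat_deriv 0 (- s * x $ j + (s * b $ j - 1)))"

lemma box_bump_test_function:
  assumes "s > 0" "box a b \<subseteq> \<Omega>"
  shows "box_bump a b s \<in> test_functions \<Omega>"
proof (rule test_functionsI)
  have "Ck k (\<lambda>x. box_bump a b s x)" for k
    unfolding box_bump_def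
    by (intro Ck_prod Ck_mult) (rule Ck_smooth_comp_coordinate[of flat_deriv, OF has_real_derivative_flat_deriv])+
  then show "Ck k (box_bump a b s)" for k by simp
  let ?K = "cbox (\<chi> j. a $ j + 1/s) (\<chi> j. b $ j - 1/s)"
  show "compact ?K" by simp
  have "?K \<subseteq> box a b"
    using assms(1) by (auto simp: mem_box_cart) (smt (verit, best) divide_pos_pos)+
  then show "?K \<subseteq> \<Omega>" using assms(2) by simp
  show "box_bump a b s x = 0" if "x \<notin> ?K" for x
  proof -
    obtain j where "x $ j < a $ j + 1/s \<or> x $ j > b $ j - 1/s"
      using \<open>x \<notin> ?K\<close> by (auto simp: mem_box_cart not_le)
    then have "s * x $ j + (- s * a $ j - 1) \<le> 0 \<or> - s * x $ j + (s * b $ j - 1) \<le> 0"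
      using assms(1) by (auto simp: field_simps)
    then have "flat_deriv 0 (s * x $ j + (- s * a $ j - 1)) * flat_deriv 0 (- s * x $ j + (s * b $ j - 1)) = 0"
      using flat_deriv_0(3) by fastforce
    then show ?thesis unfolding box_bump_def by (intro prod_zero) auto
  qed
qed

lemma box_bump_bounds: "0 \<le> box_bump a b s x" "box_bump a b s x \<le> 1"
  unfolding box_bump_def by (auto intro!: prod_nonneg prod_le_1 mult_le_one flat_deriv_0 mult_nonneg_nonneg)

lemma flat_deriv_0_tendsto:
  "(\<lambda>n. flat_deriv 0 (real n * d - 1)) \<longlonglongrightarrow> (if d > 0 then 1 else 0)"
proof (cases "d > 0")
  case True
  have top: "filterlim (\<lambda>n. real n * d - 1) at_top sequentially"
    using filterlim_tendsto_add_at_top[OF tendsto_const[of "-1"]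
        filterlim_at_top_mult_tendsto_pos[OF tendsto_const[of d] True filterlim_real_sequentially]] by simp
  have "(\<lambda>n. exp (- inverse (real n * d - 1))) \<longlonglongrightarrow> exp (- 0)"
    by (intro tendsto_exp tendsto_minus filterlim_compose[OF tendsto_inverse_0_at_top top] filterlim_ident)
  moreover have "\<forall>\<^sub>F n in sequentially. exp (- inverse (real n * d - 1)) = flat_deriv 0 (real n * d - 1)"
    using eventually_compose_filterlim[OF eventually_gt_at_top[of 0] top]
    by eventually_elim (simp add: flat_deriv_def inverse_eq_divide)
  ultimately have "(\<lambda>n. flat_deriv 0 (real n * d - 1)) \<longlonglongrightarrow> exp (- 0)"
    by (rule Lim_transform_eventually)
  then show ?thesis using True by simp
next
  case False
  then have "flat_deriv 0 (real n * d - 1) = 0" for n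
    by (intro flat_deriv_0) (simp add: mult_nonneg_nonpos order_trans[of _ 0])
  then show ?thesis using False by simp
qed

lemma box_bump_tendsto: "(\<lambda>n. box_bump a b (real n) x) \<longlonglongrightarrow> indicator (box a b) x"
proof -
  have "(\<lambda>n. flat_deriv 0 (real n * (x $ j - a $ j) - 1) * flat_deriv 0 (real n * (b $ j - x $ j) - 1))
      \<longlonglongrightarrow> (if x $ j - a $ j > 0 then 1 else 0) * (if b $ j - x $ j > 0 then 1 else 0)" for j
    by (intro tendsto_mult flat_deriv_0_tendsto)
  then have "(\<lambda>n. \<Prod>j\<in>UNIV. flat_deriv 0 (real n * (x $ j - a $ j) - 1) * flat_deriv 0 (real n * (b $ j - x $ j) - 1))
      \<longlonglongrightarrow> (\<Prod>j\<in>UNIV. (if x $ j - a $ j > 0 then 1 else 0) * (if b $ j - x $ j > 0 then 1 else 0))"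
    by (intro tendsto_prod)
  moreover have "(\<Prod>j\<in>UNIV. (if x $ j - a $ j > 0 then 1 else 0) * (if b $ j - x $ j > 0 then 1 else 0))
      = (indicator (box a b) x :: real)"
  proof (cases "x \<in> box a b")
    case True
    then show ?thesis by (auto simp: mem_box_cart intro!: prod.neutral)
  next
    case False
    then have "\<exists>j. \<not> (a $ j < x $ j \<and> x $ j < b $ j)" by (auto simp: mem_box_cart)
    then have "(\<Prod>j\<in>UNIV. (if x $ j - a $ j > 0 then 1 else 0) * (if b $ j - x $ j > 0 then 1 else 0)) = (0::real)"
      by (intro prod_zero) auto
    then show ?thesis using False by simp
  qed
  ultimately show ?thesis
    unfolding box_bump_def by (simp add: algebra_simps)
qed

text \<open>Bumps converge to indicators of boxes, and the boxes inside \<open>\<Omega>\<close> generate the Borel sets.\<close>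

lemma borel_zero_of_test_functions:
  fixes g :: "real^'n \<Rightarrow> real"
  assumes \<Omega>: "open \<Omega>" and g: "integrable lborel g"
    and zero: "\<And>\<psi>. \<psi> \<in> test_functions \<Omega> \<Longrightarrow> (\<integral>x. g x * \<psi> x \<partial>lborel) = 0"
  shows "AE x in lborel. x \<in> \<Omega> \<longrightarrow> g x = 0"
proof -
  have [measurable]: "g \<in> borel_measurable borel" using g by auto
  have int: "integrable lborel (\<lambda>x. g x * indicator A x)" if "A \<in> sets borel" for A
    using integrable_mult_indicator[of A lborel g] that g by (simp add: mult.commute)
  have box: "(\<integral>x. g x * indicator (box a b) x \<partial>lborel) = 0" if "box a b \<subseteq> \<Omega>" for a b
  proof -
    have meas: "box_bump a b (real (Suc n)) \<in> borel_measurable borel" for n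
      using C1c_continuous[OF test_functionsD[OF box_bump_test_function[OF _ that]], of "real (Suc n)"]
      by (intro borel_measurable_continuous_onI) simp
    have "(\<lambda>n. \<integral>x. g x * box_bump a b (real (Suc n)) x \<partial>lborel) \<longlonglongrightarrow> (\<integral>x. g x * indicator (box a b) x \<partial>lborel)"
    proof (rule integral_dominated_convergence[where w="\<lambda>x. \<bar>g x\<bar>"])
      show "AE x in lborel. (\<lambda>n. g x * box_bump a b (real (Suc n)) x) \<longlonglongrightarrow> g x * indicator (box a b) x"
        by (intro AE_I2 tendsto_mult tendsto_const LIMSEQ_Suc[OF box_bump_tendsto])
      show "AE x in lborel. norm (g x * box_bump a b (real (Suc n)) x) \<le> \<bar>g x\<bar>" for n
      proof (rule AE_I2)
        fix x
        show "norm (g x * box_bump a b (real (Suc n)) x) \<le> \<bar>g x\<bar>"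
          using mult_left_mono[OF box_bump_bounds(2)[of a b "real (Suc n)" x], of "\<bar>g x\<bar>"] box_bump_bounds(1)[of a b "real (Suc n)" x]
          by (simp add: abs_mult)
      qed
      show "(\<lambda>x. g x * box_bump a b (real (Suc n)) x) \<in> borel_measurable lborel" for n
        using meas[of n] by simp
    qed (use g in auto)
    moreover have "(\<integral>x. g x * box_bump a b (real (Suc n)) x \<partial>lborel) = 0" for n
      by (intro zero box_bump_test_function that) simp
    ultimately show ?thesis by (simp add: LIMSEQ_const_iff)
  qed
  \<comment> \<open>Inside a fixed box contained in \<Omega>, the intersection with any other box is
    again a box in \<Omega>. The boxes therefore form an intersection-stable generator on which the
    integral vanishes, and Dynkin induction reaches all Borel sets.\<close>
  have AE_box: "AE x in lborel. g x * indicator (box a b) x = 0" if ab: "box a b \<subseteq> \<Omega>" for a b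
  proof -
    let ?f = "\<lambda>x. g x * indicator (box a b) x"
    have f: "integrable lborel ?f" by (intro int) auto
    have "(\<integral>x. ?f x * indicator A x \<partial>lborel) = 0" if "A \<in> sets borel" for A
    proof -
      have "Int_stable (range (\<lambda>(a, b). box a b :: (real^'n) set))"
        by (auto simp: Int_stable_def box_Int_box)
      moreover have "(range (\<lambda>(a, b). box a b :: (real^'n) set)) \<subseteq> Pow UNIV" by auto
      moreover have "A \<in> sigma_sets UNIV (range (\<lambda>(a, b). box a b))"
        using that unfolding borel_eq_box by simp
      ultimately show ?thesis
      proof (induction rule: sigma_sets_induct_disjoint)
        case (basic A)
        then obtain c d where A: "A = box c d" by auto
        obtain l u where lu: "box c d \<inter> box a b = box l u" by (auto simp: box_Int_box)
        have eq: "?f x * indicator A x = g x * indicator (box l u) x" for x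
          unfolding A lu[symmetric] by (simp add: indicator_inter_arith)
        have "box l u \<subseteq> \<Omega>" using lu ab by blast
        from box[OF this] show ?case unfolding eq .
      next
        case empty then show ?case by simp
      next
        case (compl A)
        then have A: "A \<in> sets borel" by (simp add: borel_eq_box)
        have "(\<integral>x. ?f x * indicator (UNIV - A) x \<partial>lborel) = (\<integral>x. ?f x - ?f x * indicator A x \<partial>lborel)"
          by (intro arg_cong[of _ _ "lebesgue_integral lborel"] ext) (auto simp: indicator_def)
        also have "\<dots> = (\<integral>x. ?f x \<partial>lborel) - (\<integral>x. ?f x * indicator A x \<partial>lborel)"
          using integrable_mult_indicator[of A lborel ?f] A f
          by (intro Bochner_Integration.integral_diff) (auto simp: mult.commute)
        finally show ?case using compl box[OF ab] by simp
      next
        case (union F)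
        then have F: "\<And>i. F i \<in> sets borel" by (simp add: borel_eq_box subset_eq)
        have "(LINT x:(\<Union>i. F i)|lborel. ?f x) = (\<Sum>i. (LINT x:(F i)|lborel. ?f x))"
        proof (rule lebesgue_integral_countable_add)
          show "F i \<inter> F j = {}" if "i \<noteq> j" for i j
            using union(1) that by (auto simp: disjoint_family_on_def)
          show "set_integrable lborel (\<Union>i. F i) ?f"
            unfolding set_integrable_def using F f by (intro integrable_mult_indicator) auto
        qed (use F in auto)
        then show ?case using union(3) by (simp add: set_lebesgue_integral_def mult.commute)
      qed
    qed
    then have "(LINT x:A|lborel. ?f x) = (LINT x:A|lborel. 0)" if "A \<in> sets lborel" for A
      using that by (simp add: set_lebesgue_integral_def mult.commute)
    from density_unique_real[OF f _ this] show ?thesis by simp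
  qed
  obtain \<D> where \<D>: "countable \<D>" "\<D> \<subseteq> Pow \<Omega>" "\<And>X. X \<in> \<D> \<Longrightarrow> \<exists>a b. X = box a b" "\<Union>\<D> = \<Omega>"
    using open_countable_Union_open_box[OF \<Omega>] by metis
  have "AE x in lborel. \<forall>X\<in>\<D>. g x * indicator X x = 0"
  proof (subst AE_ball_countable[OF \<D>(1)], intro ballI)
    fix X assume X: "X \<in> \<D>"
    then obtain a b where "X = box a b" using \<D>(3) by blast
    with X \<D>(2) AE_box[of a b] show "AE x in lborel. g x * indicator X x = 0" by blast
  qed
  then show ?thesis
  proof eventually_elim
    case (elim x)
    show ?case
    proof
      assume "x \<in> \<Omega>"
      then obtain X where "X \<in> \<D>" "x \<in> X" using \<D>(4) by blast
      with elim show "g x = 0" by force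
    qed
  qed
qed

section \<open>Lebesgue measure on the domain\<close>

lemma finite_measure_lebesgue_on:
  assumes "open \<Omega>" "bounded (\<Omega> :: 'a::euclidean_space set)"
  shows "finite_measure (lebesgue_on \<Omega>)"
proof (rule finite_measureI)
  have "\<Omega> \<in> lmeasurable" using assms by (intro bounded_set_imp_lmeasurable) auto
  then show "emeasure (lebesgue_on \<Omega>) (space (lebesgue_on \<Omega>)) \<noteq> \<infinity>"
    by (auto simp: emeasure_restrict_space fmeasurable_def)
qed

text \<open>The function spaces use the completed measure restricted to \<Omega>, whereas Tonelli's
  theorem and translation invariance are applied on \<open>lborel\<close>. This is the bridge for
  Borel functions that vanish outside \<Omega>.\<close>

lemma lebesgue_on_zero_outside:
  fixes g :: "'a::euclidean_space \<Rightarrow> real"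
  assumes "open \<Omega>" "g \<in> borel_measurable borel" "\<And>x. x \<notin> \<Omega> \<Longrightarrow> g x = 0"
  shows "(\<integral>x. g x \<partial>lebesgue_on \<Omega>) = (\<integral>x. g x \<partial>lborel)"
    "integrable (lebesgue_on \<Omega>) g \<longleftrightarrow> integrable lborel g"
proof -
  have \<Omega>: "\<Omega> \<in> sets lebesgue" using assms(1) by (auto intro: borel_open)
  have eq: "(\<lambda>x. if x \<in> \<Omega> then g x else 0) = g" using assms(3) by auto
  have m: "g \<in> borel_measurable lborel" using assms(2) by simp
  show "(\<integral>x. g x \<partial>lebesgue_on \<Omega>) = (\<integral>x. g x \<partial>lborel)"
    using Lebesgue_Measure.integral_restrict_UNIV[OF \<Omega>, of g] integral_completion[OF m] by (simp add: eq)
  show "integrable (lebesgue_on \<Omega>) g \<longleftrightarrow> integrable lborel g"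
    using Lebesgue_Measure.integrable_restrict_UNIV[OF \<Omega>, of g] integrable_completion[OF m] by (simp add: eq)
qed

text \<open>The fundamental lemma of the calculus of variations for Lebesgue measurable functions.
  The extension of \<open>h\<close> by zero agrees almost everywhere with a Borel function, to which
  the Borel version applies.\<close>

lemma zero_of_test_functions:
  fixes h :: "real^'n \<Rightarrow> real"
  assumes \<Omega>: "open \<Omega>" and h: "integrable (lebesgue_on \<Omega>) h"
    and zero: "\<And>\<psi>. \<psi> \<in> test_functions \<Omega> \<Longrightarrow> (\<integral>x. h x * \<psi> x \<partial>lebesgue_on \<Omega>) = 0"
  shows "AE x in lebesgue_on \<Omega>. h x = 0"
proof -
  have \<Omega>m: "\<Omega> \<in> sets lebesgue" using \<Omega> by (auto intro: borel_open)
  define H where "H x = (if x \<in> \<Omega> then h x else 0)" for x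
  have H: "integrable lebesgue H"
    unfolding H_def using Lebesgue_Measure.integrable_restrict_UNIV[OF \<Omega>m] h by blast
  obtain g where g: "g \<in> borel_measurable lborel" "AE x in lborel. H x = g x"
    using completion_ex_borel_measurable_real[of H lborel] H by blast
  have AE: "AE x in lebesgue. H x = g x" by (rule AE_completion[OF g(2)])
  have gm: "g \<in> borel_measurable lebesgue" using g(1) by (rule measurable_completion)
  have "integrable lebesgue g"
    using H AE gm by (intro integrable_cong_AE_imp[OF H gm]) auto
  then have gi: "integrable lborel g" using integrable_completion[OF g(1)] by blast
  have "(\<integral>x. g x * \<psi> x \<partial>lborel) = 0" if \<psi>: "\<psi> \<in> test_functions \<Omega>" for \<psi>
  proof -
    have m: "\<psi> \<in> borel_measurable lborel"
      using C1c_continuous[OF test_functionsD[OF \<psi>]] by (simp add: borel_measurable_continuous_onI)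
    have m': "\<psi> \<in> borel_measurable lebesgue" using m by (rule measurable_completion)
    have "(\<integral>x. g x * \<psi> x \<partial>lborel) = (\<integral>x. g x * \<psi> x \<partial>lebesgue)"
      using g(1) m by (intro integral_completion[symmetric]) auto
    also have "\<dots> = (\<integral>x. H x * \<psi> x \<partial>lebesgue)"
      using AE H gm m' by (intro integral_cong_AE) auto
    also have "\<dots> = (\<integral>x. (if x \<in> \<Omega> then h x * \<psi> x else 0) \<partial>lebesgue)"
      by (intro arg_cong[of _ _ "lebesgue_integral lebesgue"]) (auto simp: H_def)
    also have "\<dots> = (\<integral>x. h x * \<psi> x \<partial>lebesgue_on \<Omega>)"
      by (rule Lebesgue_Measure.integral_restrict_UNIV[OF \<Omega>m])
    finally show ?thesis using zero[OF \<psi>] by simp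
  qed
  from borel_zero_of_test_functions[OF \<Omega> gi this] have "AE x in lebesgue. x \<in> \<Omega> \<longrightarrow> g x = 0"
    by (intro AE_completion) auto
  with AE have "AE x in lebesgue. x \<in> \<Omega> \<longrightarrow> h x = 0"
    by eventually_elim (auto simp: H_def)
  then show ?thesis using \<Omega>m by (simp add: AE_restrict_space_iff)
qed

section \<open>Weak derivatives\<close>

locale bounded_open =
  fixes \<Omega> :: "(real^'n::finite) set"
  assumes open_domain: "open \<Omega>" and bounded_domain: "bounded \<Omega>"
begin

abbreviation \<mu> :: "(real^'n) measure" where "\<mu> \<equiv> lebesgue_on \<Omega>"

sublocale finite_measure \<mu>
  by (rule finite_measure_lebesgue_on[OF open_domain bounded_domain])

lemma continuous_imp_measurable: "continuous_on UNIV f \<Longrightarrow> f \<in> borel_measurable \<mu>"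
  for f :: "real^'n \<Rightarrow> real"
  using measurable_restrict_space1[OF measurable_completion[of f lborel borel]]
    borel_measurable_continuous_onI[of f] by simp

lemma sq_integrable_bounded:
  assumes "f \<in> borel_measurable \<mu>" "\<And>x. \<bar>f x\<bar> \<le> B"
  shows "sq_integrable \<mu> f"
  unfolding sq_integrable_def
proof
  have "(f x)\<^sup>2 \<le> B\<^sup>2" for x using power_mono[OF assms(2)[of x], of 2] by simp
  then show "integrable \<mu> (\<lambda>x. (f x)\<^sup>2)"
    using assms(1) by (intro integrable_const_bound[where B="B\<^sup>2"]) auto
qed (use assms in auto)

lemma C1c_sq_integrable:
  assumes "\<phi> \<in> C1c \<Omega>" shows "sq_integrable \<mu> \<phi>"
proof -
  obtain B where B: "\<And>x. \<bar>\<phi> x\<bar> \<le> B" using C1c_bounded[OF assms] by blast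
  show ?thesis by (rule sq_integrable_bounded[OF continuous_imp_measurable[OF C1c_continuous[OF assms]] B])
qed

lemma C1c_partial_sq_integrable:
  assumes "\<phi> \<in> C1c \<Omega>" shows "sq_integrable \<mu> (partial_deriv i \<phi>)"
proof -
  obtain B where B: "\<And>x. \<bar>partial_deriv i \<phi> x\<bar> \<le> B" using C1c_bounded_partial[OF assms] by blast
  show ?thesis
    by (rule sq_integrable_bounded[OF continuous_imp_measurable[OF C1c_continuous_partial[OF assms]] B])
qed

lemma integral_partial_deriv_eq_0:
  assumes "w \<in> C1c \<Omega>" shows "(\<integral>x. partial_deriv i w x \<partial>\<mu>) = 0"
  using lebesgue_on_zero_outside(1)[OF open_domain, of "partial_deriv i w"]
    C1c_integral_partial_deriv[OF assms, of i]
    C1c_partial_borel_measurable[OF assms] C1c_partial_zero_outside[OF assms]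
  by simp

text \<open>The product is again in the C1 class, so its derivative integrates to zero.\<close>

lemma integration_by_parts:
  assumes \<phi>: "\<phi> \<in> C1c \<Omega>" and \<psi>: "\<psi> \<in> C1c \<Omega>"
  shows "(\<integral>x. \<phi> x * partial_deriv i \<psi> x \<partial>\<mu>) = - (\<integral>x. partial_deriv i \<phi> x * \<psi> x \<partial>\<mu>)"
proof -
  note d = C1c_differentiable[OF \<phi>] C1c_differentiable[OF \<psi>]
  have w: "(\<lambda>x. \<phi> x * \<psi> x) \<in> C1c \<Omega>"
    by (rule C1c_mult[OF \<phi> C1c_differentiable[OF \<psi>] C1c_continuous_partial[OF \<psi>]])
  have "0 = (\<integral>x. partial_deriv i \<phi> x * \<psi> x + \<phi> x * partial_deriv i \<psi> x \<partial>\<mu>)"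
    using integral_partial_deriv_eq_0[OF w, of i] partial_deriv_mult[OF d, of i] by simp
  also have "\<dots> = (\<integral>x. partial_deriv i \<phi> x * \<psi> x \<partial>\<mu>) + (\<integral>x. \<phi> x * partial_deriv i \<psi> x \<partial>\<mu>)"
    by (intro Bochner_Integration.integral_add sq_integrable_mult C1c_sq_integrable C1c_partial_sq_integrable \<phi> \<psi>)
  finally show ?thesis by simp
qed

lemma C1c_has_weak_deriv: "\<phi> \<in> C1c \<Omega> \<Longrightarrow> has_weak_deriv \<Omega> i \<phi> (partial_deriv i \<phi>)"
  using integration_by_parts test_functionsD unfolding has_weak_deriv_def L2_inner_def by blast

lemma weak_deriv_unique:
  assumes g: "sq_integrable \<mu> g" "has_weak_deriv \<Omega> i u g" and h: "sq_integrable \<mu> h" "has_weak_deriv \<Omega> i u h"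
  shows "AE x in \<mu>. g x = h x"
proof -
  have "(\<integral>x. (g x - h x) * \<psi> x \<partial>\<mu>) = 0" if \<psi>: "\<psi> \<in> test_functions \<Omega>" for \<psi>
  proof -
    note s = C1c_sq_integrable[OF test_functionsD[OF \<psi>]]
    have "(\<integral>x. (g x - h x) * \<psi> x \<partial>\<mu>) = (\<integral>x. g x * \<psi> x - h x * \<psi> x \<partial>\<mu>)"
      by (simp only: left_diff_distrib)
    also have "\<dots> = (\<integral>x. g x * \<psi> x \<partial>\<mu>) - (\<integral>x. h x * \<psi> x \<partial>\<mu>)"
      by (intro Bochner_Integration.integral_diff sq_integrable_mult g h s)
    also have "\<dots> = 0"
      using g(2) h(2) \<psi> unfolding has_weak_deriv_def L2_inner_def by (metis add.inverse_inverse diff_self)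
    finally show ?thesis .
  qed
  then have "AE x in \<mu>. g x - h x = 0"
    by (intro zero_of_test_functions[OF open_domain] l1_le_l2norm(1) sq_integrable_diff g h)
  then show ?thesis by eventually_elim simp
qed

lemma H1_sq_integrable: "u \<in> H1 \<Omega> \<Longrightarrow> sq_integrable \<mu> u"
  by (simp add: H1_def L2_iff)

lemma H1_weak_deriv:
  assumes "u \<in> H1 \<Omega>"
  shows "sq_integrable \<mu> (weak_deriv \<Omega> i u)" "has_weak_deriv \<Omega> i u (weak_deriv \<Omega> i u)"
proof -
  have "\<exists>g. g \<in> L2 \<Omega> \<and> has_weak_deriv \<Omega> i u g" using assms unfolding H1_def by blast
  from someI_ex[OF this, folded weak_deriv_def]
  show "sq_integrable \<mu> (weak_deriv \<Omega> i u)" "has_weak_deriv \<Omega> i u (weak_deriv \<Omega> i u)"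
    by (auto simp: L2_iff)
qed

text \<open>The means of computing \<open>weak_deriv\<close>, which is only a choice: every
  square-integrable candidate that satisfies the integration by parts formula equals it up to a null
  set.\<close>

lemma H1I:
  assumes "sq_integrable \<mu> u" "\<And>i. sq_integrable \<mu> (g i)" "\<And>i. has_weak_deriv \<Omega> i u (g i)"
  shows "u \<in> H1 \<Omega>" "AE x in \<mu>. weak_deriv \<Omega> i u x = g i x"
proof -
  show u: "u \<in> H1 \<Omega>" using assms unfolding H1_def L2_iff Bex_def mem_Collect_eq by blast
  show "AE x in \<mu>. weak_deriv \<Omega> i u x = g i x"
    by (rule weak_deriv_unique[OF H1_weak_deriv[OF u] assms(2,3)])
qed

lemma C1c_H1:
  assumes "\<phi> \<in> C1c \<Omega>"
  shows "\<phi> \<in> H1 \<Omega>" "AE x in \<mu>. weak_deriv \<Omega> i \<phi> x = partial_deriv i \<phi> x"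
  using H1I[OF C1c_sq_integrable C1c_partial_sq_integrable C1c_has_weak_deriv, OF assms assms assms] by auto

lemma H1_linear_combination:
  assumes u: "u \<in> H1 \<Omega>" and v: "v \<in> H1 \<Omega>"
  shows "(\<lambda>x. a * u x + b * v x) \<in> H1 \<Omega>"
    "AE x in \<mu>. weak_deriv \<Omega> i (\<lambda>x. a * u x + b * v x) x = a * weak_deriv \<Omega> i u x + b * weak_deriv \<Omega> i v x"
proof -
  have lin: "L2_inner \<Omega> (\<lambda>x. a * f x + b * g x) h = a * L2_inner \<Omega> f h + b * L2_inner \<Omega> g h"
    if "sq_integrable \<mu> f" "sq_integrable \<mu> g" "sq_integrable \<mu> h" for f g h
  proof -
    have "L2_inner \<Omega> (\<lambda>x. a * f x + b * g x) h = (\<integral>x. a * (f x * h x) + b * (g x * h x) \<partial>\<mu>)"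
      by (simp only: L2_inner_def distrib_right mult.assoc)
    then show ?thesis
      using sq_integrable_mult[OF that(1,3)] sq_integrable_mult[OF that(2,3)] by (simp add: L2_inner_def)
  qed
  have s: "sq_integrable \<mu> (\<lambda>x. a * u x + b * v x)"
    by (intro sq_integrable_add sq_integrable_cmult H1_sq_integrable u v)
  have sg: "sq_integrable \<mu> (\<lambda>x. a * weak_deriv \<Omega> i u x + b * weak_deriv \<Omega> i v x)" for i
    by (intro sq_integrable_add sq_integrable_cmult H1_weak_deriv u v)
  have w: "has_weak_deriv \<Omega> i (\<lambda>x. a * u x + b * v x) (\<lambda>x. a * weak_deriv \<Omega> i u x + b * weak_deriv \<Omega> i v x)" for i
    unfolding has_weak_deriv_def
  proof
    fix \<phi> assume \<phi>: "\<phi> \<in> test_functions \<Omega>"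
    note \<phi>' = C1c_sq_integrable[OF test_functionsD[OF \<phi>]] C1c_partial_sq_integrable[OF test_functionsD[OF \<phi>]]
    have "L2_inner \<Omega> u (partial_deriv i \<phi>) = - L2_inner \<Omega> (weak_deriv \<Omega> i u) \<phi>"
      "L2_inner \<Omega> v (partial_deriv i \<phi>) = - L2_inner \<Omega> (weak_deriv \<Omega> i v) \<phi>"
      using H1_weak_deriv(2)[OF u, of i] H1_weak_deriv(2)[OF v, of i] \<phi> unfolding has_weak_deriv_def by blast+
    then show "L2_inner \<Omega> (\<lambda>x. a * u x + b * v x) (partial_deriv i \<phi>) =
        - L2_inner \<Omega> (\<lambda>x. a * weak_deriv \<Omega> i u x + b * weak_deriv \<Omega> i v x) \<phi>"
      by (simp add: lin H1_sq_integrable H1_weak_deriv u v \<phi>')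
  qed
  show "(\<lambda>x. a * u x + b * v x) \<in> H1 \<Omega>" by (rule H1I(1)[OF s sg w])
  show "AE x in \<mu>. weak_deriv \<Omega> i (\<lambda>x. a * u x + b * v x) x = a * weak_deriv \<Omega> i u x + b * weak_deriv \<Omega> i v x"
    by (rule H1I(2)[OF s sg w])
qed

lemma H1_diff:
  assumes "u \<in> H1 \<Omega>" "v \<in> H1 \<Omega>"
  shows "(\<lambda>x. u x - v x) \<in> H1 \<Omega>"
    "AE x in \<mu>. weak_deriv \<Omega> i (\<lambda>x. u x - v x) x = weak_deriv \<Omega> i u x - weak_deriv \<Omega> i v x"
  using H1_linear_combination[OF assms, where a=1 and b="-1"] by simp_all

lemma H1_norm_eq: "H1_norm \<Omega> u = sqrt ((l2norm \<mu> u)\<^sup>2 + (\<Sum>i\<in>UNIV. (l2norm \<mu> (weak_deriv \<Omega> i u))\<^sup>2))"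
  unfolding H1_norm_def grad_inner_def L2_inner_def l2norm_sq by (simp add: power2_eq_square)

lemma l2norm_le_H1_norm: "l2norm \<mu> u \<le> H1_norm \<Omega> u"
  unfolding H1_norm_eq by (intro real_le_rsqrt) (simp add: sum_nonneg)

lemma l2norm_weak_deriv_le_H1_norm: "l2norm \<mu> (weak_deriv \<Omega> i u) \<le> H1_norm \<Omega> u"
  unfolding H1_norm_eq
proof (intro real_le_rsqrt)
  have "(l2norm \<mu> (weak_deriv \<Omega> i u))\<^sup>2 \<le> (\<Sum>i\<in>UNIV. (l2norm \<mu> (weak_deriv \<Omega> i u))\<^sup>2)"
    by (rule member_le_sum) auto
  then show "(l2norm \<mu> (weak_deriv \<Omega> i u))\<^sup>2 \<le> (l2norm \<mu> u)\<^sup>2 + (\<Sum>i\<in>UNIV. (l2norm \<mu> (weak_deriv \<Omega> i u))\<^sup>2)"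
    using zero_le_power2[of "l2norm \<mu> u"] by linarith
qed

lemma H1_norm_nonneg: "H1_norm \<Omega> u \<ge> 0"
  using l2norm_le_H1_norm[of u] l2norm_nonneg order_trans by blast

lemma H1_norm_tendsto_0:
  assumes "\<And>n. w n \<in> H1 \<Omega>"
    and "(\<lambda>n. l2norm \<mu> (w n)) \<longlonglongrightarrow> 0" "\<And>i. (\<lambda>n. l2norm \<mu> (weak_deriv \<Omega> i (w n))) \<longlonglongrightarrow> 0"
  shows "(\<lambda>n. H1_norm \<Omega> (w n)) \<longlonglongrightarrow> 0"
proof -
  have "(\<lambda>n. sqrt ((l2norm \<mu> (w n))\<^sup>2 + (\<Sum>i\<in>UNIV. (l2norm \<mu> (weak_deriv \<Omega> i (w n)))\<^sup>2)))
      \<longlonglongrightarrow> sqrt (0\<^sup>2 + (\<Sum>i\<in>(UNIV::'n set). 0\<^sup>2))"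
    by (intro tendsto_intros assms)
  then show ?thesis by (simp add: H1_norm_eq)
qed

section \<open>The closure of the test functions in H1\<close>

lemma H10_H1: "u \<in> H10 \<Omega> \<Longrightarrow> u \<in> H1 \<Omega>"
  by (simp add: H10_def)

lemma l2norm_partial_diff_weak_deriv:
  assumes \<phi>: "\<phi> \<in> C1c \<Omega>" and u: "u \<in> H1 \<Omega>"
  shows "l2norm \<mu> (\<lambda>x. partial_deriv i \<phi> x - weak_deriv \<Omega> i u x) = l2norm \<mu> (weak_deriv \<Omega> i (\<lambda>x. \<phi> x - u x))"
proof (rule l2norm_cong_AE)
  show "AE x in \<mu>. partial_deriv i \<phi> x - weak_deriv \<Omega> i u x = weak_deriv \<Omega> i (\<lambda>x. \<phi> x - u x) x"
    using C1c_H1(2)[OF \<phi>, of i] H1_diff(2)[OF C1c_H1(1)[OF \<phi>] u, of i] by eventually_elim simp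
  show "(\<lambda>x. partial_deriv i \<phi> x - weak_deriv \<Omega> i u x) \<in> borel_measurable \<mu>"
    by (intro sq_integrable_measurable sq_integrable_diff C1c_partial_sq_integrable \<phi> H1_weak_deriv u)
  show "weak_deriv \<Omega> i (\<lambda>x. \<phi> x - u x) \<in> borel_measurable \<mu>"
    by (intro sq_integrable_measurable H1_weak_deriv H1_diff C1c_H1 \<phi> u)
qed

lemma H10_approx:
  assumes u: "u \<in> H10 \<Omega>"
  shows "\<exists>\<phi>. (\<forall>n::nat. \<phi> n \<in> test_functions \<Omega>) \<and> (\<lambda>n. l2norm \<mu> (\<lambda>x. \<phi> n x - u x)) \<longlonglongrightarrow> 0 \<and>
    (\<forall>i. (\<lambda>n. l2norm \<mu> (\<lambda>x. partial_deriv i (\<phi> n) x - weak_deriv \<Omega> i u x)) \<longlonglongrightarrow> 0)"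
proof -
  obtain \<phi> where \<phi>: "\<And>n::nat. \<phi> n \<in> test_functions \<Omega>" "(\<lambda>n. H1_norm \<Omega> (\<lambda>x. \<phi> n x - u x)) \<longlonglongrightarrow> 0"
    using u unfolding H10_def by blast
  have "(\<lambda>n. l2norm \<mu> (\<lambda>x. \<phi> n x - u x)) \<longlonglongrightarrow> 0"
    by (rule tendsto_sandwich[OF _ _ tendsto_const \<phi>(2)]) (auto simp: l2norm_le_H1_norm)
  moreover have "(\<lambda>n. l2norm \<mu> (\<lambda>x. partial_deriv i (\<phi> n) x - weak_deriv \<Omega> i u x)) \<longlonglongrightarrow> 0" for i
    unfolding l2norm_partial_diff_weak_deriv[OF test_functionsD[OF \<phi>(1)] H10_H1[OF u]]
    by (rule tendsto_sandwich[OF _ _ tendsto_const \<phi>(2)]) (auto simp: l2norm_weak_deriv_le_H1_norm)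
  ultimately show ?thesis using \<phi>(1) by blast
qed

text \<open>Strong limits of the gradients are automatically weak derivatives, since integration by
  parts against a fixed test function passes to the limit. Hence membership of \<open>u\<close> in
  \<open>H1\<close> is a result here and not an assumption.\<close>

lemma H10I:
  assumes \<phi>: "\<And>n. \<phi> n \<in> test_functions \<Omega>" and u: "sq_integrable \<mu> u" and g: "\<And>i. sq_integrable \<mu> (g i)"
    and lim: "(\<lambda>n. l2norm \<mu> (\<lambda>x. \<phi> n x - u x)) \<longlonglongrightarrow> 0"
    and limg: "\<And>i. (\<lambda>n. l2norm \<mu> (\<lambda>x. partial_deriv i (\<phi> n) x - g i x)) \<longlonglongrightarrow> 0"
  shows "u \<in> H10 \<Omega>" "AE x in \<mu>. weak_deriv \<Omega> i u x = g i x"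
proof -
  note c = test_functionsD[OF \<phi>]
  have "has_weak_deriv \<Omega> i u (g i)" for i
    unfolding has_weak_deriv_def L2_inner_def
  proof
    fix \<psi> assume "\<psi> \<in> test_functions \<Omega>"
    then have \<psi>: "\<psi> \<in> C1c \<Omega>" by (rule test_functionsD)
    note \<psi>' = C1c_sq_integrable[OF \<psi>] C1c_partial_sq_integrable[OF \<psi>, of i]
    have "(\<lambda>n. \<integral>x. \<phi> n x * partial_deriv i \<psi> x \<partial>\<mu>) \<longlonglongrightarrow> (\<integral>x. u x * partial_deriv i \<psi> x \<partial>\<mu>)"
      by (rule integral_mult_tendsto[OF C1c_sq_integrable[OF c] u \<psi>'(2) \<psi>'(2) lim]) (simp add: l2norm_def)
    moreover have "(\<lambda>n. \<integral>x. partial_deriv i (\<phi> n) x * \<psi> x \<partial>\<mu>) \<longlonglongrightarrow> (\<integral>x. g i x * \<psi> x \<partial>\<mu>)"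
      by (rule integral_mult_tendsto[OF C1c_partial_sq_integrable[OF c] g \<psi>'(1) \<psi>'(1) limg]) (simp add: l2norm_def)
    then have "(\<lambda>n. \<integral>x. \<phi> n x * partial_deriv i \<psi> x \<partial>\<mu>) \<longlonglongrightarrow> - (\<integral>x. g i x * \<psi> x \<partial>\<mu>)"
      unfolding integration_by_parts[OF c \<psi>] by (rule tendsto_minus)
    ultimately show "(\<integral>x. u x * partial_deriv i \<psi> x \<partial>\<mu>) = - (\<integral>x. g i x * \<psi> x \<partial>\<mu>)"
      by (rule LIMSEQ_unique)
  qed
  note H = H1I[OF u g this]
  show wd: "AE x in \<mu>. weak_deriv \<Omega> i u x = g i x" for i by (rule H(2))
  have "(\<lambda>n. H1_norm \<Omega> (\<lambda>x. \<phi> n x - u x)) \<longlonglongrightarrow> 0"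
  proof (rule H1_norm_tendsto_0)
    show "(\<lambda>x. \<phi> n x - u x) \<in> H1 \<Omega>" for n by (intro H1_diff C1c_H1 c H)
    have "l2norm \<mu> (weak_deriv \<Omega> i (\<lambda>x. \<phi> n x - u x)) = l2norm \<mu> (\<lambda>x. partial_deriv i (\<phi> n) x - g i x)" for i n
      unfolding l2norm_partial_diff_weak_deriv[OF c H(1), symmetric]
    proof (rule l2norm_cong_AE)
      show "AE x in \<mu>. partial_deriv i (\<phi> n) x - weak_deriv \<Omega> i u x = partial_deriv i (\<phi> n) x - g i x"
        using wd[of i] by eventually_elim simp
    qed (intro sq_integrable_measurable sq_integrable_diff C1c_partial_sq_integrable c H1_weak_deriv H g)+
    with limg show "(\<lambda>n. l2norm \<mu> (weak_deriv \<Omega> i (\<lambda>x. \<phi> n x - u x))) \<longlonglongrightarrow> 0" for i by simp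
  qed (rule lim)
  with H(1) \<phi> show "u \<in> H10 \<Omega>" unfolding H10_def by blast
qed

lemma test_functions_H10:
  assumes "\<phi> \<in> test_functions \<Omega>" shows "\<phi> \<in> H10 \<Omega>"
proof (rule H10I(1)[where \<phi>="\<lambda>n. \<phi>" and g="\<lambda>i. partial_deriv i \<phi>"])
  show "sq_integrable \<mu> \<phi>" "\<And>i. sq_integrable \<mu> (partial_deriv i \<phi>)"
    by (rule C1c_sq_integrable[OF test_functionsD[OF assms]] C1c_partial_sq_integrable[OF test_functionsD[OF assms]])+
  show "(\<lambda>n. l2norm \<mu> (\<lambda>x. \<phi> x - \<phi> x)) \<longlonglongrightarrow> 0"
    "\<And>i. (\<lambda>n. l2norm \<mu> (\<lambda>x. partial_deriv i \<phi> x - partial_deriv i \<phi> x)) \<longlonglongrightarrow> 0"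
    by (simp_all add: l2norm_def)
qed (rule assms)

text \<open>Puts differences into the domain of the functional, whose continuity is a bound on
  single elements.\<close>

lemma H10_diff:
  assumes u: "u \<in> H10 \<Omega>" and v: "v \<in> H10 \<Omega>"
  shows "(\<lambda>x. u x - v x) \<in> H10 \<Omega>"
proof -
  obtain \<phi> where \<phi>: "\<And>n. \<phi> n \<in> test_functions \<Omega>" "(\<lambda>n. l2norm \<mu> (\<lambda>x. \<phi> n x - u x)) \<longlonglongrightarrow> 0"
    "\<And>i. (\<lambda>n. l2norm \<mu> (\<lambda>x. partial_deriv i (\<phi> n) x - weak_deriv \<Omega> i u x)) \<longlonglongrightarrow> 0"
    using H10_approx[OF u] by blast
  obtain \<psi> where \<psi>: "\<And>n. \<psi> n \<in> test_functions \<Omega>" "(\<lambda>n. l2norm \<mu> (\<lambda>x. \<psi> n x - v x)) \<longlonglongrightarrow> 0"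
    "\<And>i. (\<lambda>n. l2norm \<mu> (\<lambda>x. partial_deriv i (\<psi> n) x - weak_deriv \<Omega> i v x)) \<longlonglongrightarrow> 0"
    using H10_approx[OF v] by blast
  note c = test_functionsD[OF \<phi>(1)] test_functionsD[OF \<psi>(1)] H10_H1[OF u] H10_H1[OF v]
  have tri: "(\<lambda>n. l2norm \<mu> (\<lambda>x. (f n x - g n x) - (f' x - g' x))) \<longlonglongrightarrow> 0"
    if "\<And>n. sq_integrable \<mu> (f n)" "\<And>n. sq_integrable \<mu> (g n)" "sq_integrable \<mu> f'" "sq_integrable \<mu> g'"
      and "(\<lambda>n. l2norm \<mu> (\<lambda>x. f n x - f' x)) \<longlonglongrightarrow> 0" "(\<lambda>n. l2norm \<mu> (\<lambda>x. g n x - g' x)) \<longlonglongrightarrow> 0" for f g f' g'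
  proof (rule nonneg_tendsto_0)
    show "(\<lambda>n. l2norm \<mu> (\<lambda>x. f n x - f' x) + l2norm \<mu> (\<lambda>x. g n x - g' x)) \<longlonglongrightarrow> 0"
      using tendsto_add[OF that(5,6)] by simp
    show "l2norm \<mu> (\<lambda>x. (f n x - g n x) - (f' x - g' x)) \<le> l2norm \<mu> (\<lambda>x. f n x - f' x) + l2norm \<mu> (\<lambda>x. g n x - g' x)" for n
    proof -
      have "(\<lambda>x. (f n x - g n x) - (f' x - g' x)) = (\<lambda>x. (f n x - f' x) + (g' x - g n x))" by auto
      then show ?thesis
        using l2norm_triangle[OF sq_integrable_diff[OF that(1)[of n] that(3)] sq_integrable_diff[OF that(4) that(2)[of n]]]
        unfolding l2norm_minus_commute[of \<mu> g' "g n"] by metis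
    qed
  qed auto
  show ?thesis
  proof (rule H10I(1)[where \<phi>="\<lambda>n x. \<phi> n x - \<psi> n x" and g="\<lambda>i x. weak_deriv \<Omega> i u x - weak_deriv \<Omega> i v x"])
    show "(\<lambda>x. \<phi> n x - \<psi> n x) \<in> test_functions \<Omega>" for n by (rule test_functions_diff[OF \<phi>(1) \<psi>(1)])
    show "(\<lambda>n. l2norm \<mu> (\<lambda>x. (\<phi> n x - \<psi> n x) - (u x - v x))) \<longlonglongrightarrow> 0"
      by (intro tri C1c_sq_integrable c H1_sq_integrable \<phi> \<psi>)
    show "(\<lambda>n. l2norm \<mu> (\<lambda>x. partial_deriv i (\<lambda>x. \<phi> n x - \<psi> n x) x - (weak_deriv \<Omega> i u x - weak_deriv \<Omega> i v x))) \<longlonglongrightarrow> 0" for i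
      unfolding C1c_partial_diff[OF c(1,2)]
      by (intro tri C1c_partial_sq_integrable c H1_weak_deriv \<phi> \<psi>)
  qed (intro sq_integrable_diff H1_sq_integrable H1_weak_deriv c)+
qed

end

section \<open>Brouwer's fixed point theorem in coordinates\<close>

text \<open>Replaces a diagonal argument by Tychonoff's theorem: with a countable index type the
  product topology is metrizable, so compactness gives convergent subsequences.\<close>

lemma bounded_family_convergent_subseq:
  fixes a :: "nat \<Rightarrow> 'i::countable \<Rightarrow> real"
  assumes "\<And>i. \<exists>B. \<forall>n. \<bar>a n i\<bar> \<le> B"
  shows "\<exists>r::nat\<Rightarrow>nat. strict_mono r \<and> (\<forall>i. convergent (\<lambda>n. a (r n) i))"
proof -
  obtain B where B: "\<And>i n. \<bar>a n i\<bar> \<le> B i" using assms by metis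
  have "compactin (product_topology (\<lambda>i::'i. euclidean) UNIV) (PiE UNIV (\<lambda>i. {- B i..B i}))"
    by (subst compactin_PiE) auto
  then have "compact (PiE UNIV (\<lambda>i. {- B i..B i}) :: ('i \<Rightarrow> real) set)"
    by (simp add: euclidean_product_topology)
  then have "seq_compact (PiE UNIV (\<lambda>i. {- B i..B i}) :: ('i \<Rightarrow> real) set)"
    by (simp add: compact_eq_seq_compact_metric)
  moreover have "a n \<in> PiE UNIV (\<lambda>i. {- B i..B i})" for n
  proof -
    have "- B i \<le> a n i \<and> a n i \<le> B i" for i using B[of n i] by linarith
    then show ?thesis by auto
  qed
  ultimately obtain l r where r: "strict_mono r" "(a \<circ> r) \<longlonglongrightarrow> l"
    unfolding seq_compact_def by blast
  have "(\<lambda>n. a (r n) i) \<longlonglongrightarrow> l i" for i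
  proof -
    have "continuous_on UNIV (\<lambda>x::'i\<Rightarrow>real. x i)"
      by (rule continuous_on_product_coordinates)
    then have "isCont (\<lambda>x::'i\<Rightarrow>real. x i) l"
      using continuous_on_eq_continuous_at[OF open_UNIV, of "\<lambda>x::'i\<Rightarrow>real. x i"] by blast
    from isCont_tendsto_compose[OF this r(2)] show ?thesis by (simp add: o_def)
  qed
  then show ?thesis using r(1) by (auto simp: convergent_def)
qed

text \<open>
  In the library version the dimension is a type, whereas the Galerkin spaces need it as a number;
  Kuhn's lemma is available in that form.
\<close>

lemma brouwer_cube_nat:
  fixes G :: "(nat \<Rightarrow> real) \<Rightarrow> nat \<Rightarrow> real"
  assumes cont: "\<And>c l j. (\<And>i. i < n \<Longrightarrow> (\<lambda>k::nat. c k i) \<longlonglongrightarrow> l i) \<Longrightarrow> j < n \<Longrightarrow> (\<lambda>k. G (c k) j) \<longlonglongrightarrow> G l j"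
    and cube: "\<And>c i. (\<And>i. i < n \<Longrightarrow> 0 \<le> c i \<and> c i \<le> 1) \<Longrightarrow> i < n \<Longrightarrow> 0 \<le> G c i \<and> G c i \<le> 1"
  shows "\<exists>c. (\<forall>i<n. 0 \<le> c i \<and> c i \<le> 1) \<and> (\<forall>i<n. G c i = c i)"
proof -
  \<comment> \<open>Label 0 says that the map does not decrease the coordinate. The exception at 1
    is forced by Kuhn's lemma, which asks for label 1 on the upper face.\<close>
  define label where "label c i = (if c i \<le> G c i \<and> c i \<noteq> 1 then 0 else 1 :: nat)" for c i
  define sc where "sc p x j = real (x j) / real (Suc p)" for p :: nat and x :: "nat \<Rightarrow> nat" and j
  define near where "near z r \<longleftrightarrow> (\<forall>j<n. z j \<le> r j \<and> r j \<le> z j + 1)" for z r :: "nat \<Rightarrow> nat"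
  define kuhn where "kuhn p z \<longleftrightarrow> (\<forall>i<n. z i < Suc p) \<and>
      (\<forall>i<n. \<exists>r s. near z r \<and> near z s \<and> label (sc p r) i \<noteq> label (sc p s) i)" for p z
  have "\<exists>z. kuhn p z" for p
  proof -
    have in_cube: "0 \<le> sc p x j \<and> sc p x j \<le> 1" if "\<forall>i<n. x i \<le> Suc p" "j < n" for x j
      using that by (auto simp: sc_def field_simps simp del: of_nat_Suc)
    have 1: "\<forall>x. (\<forall>i<n. x i \<le> Suc p) \<longrightarrow> (\<forall>i<n. label (sc p x) i = 0 \<or> label (sc p x) i = 1)"
      by (simp add: label_def)
    have 2: "\<forall>x. (\<forall>i<n. x i \<le> Suc p) \<longrightarrow> (\<forall>i<n. x i = 0 \<longrightarrow> label (sc p x) i = 0)"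
    proof (intro allI impI)
      fix x i assume x: "\<forall>i<n. x i \<le> Suc p" "i < n" "x i = 0"
      have "0 \<le> G (sc p x) i" using cube[of "sc p x" i] in_cube[OF x(1)] x(2) by blast
      then show "label (sc p x) i = 0" using x(3) by (simp add: label_def sc_def)
    qed
    have 3: "\<forall>x. (\<forall>i<n. x i \<le> Suc p) \<longrightarrow> (\<forall>i<n. x i = Suc p \<longrightarrow> label (sc p x) i = 1)"
      by (simp add: label_def sc_def del: of_nat_Suc)
    obtain z where "\<forall>i<n. z i < Suc p"
      "\<forall>i<n. \<exists>r s. (\<forall>j<n. z j \<le> r j \<and> r j \<le> z j + 1) \<and> (\<forall>j<n. z j \<le> s j \<and> s j \<le> z j + 1) \<and>
        label (sc p r) i \<noteq> label (sc p s) i"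
      by (rule kuhn_lemma[where label="\<lambda>x. label (sc p x)", OF zero_less_Suc 1 2 3])
    then show ?thesis unfolding kuhn_def near_def by (intro exI[of _ z] conjI)
  qed
  then obtain q where q: "\<And>p. kuhn p (q p)" by metis
  have q1: "q p i < Suc p" if "i < n" for p i
    using q[of p] that unfolding kuhn_def by blast
  \<comment> \<open>Kuhn's lemma gives two vertices of one cell with different labels; they are
    ordered here so that the first has label 0 and the second label 1.\<close>
  define good where "good p i r s \<longleftrightarrow> near (q p) r \<and> near (q p) s \<and> label (sc p r) i = 0 \<and> label (sc p s) i = 1" for p i r s
  have "\<exists>t. i < n \<longrightarrow> good p i (fst t) (snd t)" for p i
  proof (cases "i < n")
    case True
    then obtain r s where rs: "near (q p) r" "near (q p) s" "label (sc p r) i \<noteq> label (sc p s) i"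
      using q[of p] unfolding kuhn_def by blast
    have "label (sc p r) i = 0 \<and> label (sc p s) i = 1 \<or> label (sc p r) i = 1 \<and> label (sc p s) i = 0"
      using rs(3) by (auto simp: label_def split: if_splits)
    then have "good p i r s \<or> good p i s r" using rs(1,2) unfolding good_def by blast
    then show ?thesis by (metis fst_conv snd_conv)
  qed simp
  then have "\<exists>T. \<forall>p i. i < n \<longrightarrow> good p i (fst (T p i)) (snd (T p i))"
    by (intro choice allI)
  then obtain T where T: "\<And>p i. i < n \<Longrightarrow> good p i (fst (T p i)) (snd (T p i))" by blast
  define R where "R p i = fst (T p i)" for p i
  define S where "S p i = snd (T p i)" for p i
  have RS: "good p i (R p i) (S p i)" if "i < n" for p i using T[OF that] by (simp add: R_def S_def)
  have R: "q p j \<le> R p i j \<and> R p i j \<le> q p j + 1" and S: "q p j \<le> S p i j \<and> S p i j \<le> q p j + 1"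
    if "i < n" "j < n" for p i j
    using RS[OF that(1), of p] that(2) unfolding good_def near_def by blast+
  have lR: "label (sc p (R p i)) i = 0" and lS: "label (sc p (S p i)) i = 1" if "i < n" for p i
    using RS[OF that, of p] unfolding good_def by blast+
  \<comment> \<open>Extended by 0 beyond the dimension, so that boundedness holds for all indices
    and the subsequence lemma applies.\<close>
  define a where "a p j = (if j < n then sc p (q p) j else 0)" for p j
  have a01: "0 \<le> a p j \<and> a p j \<le> 1" for p j
    using q1[of j p] by (auto simp: a_def sc_def field_simps)
  have "\<exists>B. \<forall>p. \<bar>a p j\<bar> \<le> B" for j
    using a01 by (intro exI[of _ 1]) (simp add: abs_le_iff order_trans[of _ 0])
  then obtain f where f: "strict_mono (f::nat\<Rightarrow>nat)" "\<And>j. convergent (\<lambda>k. a (f k) j)"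
    using bounded_family_convergent_subseq[of a] by blast
  define l where "l j = lim (\<lambda>k. a (f k) j)" for j
  have l: "(\<lambda>k. a (f k) j) \<longlonglongrightarrow> l j" for j
    using f(2) by (simp add: l_def convergent_LIMSEQ_iff)
  have l01: "0 \<le> l j \<and> l j \<le> 1" for j
    using LIMSEQ_le_const[OF l, of 0] LIMSEQ_le_const2[OF l, of _ 1] a01 by blast
  \<comment> \<open>The cells have side 1/(p + 1), so all their vertices converge to the limit of
    the corners.\<close>
  have close: "(\<lambda>k. sc (f k) (T (f k)) j) \<longlonglongrightarrow> l j"
    if T: "\<And>p. q p j \<le> T p j \<and> T p j \<le> q p j + 1" and j: "j < n" for T j
  proof -
    have "(\<lambda>p. 1 / real (Suc p)) \<longlonglongrightarrow> 0" by (rule lim_inverse_n'[THEN LIMSEQ_Suc])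
    from LIMSEQ_subseq_LIMSEQ[OF this f(1)] have inv: "(\<lambda>k. 1 / real (Suc (f k))) \<longlonglongrightarrow> 0" by (simp add: o_def)
    have "(\<lambda>k. sc (f k) (T (f k)) j - a (f k) j) \<longlonglongrightarrow> 0"
    proof (rule Lim_null_comparison[OF always_eventually inv], intro allI)
      fix k
      have "real (T (f k) j) - real (q (f k) j) \<le> 1" "real (q (f k) j) \<le> real (T (f k) j)"
        using T[of "f k"] by linarith+
      then show "norm (sc (f k) (T (f k)) j - a (f k) j) \<le> 1 / real (Suc (f k))"
        using j by (simp add: a_def sc_def diff_divide_distrib[symmetric] divide_right_mono del: of_nat_Suc)
    qed
    from tendsto_add[OF this l[of j]] show ?thesis by simp
  qed
  have "G l i = l i" if i: "i < n" for i
  proof (rule antisym)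
    have Rl: "(\<lambda>k. sc (f k) (R (f k) i) j) \<longlonglongrightarrow> l j" if "j < n" for j
      by (rule close[of j "\<lambda>p. R p i"]) (use R i that in auto)
    have Sl: "(\<lambda>k. sc (f k) (S (f k) i) j) \<longlonglongrightarrow> l j" if "j < n" for j
      by (rule close[of j "\<lambda>p. S p i"]) (use S i that in auto)
    have "sc (f k) (R (f k) i) i \<le> G (sc (f k) (R (f k) i)) i" for k
      using lR[OF i, of "f k"] by (auto simp: label_def split: if_splits)
    then show "l i \<le> G l i"
      by (intro LIMSEQ_le[OF Rl[OF i] cont[OF Rl i]]) auto
    \<comment> \<open>Label 1 has two causes: either the map lowers the coordinate, or the
      coordinate is 1, and then the inequality holds because the map stays in the cube.\<close>
    have "G (sc (f k) (S (f k) i)) i \<le> sc (f k) (S (f k) i) i" for k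
    proof -
      have "0 \<le> sc (f k) (S (f k) i) j \<and> sc (f k) (S (f k) i) j \<le> 1" if "j < n" for j
      proof -
        have "S (f k) i j \<le> Suc (f k)" using S[OF i that, of "f k"] q1[OF that, of "f k"] by linarith
        then show ?thesis by (simp add: sc_def field_simps del: of_nat_Suc)
      qed
      then have "G (sc (f k) (S (f k) i)) i \<le> 1" using cube i by blast
      then show ?thesis using lS[OF i, of "f k"] by (auto simp: label_def split: if_splits)
    qed
    then show "G l i \<le> l i"
      by (intro LIMSEQ_le[OF cont[OF Sl i] Sl[OF i]]) auto
  qed
  with l01 show ?thesis by blast
qed

text \<open>Retract c - F c radially to the ball of radius \<rho> and apply Brouwer's theorem. At a
  fixed point where the retraction acts, c lies on the sphere and F c is a negative multiple of c,
  against the outward condition; any other fixed point is a zero of F.\<close>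

lemma zero_of_outward_field:
  fixes F :: "(nat \<Rightarrow> real) \<Rightarrow> nat \<Rightarrow> real"
  assumes cont: "\<And>c l j. (\<And>i. i < n \<Longrightarrow> (\<lambda>k::nat. c k i) \<longlonglongrightarrow> l i) \<Longrightarrow> j < n \<Longrightarrow> (\<lambda>k. F (c k) j) \<longlonglongrightarrow> F l j"
    and "\<rho> > 0" and outward: "\<And>c. (\<Sum>i<n. (c i)\<^sup>2) = \<rho>\<^sup>2 \<Longrightarrow> (\<Sum>i<n. F c i * c i) \<ge> 0"
  shows "\<exists>c. (\<Sum>i<n. (c i)\<^sup>2) \<le> \<rho>\<^sup>2 \<and> (\<forall>i<n. F c i = 0)"
proof -
  define C where "C x i = \<rho> * (2 * x i - 1)" for x :: "nat \<Rightarrow> real" and i :: nat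
  define Y where "Y c i = c i - F c i" for c i
  define N where "N y = sqrt (\<Sum>i<n. (y i)\<^sup>2)" for y :: "nat \<Rightarrow> real"
  \<comment> \<open>The radial retraction onto the ball. Its values lie in the cube with half-width
    \<rho>, which \<open>C\<close> parametrizes by the unit cube.\<close>
  define P where "P y i = (\<rho> / max \<rho> (N y)) * y i" for y :: "nat \<Rightarrow> real" and i :: nat
  define G where "G x i = (P (Y (C x)) i / \<rho> + 1) / 2" for x i
  have N0: "N y \<ge> 0" for y by (simp add: N_def sum_nonneg)
  have yN: "\<bar>y i\<bar> \<le> N y" if "i < n" for y i
  proof -
    have "(y i)\<^sup>2 \<le> (\<Sum>i<n. (y i)\<^sup>2)" using that by (intro member_le_sum) auto
    then show ?thesis unfolding N_def by (intro real_le_rsqrt) simp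
  qed
  have Pbound: "\<bar>P y i\<bar> \<le> \<rho>" if "i < n" for y i
  proof -
    have "\<bar>y i\<bar> \<le> max \<rho> (N y)" using yN[OF that, of y] by simp
    then show ?thesis using \<open>\<rho> > 0\<close> by (simp add: P_def abs_mult field_simps max_def)
  qed
  have "\<exists>x. (\<forall>i<n. 0 \<le> x i \<and> x i \<le> 1) \<and> (\<forall>i<n. G x i = x i)"
  proof (rule brouwer_cube_nat)
    fix c :: "nat \<Rightarrow> nat \<Rightarrow> real" and l :: "nat \<Rightarrow> real" and j
    assume c: "\<And>i. i < n \<Longrightarrow> (\<lambda>k. c k i) \<longlonglongrightarrow> l i" and j: "j < n"
    have 1: "(\<lambda>k. C (c k) i) \<longlonglongrightarrow> C l i" if "i < n" for i
      unfolding C_def by (intro tendsto_intros c that)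
    have 2: "(\<lambda>k. Y (C (c k)) i) \<longlonglongrightarrow> Y (C l) i" if "i < n" for i
      unfolding Y_def by (intro tendsto_diff 1 cont that)
    have 3: "(\<lambda>k. N (Y (C (c k)))) \<longlonglongrightarrow> N (Y (C l))"
      unfolding N_def by (intro tendsto_real_sqrt tendsto_sum tendsto_power 2) simp
    have "(\<lambda>k. P (Y (C (c k))) j) \<longlonglongrightarrow> P (Y (C l)) j"
      unfolding P_def using \<open>\<rho> > 0\<close> by (intro tendsto_mult tendsto_divide tendsto_const tendsto_max 2 3 j) auto
    then show "(\<lambda>k. G (c k) j) \<longlonglongrightarrow> G l j"
      unfolding G_def using \<open>\<rho> > 0\<close> by (intro tendsto_intros) auto
  next
    fix c :: "nat \<Rightarrow> real" and i assume "i < n"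
    from Pbound[OF this, of "Y (C c)"] have "- \<rho> \<le> P (Y (C c)) i" "P (Y (C c)) i \<le> \<rho>" by (auto simp: abs_le_iff)
    then show "0 \<le> G c i \<and> G c i \<le> 1"
      using \<open>\<rho> > 0\<close> by (simp add: G_def field_simps)
  qed
  then obtain x where x: "\<And>i. i < n \<Longrightarrow> G x i = x i" by blast
  define c where "c = C x"
  define t where "t = \<rho> / max \<rho> (N (Y c))"
  have t: "t > 0" using \<open>\<rho> > 0\<close> by (simp add: t_def)
  have c: "c i = t * Y c i" if "i < n" for i
  proof -
    have "P (Y c) i = c i"
      using x[OF that] \<open>\<rho> > 0\<close> unfolding G_def c_def[symmetric] by (simp add: c_def C_def field_simps)
    then show ?thesis by (simp add: P_def t_def)
  qed
  show ?thesis
  proof (cases "N (Y c) \<le> \<rho>")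
    case True
    then have "t = 1" using \<open>\<rho> > 0\<close> by (simp add: t_def)
    then have eq: "Y c i = c i" if "i < n" for i using c[OF that] by simp
    have "(\<Sum>i<n. (c i)\<^sup>2) = (\<Sum>i<n. (Y c i)\<^sup>2)" by (intro sum.cong) (auto simp: eq)
    also have "\<dots> = (N (Y c))\<^sup>2" by (simp add: N_def sum_nonneg)
    also have "\<dots> \<le> \<rho>\<^sup>2" using True N0 by (intro power_mono) auto
    finally show ?thesis using eq by (auto simp: Y_def intro!: exI[of _ c])
  next
    case False
    then have t': "t = \<rho> / N (Y c)" and "t < 1" using \<open>\<rho> > 0\<close> by (auto simp: t_def)
    have "(\<Sum>i<n. (c i)\<^sup>2) = (\<Sum>i<n. t\<^sup>2 * (Y c i)\<^sup>2)"
      by (intro sum.cong) (auto simp: c power_mult_distrib)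
    also have "\<dots> = t\<^sup>2 * (N (Y c))\<^sup>2" by (simp add: N_def sum_nonneg sum_distrib_left)
    also have "\<dots> = \<rho>\<^sup>2" using False \<open>\<rho> > 0\<close> by (simp add: t' power_divide)
    finally have sphere: "(\<Sum>i<n. (c i)\<^sup>2) = \<rho>\<^sup>2" .
    have "F c i * c i = (1 - 1 / t) * (c i)\<^sup>2" if "i < n" for i
    proof -
      have "F c i = c i - c i / t" using c[OF that] t by (simp add: Y_def field_simps)
      then have "F c i * c i = (c i - c i / t) * c i" by (simp only:)
      then show ?thesis by (simp add: power2_eq_square left_diff_distrib)
    qed
    then have "(\<Sum>i<n. F c i * c i) = (1 - 1 / t) * \<rho>\<^sup>2" by (simp add: sphere[symmetric] sum_distrib_left)
    moreover have "(1 - 1 / t) * \<rho>\<^sup>2 < 0" using t \<open>t < 1\<close> \<open>\<rho> > 0\<close> by (intro mult_neg_pos) auto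
    ultimately show ?thesis using outward[OF sphere] by simp
  qed
qed

section \<open>The Gagliardo--Nirenberg inequality in the plane\<close>

definition vec2 :: "real \<Rightarrow> real \<Rightarrow> real^2" where
  "vec2 a b = (\<chi> i. if i = 1 then a else b)"

lemma vec2_nth [simp]: "vec2 a b $ 1 = a" "vec2 a b $ 2 = b"
  by (simp_all add: vec2_def)

lemma continuous_on_vec2:
  assumes "continuous_on S f" "continuous_on S g"
  shows "continuous_on S (\<lambda>x. vec2 (f x) (g x))"
proof -
  have "continuous_on S (\<lambda>x. if i = 1 then f x else g x)" for i :: 2
    using assms by (cases "i = 1") auto
  then show ?thesis
    unfolding vec2_def by (intro continuous_on_vec_lambda)
qed

lemma measurable_vec2: "(\<lambda>p. vec2 (fst p) (snd p)) \<in> borel_measurable (borel \<Otimes>\<^sub>M borel)"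
  unfolding borel_prod by (intro borel_measurable_continuous_onI continuous_on_vec2 continuous_intros)

lemma measurable_vec2_compose [measurable]:
  assumes [measurable]: "f \<in> borel_measurable M" "g \<in> borel_measurable M"
  shows "(\<lambda>x. vec2 (f x) (g x)) \<in> borel_measurable M"
  using measurable_compose[OF measurable_Pair[OF assms] measurable_vec2] by simp

text \<open>Identifies the plane with a product of lines, so that Tonelli's theorem yields iterated
  integrals in either order.\<close>

lemma lborel_eq_distr_vec2: "(lborel :: (real^2) measure) = distr (lborel \<Otimes>\<^sub>M lborel) borel (\<lambda>p. vec2 (fst p) (snd p))"
proof (rule lborel_eqI)
  fix l u :: "real^2"
  assume le: "\<And>b. b \<in> Basis \<Longrightarrow> l \<bullet> b \<le> u \<bullet> b"
  have le': "l $ i \<le> u $ i" for i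
    using le[of "axis i 1"] by (auto simp: Basis_vec_def inner_axis)
  have "(\<lambda>p. vec2 (fst p) (snd p)) -` box l u = {l $ 1<..<u $ 1} \<times> {l $ 2<..<u $ 2}"
    by (auto simp: mem_box_cart forall_2)
  then have "emeasure (distr (lborel \<Otimes>\<^sub>M lborel) borel (\<lambda>p. vec2 (fst p) (snd p))) (box l u)
      = emeasure (lborel \<Otimes>\<^sub>M lborel) ({l $ 1<..<u $ 1} \<times> {l $ 2<..<u $ 2})"
    using measurable_vec2 by (subst emeasure_distr) (auto simp: space_pair_measure)
  also have "\<dots> = emeasure lborel {l $ 1<..<u $ 1} * emeasure lborel {l $ 2<..<u $ 2}"
    by (rule lborel.emeasure_pair_measure_Times) auto
  also have "\<dots> = ennreal ((u $ 1 - l $ 1) * (u $ 2 - l $ 2))"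
    using le'[of 1] le'[of 2] by (simp add: ennreal_mult)
  also have "(u $ 1 - l $ 1) * (u $ 2 - l $ 2) = (\<Prod>b\<in>Basis. (u - l) \<bullet> b)"
  proof -
    have B: "(Basis :: (real^2) set) = {axis 1 1, axis 2 1}"
      by (auto simp: Basis_vec_def UNIV_2)
    have "axis 1 (1::real) \<noteq> (axis 2 1 :: real^2)" by (simp add: axis_eq_axis)
    then show ?thesis unfolding B by (simp add: inner_axis)
  qed
  finally show "emeasure (distr (lborel \<Otimes>\<^sub>M lborel) borel (\<lambda>p. vec2 (fst p) (snd p))) (box l u)
      = ennreal (\<Prod>b\<in>Basis. (u - l) \<bullet> b)" .
qed simp

lemma nn_integral_lborel_vec2:
  assumes [measurable]: "f \<in> borel_measurable borel"
  shows "(\<integral>\<^sup>+x. f x \<partial>lborel) = (\<integral>\<^sup>+a. \<integral>\<^sup>+b. f (vec2 a b) \<partial>lborel \<partial>lborel)"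
    "(\<integral>\<^sup>+x. f x \<partial>lborel) = (\<integral>\<^sup>+b. \<integral>\<^sup>+a. f (vec2 a b) \<partial>lborel \<partial>lborel)"
proof -
  have eq: "(\<integral>\<^sup>+x. f x \<partial>lborel) = (\<integral>\<^sup>+p. f (vec2 (fst p) (snd p)) \<partial>(lborel \<Otimes>\<^sub>M lborel))"
    by (subst lborel_eq_distr_vec2, subst nn_integral_distr) (auto simp: measurable_vec2)
  show "(\<integral>\<^sup>+x. f x \<partial>lborel) = (\<integral>\<^sup>+a. \<integral>\<^sup>+b. f (vec2 a b) \<partial>lborel \<partial>lborel)"
    unfolding eq by (subst lborel.nn_integral_fst[symmetric]) (simp_all add: measurable_vec2)
  show "(\<integral>\<^sup>+x. f x \<partial>lborel) = (\<integral>\<^sup>+b. \<integral>\<^sup>+a. f (vec2 a b) \<partial>lborel \<partial>lborel)"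
    unfolding eq by (subst lborel_pair.nn_integral_snd[symmetric]) (simp_all add: measurable_vec2)
qed

text \<open>The fundamental theorem of calculus from a zero of g. With an integral in
  \<open>ennreal\<close> the bound may extend over the whole line without an integrability condition
  on the derivative.\<close>

lemma abs_le_nn_integral_deriv:
  fixes g :: "real \<Rightarrow> real"
  assumes deriv: "\<And>t. (g has_real_derivative g' t) (at t)" and cont: "continuous_on UNIV g'"
    and zero: "a \<le> t" "g a = 0"
  shows "ennreal \<bar>g t\<bar> \<le> (\<integral>\<^sup>+s. ennreal \<bar>g' s\<bar> \<partial>lborel)"
proof -
  have I: "has_bochner_integral lborel (\<lambda>x. g' x * indicator {a..t} x) (g t - g a)"
    using cont by (intro has_bochner_integral_FTC_Icc_real zero deriv) (simp add: continuous_on_eq_continuous_at)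
  have [measurable]: "g' \<in> borel_measurable borel" using cont by (rule borel_measurable_continuous_onI)
  have "ennreal (norm (\<integral>x. g' x * indicator {a..t} x \<partial>lborel)) \<le> (\<integral>\<^sup>+x. ennreal (norm (g' x * indicator {a..t} x)) \<partial>lborel)"
    using I by (intro integral_norm_bound_ennreal) (auto simp: has_bochner_integral_iff)
  also have "\<dots> \<le> (\<integral>\<^sup>+s. ennreal \<bar>g' s\<bar> \<partial>lborel)"
    by (intro nn_integral_mono) (auto simp: indicator_def)
  finally show ?thesis using I zero by (simp add: has_bochner_integral_iff)
qed

lemma vec2_line: "vec2 s b = vec2 0 b + s *\<^sub>R axis 1 1" "vec2 a s = vec2 a 0 + s *\<^sub>R axis 2 1"
  by (simp_all add: vec_eq_iff forall_2 axis_def)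

lemma C1c_derivative_vec2:
  assumes "w \<in> C1c \<Omega>"
  shows "((\<lambda>s. w (vec2 s b)) has_real_derivative partial_deriv 1 w (vec2 t b)) (at t)"
    "((\<lambda>s. w (vec2 a s)) has_real_derivative partial_deriv 2 w (vec2 a t)) (at t)"
  using has_real_derivative_line[OF C1c_differentiable[OF assms], where x="vec2 0 b" and t=t and i=1]
    has_real_derivative_line[OF C1c_differentiable[OF assms], where x="vec2 a 0" and t=t and i=2]
  unfolding vec2_line[symmetric] .

text \<open>Bound one factor \<open>\<bar>w\<bar>\<close> by integrating along horizontal lines and the other along vertical ones.\<close>

lemma Gagliardo_Nirenberg_nn_integral:
  assumes w: "w \<in> C1c (\<Omega> :: (real^2) set)"
  shows "(\<integral>\<^sup>+x. ennreal ((w x)\<^sup>2) \<partial>lborel)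
    \<le> (\<integral>\<^sup>+x. ennreal \<bar>partial_deriv 1 w x\<bar> \<partial>lborel) * (\<integral>\<^sup>+x. ennreal \<bar>partial_deriv 2 w x\<bar> \<partial>lborel)"
proof -
  obtain K where K: "compact K" "\<And>x. x \<notin> K \<Longrightarrow> w x = 0" using C1c_support[OF w] by metis
  obtain R where R: "\<And>x. x \<in> K \<Longrightarrow> norm x \<le> R" using compact_imp_bounded[OF K(1)] by (auto simp: bounded_iff)
  have out: "w x = 0" if "\<bar>x $ i\<bar> > R" for x i
    using R K(2) component_le_norm_cart[of x i] that by force
  note [measurable] = C1c_borel_measurable[OF w] C1c_partial_borel_measurable[OF w]
  define A where "A b = (\<integral>\<^sup>+s. ennreal \<bar>partial_deriv 1 w (vec2 s b)\<bar> \<partial>lborel)" for b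
  define B where "B a = (\<integral>\<^sup>+s. ennreal \<bar>partial_deriv 2 w (vec2 a s)\<bar> \<partial>lborel)" for a
  have Am [measurable]: "A \<in> borel_measurable borel"
    unfolding A_def by measurable
  have Bm [measurable]: "B \<in> borel_measurable borel"
    unfolding B_def by measurable
  have wA: "ennreal \<bar>w (vec2 a b)\<bar> \<le> A b" for a b
    unfolding A_def
  proof (rule abs_le_nn_integral_deriv[OF C1c_derivative_vec2(1)[OF w]])
    show "continuous_on UNIV (\<lambda>s. partial_deriv 1 w (vec2 s b))"
      by (rule continuous_on_compose2[OF C1c_continuous_partial[OF w]]) (auto intro!: continuous_on_vec2 continuous_intros)
    \<comment> \<open>This starting point is to the left of \<open>a\<close> and outside the
      support.\<close>
    show "- \<bar>a\<bar> - \<bar>R\<bar> - 1 \<le> a" by simp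
    show "w (vec2 (- \<bar>a\<bar> - \<bar>R\<bar> - 1) b) = 0" by (rule out[of _ 1]) simp
  qed
  have wB: "ennreal \<bar>w (vec2 a b)\<bar> \<le> B a" for a b
    unfolding B_def
  proof (rule abs_le_nn_integral_deriv[OF C1c_derivative_vec2(2)[OF w]])
    show "continuous_on UNIV (\<lambda>s. partial_deriv 2 w (vec2 a s))"
      by (rule continuous_on_compose2[OF C1c_continuous_partial[OF w]]) (auto intro!: continuous_on_vec2 continuous_intros)
    show "- \<bar>b\<bar> - \<bar>R\<bar> - 1 \<le> b" by simp
    show "w (vec2 a (- \<bar>b\<bar> - \<bar>R\<bar> - 1)) = 0" by (rule out[of _ 2]) simp
  qed
  have "(\<integral>\<^sup>+x. ennreal ((w x)\<^sup>2) \<partial>lborel) = (\<integral>\<^sup>+a. \<integral>\<^sup>+b. ennreal ((w (vec2 a b))\<^sup>2) \<partial>lborel \<partial>lborel)"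
    by (rule nn_integral_lborel_vec2(1)) measurable
  also have "\<dots> \<le> (\<integral>\<^sup>+a. \<integral>\<^sup>+b. B a * A b \<partial>lborel \<partial>lborel)"
  proof (intro nn_integral_mono)
    fix a b
    have "ennreal ((w (vec2 a b))\<^sup>2) = ennreal \<bar>w (vec2 a b)\<bar> * ennreal \<bar>w (vec2 a b)\<bar>"
      by (simp add: power2_eq_square ennreal_mult[symmetric] abs_mult_self_eq)
    also have "\<dots> \<le> B a * A b" by (intro mult_mono wA wB) auto
    finally show "ennreal ((w (vec2 a b))\<^sup>2) \<le> B a * A b" .
  qed
  also have "\<dots> = (\<integral>\<^sup>+a. B a \<partial>lborel) * (\<integral>\<^sup>+b. A b \<partial>lborel)"
    by (simp add: nn_integral_cmult nn_integral_multc)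
  also have "(\<integral>\<^sup>+a. B a \<partial>lborel) = (\<integral>\<^sup>+x. ennreal \<bar>partial_deriv 2 w x\<bar> \<partial>lborel)"
    unfolding B_def by (rule nn_integral_lborel_vec2(1)[symmetric]) measurable
  also have "(\<integral>\<^sup>+b. A b \<partial>lborel) = (\<integral>\<^sup>+x. ennreal \<bar>partial_deriv 1 w x\<bar> \<partial>lborel)"
    unfolding A_def by (rule nn_integral_lborel_vec2(2)[symmetric]) measurable
  finally show ?thesis by (simp add: mult.commute)
qed

section \<open>Energy and moments on a planar domain\<close>

locale planar_domain = bounded_open \<Omega> for \<Omega> :: "(real^2) set"
begin

definition energy :: "(real^2 \<Rightarrow> real) \<Rightarrow> real" where
  "energy \<phi> = (\<Sum>i\<in>UNIV. (l2norm \<mu> (partial_deriv i \<phi>))\<^sup>2)"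

lemma energy_nonneg: "energy \<phi> \<ge> 0"
  by (simp add: energy_def sum_nonneg)

lemma l2norm_partial_sq_le_energy: "(l2norm \<mu> (partial_deriv i \<phi>))\<^sup>2 \<le> energy \<phi>"
  unfolding energy_def by (rule member_le_sum) auto

lemma l2norm_partial_le: "l2norm \<mu> (partial_deriv i \<phi>) \<le> sqrt (energy \<phi>)"
  using l2norm_partial_sq_le_energy by (intro real_le_rsqrt)

abbreviation area :: real where "area \<equiv> measure \<mu> (space \<mu>)"

lemma Gagliardo_Nirenberg:
  assumes w: "w \<in> C1c \<Omega>"
  shows "(\<integral>x. (w x)\<^sup>2 \<partial>\<mu>) \<le> (\<integral>x. \<bar>partial_deriv 1 w x\<bar> \<partial>\<mu>) * (\<integral>x. \<bar>partial_deriv 2 w x\<bar> \<partial>\<mu>)"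
proof -
  note bm = C1c_borel_measurable[OF w] and bmp = C1c_partial_borel_measurable[OF w]
  have I: "(\<integral>x. (w x)\<^sup>2 \<partial>\<mu>) = (\<integral>x. (w x)\<^sup>2 \<partial>lborel)" "integrable lborel (\<lambda>x. (w x)\<^sup>2)"
    using lebesgue_on_zero_outside[OF open_domain, of "\<lambda>x. (w x)\<^sup>2"] bm C1c_zero_outside[OF w]
      sq_integrable_sq[OF C1c_sq_integrable[OF w]] by auto
  have P: "(\<integral>x. \<bar>partial_deriv i w x\<bar> \<partial>\<mu>) = (\<integral>x. \<bar>partial_deriv i w x\<bar> \<partial>lborel)"
    "integrable lborel (\<lambda>x. \<bar>partial_deriv i w x\<bar>)" for i
    using lebesgue_on_zero_outside[OF open_domain, of "\<lambda>x. \<bar>partial_deriv i w x\<bar>"] bmp C1c_partial_zero_outside[OF w]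
      l1_le_l2norm(1)[OF C1c_partial_sq_integrable[OF w, of i]] by auto
  have "ennreal (\<integral>x. (w x)\<^sup>2 \<partial>lborel)
      \<le> ennreal (\<integral>x. \<bar>partial_deriv 1 w x\<bar> \<partial>lborel) * ennreal (\<integral>x. \<bar>partial_deriv 2 w x\<bar> \<partial>lborel)"
    using Gagliardo_Nirenberg_nn_integral[OF w] I(2) P(2) by (simp add: nn_integral_eq_integral)
  then have "ennreal (\<integral>x. (w x)\<^sup>2 \<partial>lborel)
      \<le> ennreal ((\<integral>x. \<bar>partial_deriv 1 w x\<bar> \<partial>lborel) * (\<integral>x. \<bar>partial_deriv 2 w x\<bar> \<partial>lborel))"
    by (simp add: ennreal_mult)
  then show ?thesis unfolding I P by (subst (asm) ennreal_le_iff) simp_all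
qed

lemma C1c_power:
  assumes u: "u \<in> C1c \<Omega>"
  shows "(\<lambda>x. u x ^ Suc k) \<in> C1c \<Omega>" "partial_deriv i (\<lambda>x. u x ^ Suc k) x = (real (Suc k) * u x ^ k) * partial_deriv i u x"
proof -
  have d: "((\<lambda>t::real. t ^ Suc k) has_real_derivative real (Suc k) * t ^ k) (at t)" for t
    using DERIV_pow[of "Suc k" t] by simp
  have c: "continuous_on UNIV (\<lambda>t::real. real (Suc k) * t ^ k)" by (intro continuous_intros)
  show "(\<lambda>x. u x ^ Suc k) \<in> C1c \<Omega>" by (rule C1c_chain(1)[OF u d c]) simp
  show "partial_deriv i (\<lambda>x. u x ^ Suc k) x = (real (Suc k) * u x ^ k) * partial_deriv i u x"
    by (rule C1c_chain(2)[OF u d c]) simp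
qed

lemma C1c_power_sq_integrable: "u \<in> C1c \<Omega> \<Longrightarrow> sq_integrable \<mu> (\<lambda>x. u x ^ k)"
proof (cases k)
  case 0 then show ?thesis by (simp add: sq_integrable_def)
next
  case (Suc j) then show "u \<in> C1c \<Omega> \<Longrightarrow> ?thesis" using C1c_sq_integrable[OF C1c_power(1)] by simp
qed

text \<open>Induction by applying \<open>Gagliardo_Nirenberg\<close> to u^(k+1). Its derivatives are
  (k+1) u^k times those of u, so Cauchy-Schwarz on each factor gives (k+1)^2 times the moment of
  order 2k times the energy; the squared factorial collects these coefficients.\<close>

lemma moment_bound:
  assumes u: "u \<in> C1c \<Omega>"
  shows "(\<integral>x. u x ^ (2 * m) \<partial>\<mu>) \<le> area * (fact m)\<^sup>2 * energy u ^ m"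
proof (induction m)
  case 0 then show ?case by simp
next
  case (Suc k)
  note sq = C1c_power_sq_integrable[OF u, of k]
  define L where "L = real (Suc k) * l2norm \<mu> (\<lambda>x. u x ^ k) * sqrt (energy u)"
  have L: "(\<integral>x. \<bar>partial_deriv i (\<lambda>x. u x ^ Suc k) x\<bar> \<partial>\<mu>) \<le> L" for i
  proof -
    have "(\<integral>x. \<bar>partial_deriv i (\<lambda>x. u x ^ Suc k) x\<bar> \<partial>\<mu>) = (\<integral>x. \<bar>(real (Suc k) * u x ^ k) * partial_deriv i u x\<bar> \<partial>\<mu>)"
      unfolding C1c_power(2)[OF u] ..
    also have "\<dots> \<le> l2norm \<mu> (\<lambda>x. real (Suc k) * u x ^ k) * l2norm \<mu> (partial_deriv i u)"
      by (intro Cauchy_Schwarz_integral_abs sq_integrable_cmult sq C1c_partial_sq_integrable u)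
    also have "\<dots> \<le> l2norm \<mu> (\<lambda>x. real (Suc k) * u x ^ k) * sqrt (energy u)"
      by (intro mult_left_mono l2norm_partial_le) simp
    also have "\<dots> = L" unfolding L_def l2norm_cmult by simp
    finally show ?thesis .
  qed
  have "(\<integral>x. u x ^ (2 * Suc k) \<partial>\<mu>) = (\<integral>x. (u x ^ Suc k)\<^sup>2 \<partial>\<mu>)"
    by (simp only: power_mult[symmetric] mult.commute)
  also have "\<dots> \<le> L * L"
    by (rule order_trans[OF Gagliardo_Nirenberg[OF C1c_power(1)[OF u]] mult_mono[OF L L]])
      (auto simp: L_def energy_nonneg)
  also have "\<dots> = (real (Suc k))\<^sup>2 * (l2norm \<mu> (\<lambda>x. u x ^ k))\<^sup>2 * (sqrt (energy u))\<^sup>2"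
    unfolding L_def by (simp only: power2_eq_square mult_ac)
  also have "\<dots> = (real (Suc k))\<^sup>2 * (\<integral>x. u x ^ (2 * k) \<partial>\<mu>) * energy u"
    by (simp only: l2norm_sq real_sqrt_pow2[OF energy_nonneg] power_mult[symmetric] mult.commute[of k])
  also have "\<dots> \<le> (real (Suc k))\<^sup>2 * (area * (fact k)\<^sup>2 * energy u ^ k) * energy u"
    by (intro mult_right_mono mult_left_mono Suc energy_nonneg) simp
  also have "\<dots> = area * (fact (Suc k))\<^sup>2 * energy u ^ Suc k"
    by (simp add: power_mult_distrib mult_ac)
  finally show ?case .
qed

text \<open>The first step of the moment recursion.\<close>

lemma Poincare: "u \<in> C1c \<Omega> \<Longrightarrow> (l2norm \<mu> u)\<^sup>2 \<le> area * energy u"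
  using moment_bound[of u 1] by (simp add: l2norm_sq)

end

section \<open>Compactness\<close>

lemma emeasure_lborel_vec2_rect:
  assumes [measurable]: "A \<in> sets borel" "B \<in> sets borel"
  shows "{x::real^2. x $ 1 \<in> A \<and> x $ 2 \<in> B} \<in> sets borel"
    "emeasure lborel {x::real^2. x $ 1 \<in> A \<and> x $ 2 \<in> B} = emeasure lborel A * emeasure lborel B"
proof -
  have [measurable]: "(\<lambda>x::real^2. x $ i) \<in> borel_measurable borel" for i
    by (intro borel_measurable_continuous_onI continuous_intros)
  show m: "{x::real^2. x $ 1 \<in> A \<and> x $ 2 \<in> B} \<in> sets borel" by measurable
  have "emeasure lborel {x::real^2. x $ 1 \<in> A \<and> x $ 2 \<in> B}
      = (\<integral>\<^sup>+x. indicator {x::real^2. x $ 1 \<in> A \<and> x $ 2 \<in> B} x \<partial>lborel)" using m by simp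
  also have "\<dots> = (\<integral>\<^sup>+a. \<integral>\<^sup>+b. indicator A a * indicator B b \<partial>lborel \<partial>lborel)"
    using m by (subst nn_integral_lborel_vec2(1)) (auto intro!: nn_integral_cong simp: indicator_def)
  also have "\<dots> = emeasure lborel A * emeasure lborel B"
    by (simp add: nn_integral_cmult nn_integral_multc)
  finally show "emeasure lborel {x::real^2. x $ 1 \<in> A \<and> x $ 2 \<in> B} = emeasure lborel A * emeasure lborel B" .
qed

text \<open>The fundamental theorem of calculus with Cauchy-Schwarz. The symmetric interval covers
  both signs of s and makes the bound independent of s.\<close>

lemma sq_diff_le_nn_integral_deriv:
  fixes g :: "real \<Rightarrow> real"
  assumes deriv: "\<And>t. (g has_real_derivative g' t) (at t)" and cont: "continuous_on UNIV g'"
    and s: "\<bar>s\<bar> \<le> h"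
  shows "ennreal ((g s - g 0)\<^sup>2) \<le> ennreal (2 * h) * (\<integral>\<^sup>+t. ennreal ((g' t)\<^sup>2) * indicator {-h..h} t \<partial>lborel)"
proof -
  have [measurable]: "g' \<in> borel_measurable borel" using cont by (rule borel_measurable_continuous_onI)
  have I: "has_bochner_integral lborel (\<lambda>x. g' x * indicator {min 0 s..max 0 s} x) (g (max 0 s) - g (min 0 s))"
    using cont by (intro has_bochner_integral_FTC_Icc_real deriv) (auto simp: continuous_on_eq_continuous_at)
  have "ennreal \<bar>g s - g 0\<bar> = ennreal (norm (\<integral>x. g' x * indicator {min 0 s..max 0 s} x \<partial>lborel))"
    using I by (auto simp: has_bochner_integral_iff min_def max_def)
  also have "\<dots> \<le> (\<integral>\<^sup>+x. ennreal (norm (g' x * indicator {min 0 s..max 0 s} x)) \<partial>lborel)"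
    using I by (intro integral_norm_bound_ennreal) (auto simp: has_bochner_integral_iff)
  also have "\<dots> \<le> (\<integral>\<^sup>+x. (ennreal \<bar>g' x\<bar> * indicator {-h..h} x) * indicator {-h..h} x \<partial>lborel)"
    using s by (intro nn_integral_mono) (auto simp: indicator_def)
  finally have le: "ennreal \<bar>g s - g 0\<bar> \<le> (\<integral>\<^sup>+x. (ennreal \<bar>g' x\<bar> * indicator {-h..h} x) * indicator {-h..h} x \<partial>lborel)" .
  have "ennreal ((g s - g 0)\<^sup>2) = (ennreal \<bar>g s - g 0\<bar>)\<^sup>2"
    by (simp add: ennreal_power)
  also have "\<dots> \<le> (\<integral>\<^sup>+x. (ennreal \<bar>g' x\<bar> * indicator {-h..h} x) * indicator {-h..h} x \<partial>lborel)\<^sup>2"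
    by (intro power_mono le) simp
  also have "\<dots> \<le> (\<integral>\<^sup>+x. (ennreal \<bar>g' x\<bar> * indicator {-h..h} x)\<^sup>2 \<partial>lborel) * (\<integral>\<^sup>+x. (indicator {-h..h} x)\<^sup>2 \<partial>lborel)"
    by (rule Cauchy_Schwarz_nn_integral) measurable
  also have "(\<integral>\<^sup>+x. (indicator {-h..h} x)\<^sup>2 \<partial>lborel) = (\<integral>\<^sup>+x. indicator {-h..h} x \<partial>lborel)"
    by (intro nn_integral_cong) (simp add: indicator_def)
  also have "\<dots> = ennreal (2 * h)" using s by simp
  also have "(\<integral>\<^sup>+x. (ennreal \<bar>g' x\<bar> * indicator {-h..h} x)\<^sup>2 \<partial>lborel) = (\<integral>\<^sup>+t. ennreal ((g' t)\<^sup>2) * indicator {-h..h} t \<partial>lborel)"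
    by (intro nn_integral_cong) (simp add: indicator_def ennreal_power)
  finally show ?thesis by (simp add: mult.commute)
qed

lemma nn_integral_lborel_translate:
  fixes f :: "'a::euclidean_space \<Rightarrow> ennreal"
  assumes "f \<in> borel_measurable borel"
  shows "(\<integral>\<^sup>+x. f (x + c) \<partial>lborel) = (\<integral>\<^sup>+x. f x \<partial>lborel)"
proof -
  have "(\<integral>\<^sup>+x. f x \<partial>lborel) = (\<integral>\<^sup>+x. f x \<partial>distr lborel borel ((+) c))"
    by (simp add: lborel_distr_plus)
  also have "\<dots> = (\<integral>\<^sup>+x. f (x + c) \<partial>lborel)"
    using assms by (subst nn_integral_distr) (auto simp: add.commute)
  finally show ?thesis by simp
qed

text \<open>After exchanging the integrals, translation invariance gives every shift t the same
  integral. The length 2 h of the interval enters twice, once from Cauchy-Schwarz and once from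
  integrating over t.\<close>

lemma nn_integral_axis_translation:
  fixes w :: "real^'n \<Rightarrow> real"
  assumes w: "w \<in> C1c \<Omega>" and s: "\<bar>s\<bar> \<le> h"
  shows "(\<integral>\<^sup>+x. ennreal ((w (x + s *\<^sub>R axis i 1) - w x)\<^sup>2) \<partial>lborel)
    \<le> ennreal (4 * h\<^sup>2) * (\<integral>\<^sup>+x. ennreal ((partial_deriv i w x)\<^sup>2) \<partial>lborel)"
proof -
  note [measurable] = C1c_borel_measurable[OF w] C1c_partial_borel_measurable[OF w]
  let ?D = "\<lambda>x. ennreal ((partial_deriv i w x)\<^sup>2)"
  have "h \<ge> 0" using s by simp
  have "(\<integral>\<^sup>+x. ennreal ((w (x + s *\<^sub>R axis i 1) - w x)\<^sup>2) \<partial>lborel)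
      \<le> (\<integral>\<^sup>+x. ennreal (2 * h) * (\<integral>\<^sup>+t. ?D (x + t *\<^sub>R axis i 1) * indicator {-h..h} t \<partial>lborel) \<partial>lborel)"
  proof (rule nn_integral_mono)
    fix x
    have "continuous_on UNIV (\<lambda>t. partial_deriv i w (x + t *\<^sub>R axis i 1))"
      by (rule continuous_on_compose2[OF C1c_continuous_partial[OF w]]) (auto intro!: continuous_intros)
    from sq_diff_le_nn_integral_deriv[OF has_real_derivative_line[OF C1c_differentiable[OF w]] this s]
    show "ennreal ((w (x + s *\<^sub>R axis i 1) - w x)\<^sup>2)
        \<le> ennreal (2 * h) * (\<integral>\<^sup>+t. ?D (x + t *\<^sub>R axis i 1) * indicator {-h..h} t \<partial>lborel)" by simp
  qed
  also have "\<dots> = ennreal (2 * h) * (\<integral>\<^sup>+x. (\<integral>\<^sup>+t. ?D (x + t *\<^sub>R axis i 1) * indicator {-h..h} t \<partial>lborel) \<partial>lborel)"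
    by (rule nn_integral_cmult) measurable
  also have "(\<integral>\<^sup>+x. (\<integral>\<^sup>+t. ?D (x + t *\<^sub>R axis i 1) * indicator {-h..h} t \<partial>lborel) \<partial>lborel)
      = (\<integral>\<^sup>+t. (\<integral>\<^sup>+x. ?D (x + t *\<^sub>R axis i 1) * indicator {-h..h} t \<partial>lborel) \<partial>lborel)"
    by (rule lborel_pair.Fubini'[symmetric]) measurable
  also have "\<dots> = (\<integral>\<^sup>+t. (\<integral>\<^sup>+x. ?D x \<partial>lborel) * indicator {-h..h} t \<partial>lborel)"
  proof (rule nn_integral_cong)
    fix t
    have "(\<integral>\<^sup>+x. ?D (x + t *\<^sub>R axis i 1) * indicator {-h..h} t \<partial>lborel)
        = (\<integral>\<^sup>+x. ?D (x + t *\<^sub>R axis i 1) \<partial>lborel) * indicator {-h..h} t"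
      by (rule nn_integral_multc) measurable
    also have "(\<integral>\<^sup>+x. ?D (x + t *\<^sub>R axis i 1) \<partial>lborel) = (\<integral>\<^sup>+x. ?D x \<partial>lborel)"
      by (rule nn_integral_lborel_translate) measurable
    finally show "(\<integral>\<^sup>+x. ?D (x + t *\<^sub>R axis i 1) * indicator {-h..h} t \<partial>lborel)
        = (\<integral>\<^sup>+x. ?D x \<partial>lborel) * indicator {-h..h} t" .
  qed
  also have "\<dots> = (\<integral>\<^sup>+x. ?D x \<partial>lborel) * ennreal (2 * h)"
    using \<open>h \<ge> 0\<close> by (subst nn_integral_cmult) auto
  also have "ennreal (2 * h) * ((\<integral>\<^sup>+x. ?D x \<partial>lborel) * ennreal (2 * h)) = ennreal (2 * h) * ennreal (2 * h) * (\<integral>\<^sup>+x. ?D x \<partial>lborel)"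
    by (simp only: mult_ac)
  also have "ennreal (2 * h) * ennreal (2 * h) = ennreal (4 * h\<^sup>2)"
    using \<open>h \<ge> 0\<close> by (simp add: ennreal_mult[symmetric] power2_eq_square)
  finally show ?thesis .
qed

definition cell :: "real \<Rightarrow> real^2 \<Rightarrow> int \<times> int" where
  "cell h x = (\<lfloor>x $ 1 / h\<rfloor>, \<lfloor>x $ 2 / h\<rfloor>)"

lemma finite_cell_image:
  assumes "bounded S" "h > 0" shows "finite (cell h ` S)"
proof -
  obtain R where R: "\<And>x. x \<in> S \<Longrightarrow> norm x \<le> R" using assms(1) by (auto simp: bounded_iff)
  have *: "\<lfloor>x $ i / h\<rfloor> \<in> {\<lfloor>- R / h\<rfloor>..\<lfloor>R / h\<rfloor>}" if "x \<in> S" for x i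
  proof -
    have "\<bar>x $ i\<bar> \<le> R" using component_le_norm_cart[of x i] R[OF that] by linarith
    then have "- R / h \<le> x $ i / h" "x $ i / h \<le> R / h"
      using assms(2) by (auto simp: pos_le_divide_eq)
    then show ?thesis by (auto intro: floor_mono)
  qed
  have "cell h ` S \<subseteq> {\<lfloor>- R / h\<rfloor>..\<lfloor>R / h\<rfloor>} \<times> {\<lfloor>- R / h\<rfloor>..\<lfloor>R / h\<rfloor>}"
    using * by (auto simp: cell_def)
  then show ?thesis by (rule finite_subset) auto
qed

lemma cell_vimage_eq:
  assumes "h > 0"
  shows "cell h -` {a} = {x. x $ 1 \<in> {h * fst a..<h * fst a + h} \<and> x $ 2 \<in> {h * snd a..<h * snd a + h}}"
  using assms by (auto simp: cell_def floor_eq_iff field_simps prod_eq_iff)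

lemma emeasure_cell:
  assumes "h > 0"
  shows "cell h -` {a} \<in> sets borel" "emeasure lborel (cell h -` {a}) = ennreal (h\<^sup>2)"
proof -
  show "cell h -` {a} \<in> sets borel"
    unfolding cell_vimage_eq[OF assms] by (rule emeasure_lborel_vec2_rect(1)) auto
  have "emeasure lborel (cell h -` {a})
      = emeasure lborel {h * fst a..<h * fst a + h} * emeasure lborel {h * snd a..<h * snd a + h}"
    unfolding cell_vimage_eq[OF assms] by (rule emeasure_lborel_vec2_rect(2)) auto
  also have "\<dots> = ennreal (h\<^sup>2)"
    using assms by (simp add: power2_eq_square ennreal_mult)
  finally show "emeasure lborel (cell h -` {a}) = ennreal (h\<^sup>2)" .
qed

lemma cell_eq_imp_close: "h > 0 \<Longrightarrow> cell h x = cell h y \<Longrightarrow> \<bar>y $ i - x $ i\<bar> \<le> h"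
proof -
  assume h: "h > 0" and eq: "cell h x = cell h y"
  have "\<lfloor>x $ i / h\<rfloor> = \<lfloor>y $ i / h\<rfloor>"
    using eq exhaust_2[of i] by (auto simp: cell_def)
  then have "\<bar>y $ i / h - x $ i / h\<bar> < 1" by linarith
  then show ?thesis using h by (simp add: diff_divide_distrib[symmetric] abs_divide)
qed

text \<open>On a cell, \<open>w\<close> differs from its mean by an average of the differences \<open>w x - w y\<close>.\<close>

lemma cell_mean_estimate:
  assumes w: "w \<in> C1c \<Omega>" and h: "h > 0"
    and P: "\<bar>\<integral>y. w y * indicator (cell h -` {cell h x}) y \<partial>lborel\<bar> \<le> \<epsilon>"
  shows "ennreal (h ^ 4 * (w x)\<^sup>2) \<le> ennreal (2 * h\<^sup>2) *
      (\<integral>\<^sup>+z. ennreal ((w (x + z) - w x)\<^sup>2) * indicator {z. \<bar>z $ 1\<bar> \<le> h \<and> \<bar>z $ 2\<bar> \<le> h} z \<partial>lborel) + ennreal (2 * \<epsilon>\<^sup>2)"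
proof -
  define Q where "Q = cell h -` {cell h x}"
  have Qm [measurable]: "Q \<in> sets borel" and Qe: "emeasure lborel Q = ennreal (h\<^sup>2)"
    unfolding Q_def using emeasure_cell[OF h] by auto
  have Qm': "measure lborel Q = h\<^sup>2" using Qe by (simp add: measure_def)
  note [measurable] = C1c_borel_measurable[OF w]
  obtain B where B: "\<And>y. \<bar>w y\<bar> \<le> B" using C1c_bounded[OF w] by blast
  have iQ: "integrable lborel (\<lambda>y. c * indicator Q y :: real)" for c
    using Qe by (intro integrable_mult_right integrable_real_indicator) auto
  have iw: "integrable lborel (\<lambda>y. w y * indicator Q y)"
  proof (rule Bochner_Integration.integrable_bound[OF iQ[of B]])
    show "AE y in lborel. norm (w y * indicator Q y) \<le> norm (B * indicator Q y :: real)"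
    proof (rule AE_I2)
      fix y
      show "norm (w y * indicator Q y) \<le> norm (B * indicator Q y :: real)"
        using B[of y] by (cases "y \<in> Q") auto
    qed
  qed simp
  have sqQ: "sq_integrable lborel (\<lambda>y. indicator Q y :: real)"
  proof -
    have "(\<lambda>y. (indicator Q y :: real)\<^sup>2) = (\<lambda>y. indicator Q y)" by (auto simp: indicator_def)
    then show ?thesis using iQ[of 1] by (simp add: sq_integrable_def)
  qed
  define f where "f y = (w x - w y) * indicator Q y" for y
  have [measurable]: "f \<in> borel_measurable borel" unfolding f_def by measurable
  have sqf: "sq_integrable lborel f"
    unfolding sq_integrable_def
  proof
    show "integrable lborel (\<lambda>y. (f y)\<^sup>2)"
    proof (rule Bochner_Integration.integrable_bound[OF iQ[of "(2 * B)\<^sup>2"]])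
      have "(w x - w y)\<^sup>2 \<le> (2 * B)\<^sup>2" for y
        using B[of x] B[of y] by (intro power2_le_iff_abs_le[THEN iffD2]) linarith+
      then show "AE y in lborel. norm ((f y)\<^sup>2) \<le> norm ((2 * B)\<^sup>2 * indicator Q y :: real)"
        by (auto simp: f_def indicator_def)
    qed simp
  qed simp
  have "h\<^sup>2 * w x = (\<integral>y. w x * indicator Q y \<partial>lborel)" using Qm' by simp
  also have "\<dots> = (\<integral>y. f y + w y * indicator Q y \<partial>lborel)"
    unfolding f_def by (intro arg_cong[of _ _ "lebesgue_integral lborel"] ext) (simp add: algebra_simps)
  also have "\<dots> = (\<integral>y. f y \<partial>lborel) + (\<integral>y. w y * indicator Q y \<partial>lborel)"
  proof (intro Bochner_Integration.integral_add iw)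
    have "integrable lborel (\<lambda>y. w x * indicator Q y - w y * indicator Q y)"
      by (intro Bochner_Integration.integrable_diff iQ iw)
    then show "integrable lborel f" unfolding f_def by (simp add: left_diff_distrib)
  qed
  finally have eq: "h\<^sup>2 * w x = (\<integral>y. f y \<partial>lborel) + (\<integral>y. w y * indicator Q y \<partial>lborel)" .
  \<comment> \<open>\<open>f\<close> vanishes off the cell. Inserting the indicator lets
    Cauchy-Schwarz gain the factor h, the square root of the cell's area.\<close>
  have "\<bar>\<integral>y. f y \<partial>lborel\<bar> = \<bar>\<integral>y. f y * indicator Q y \<partial>lborel\<bar>"
    unfolding f_def by (intro arg_cong[of _ _ abs] arg_cong[of _ _ "lebesgue_integral lborel"] ext) (simp add: indicator_def)
  also have "\<dots> \<le> l2norm lborel f * l2norm lborel (indicator Q)"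
    by (rule Cauchy_Schwarz_integral[OF sqf sqQ])
  also have "l2norm lborel (indicator Q) = h"
  proof -
    have "(\<lambda>y. (indicator Q y :: real)\<^sup>2) = (\<lambda>y. indicator Q y)" by (auto simp: indicator_def)
    then show ?thesis using Qm' h by (simp add: l2norm_def)
  qed
  finally have "(\<integral>y. f y \<partial>lborel)\<^sup>2 \<le> (l2norm lborel f * h)\<^sup>2"
    using h by (subst abs_le_square_iff[symmetric]) (simp add: abs_mult)
  then have f2: "(\<integral>y. f y \<partial>lborel)\<^sup>2 \<le> h\<^sup>2 * (\<integral>y. (f y)\<^sup>2 \<partial>lborel)"
    by (simp add: power_mult_distrib l2norm_sq mult.commute)
  have P2: "(\<integral>y. w y * indicator Q y \<partial>lborel)\<^sup>2 \<le> \<epsilon>\<^sup>2"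
    using P unfolding Q_def by (subst abs_le_square_iff[symmetric]) linarith
  have "h ^ 4 * (w x)\<^sup>2 = (h\<^sup>2 * w x)\<^sup>2" by (simp add: power_mult_distrib)
  also have "\<dots> \<le> 2 * (\<integral>y. f y \<partial>lborel)\<^sup>2 + 2 * (\<integral>y. w y * indicator Q y \<partial>lborel)\<^sup>2"
    unfolding eq by (smt (verit) power2_sum sum_squares_bound)
  also have "\<dots> \<le> 2 * h\<^sup>2 * (\<integral>y. (f y)\<^sup>2 \<partial>lborel) + 2 * \<epsilon>\<^sup>2"
    using f2 P2 by linarith
  finally have "ennreal (h ^ 4 * (w x)\<^sup>2) \<le> ennreal (2 * h\<^sup>2 * (\<integral>y. (f y)\<^sup>2 \<partial>lborel) + 2 * \<epsilon>\<^sup>2)"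
    by (rule ennreal_leI)
  also have "\<dots> = ennreal (2 * h\<^sup>2) * ennreal (\<integral>y. (f y)\<^sup>2 \<partial>lborel) + ennreal (2 * \<epsilon>\<^sup>2)"
    by (simp add: ennreal_mult)
  also have "ennreal (\<integral>y. (f y)\<^sup>2 \<partial>lborel) = (\<integral>\<^sup>+y. ennreal ((f y)\<^sup>2) \<partial>lborel)"
    by (intro nn_integral_eq_integral[symmetric] sq_integrable_sq sqf) simp
  also have "\<dots> = (\<integral>\<^sup>+z. ennreal ((f (z + x))\<^sup>2) \<partial>lborel)"
    by (rule nn_integral_lborel_translate[symmetric]) measurable
  \<comment> \<open>The translated cell depends on x. It is enlarged to a fixed square of shifts, so
    that the integrations over x and z can later be exchanged.\<close>
  also have "\<dots> \<le> (\<integral>\<^sup>+z. ennreal ((w (x + z) - w x)\<^sup>2) * indicator {z. \<bar>z $ 1\<bar> \<le> h \<and> \<bar>z $ 2\<bar> \<le> h} z \<partial>lborel)"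
  proof (rule nn_integral_mono)
    fix z
    show "ennreal ((f (z + x))\<^sup>2) \<le> ennreal ((w (x + z) - w x)\<^sup>2) * indicator {z. \<bar>z $ 1\<bar> \<le> h \<and> \<bar>z $ 2\<bar> \<le> h} z"
    proof (cases "z + x \<in> Q")
      case True
      then have "\<bar>z $ i\<bar> \<le> h" for i using cell_eq_imp_close[OF h, of x "z + x" i] by (simp add: Q_def)
      then show ?thesis using True by (simp add: f_def add.commute power2_commute)
    qed (simp add: f_def)
  qed
  finally show ?thesis by (simp add: add_right_mono mult_left_mono)
qed

context planar_domain
begin

lemma nn_integral_partial_deriv_sq:
  assumes w: "w \<in> C1c \<Omega>"
  shows "(\<integral>\<^sup>+x. ennreal ((partial_deriv i w x)\<^sup>2) \<partial>lborel) = ennreal ((l2norm \<mu> (partial_deriv i w))\<^sup>2)"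
proof -
  have "(\<integral>x. (partial_deriv i w x)\<^sup>2 \<partial>\<mu>) = (\<integral>x. (partial_deriv i w x)\<^sup>2 \<partial>lborel)"
    "integrable lborel (\<lambda>x. (partial_deriv i w x)\<^sup>2)"
    using lebesgue_on_zero_outside[OF open_domain, of "\<lambda>x. (partial_deriv i w x)\<^sup>2"] C1c_partial_zero_outside[OF w]
      C1c_partial_borel_measurable[OF w] sq_integrable_sq[OF C1c_partial_sq_integrable[OF w]] by auto
  then show ?thesis by (simp add: l2norm_sq nn_integral_eq_integral)
qed

text \<open>Move along one axis at a time. Splitting the square costs a factor 2, and each axis
  contributes 4 h^2 times its part of the energy.\<close>

lemma nn_integral_translation:
  assumes w: "w \<in> C1c \<Omega>" and z: "\<bar>z $ 1\<bar> \<le> h" "\<bar>z $ 2\<bar> \<le> h"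
  shows "(\<integral>\<^sup>+x. ennreal ((w (x + z) - w x)\<^sup>2) \<partial>lborel) \<le> ennreal (8 * h\<^sup>2 * energy w)"
proof -
  note [measurable] = C1c_borel_measurable[OF w]
  let ?e = "\<lambda>i::2. axis i (1::real)"
  have z_eq: "z = z $ 1 *\<^sub>R ?e 1 + z $ 2 *\<^sub>R ?e 2"
    by (simp add: vec_eq_iff forall_2 axis_def)
  let ?y = "\<lambda>x. x + z $ 1 *\<^sub>R ?e 1"
  let ?f = "\<lambda>x. ennreal ((w (x + z $ 2 *\<^sub>R ?e 2) - w x)\<^sup>2)"
  let ?g = "\<lambda>x. ennreal ((w (x + z $ 1 *\<^sub>R ?e 1) - w x)\<^sup>2)"
  have "(\<integral>\<^sup>+x. ennreal ((w (x + z) - w x)\<^sup>2) \<partial>lborel) \<le> (\<integral>\<^sup>+x. 2 * ?f (?y x) + 2 * ?g x \<partial>lborel)"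
  proof (rule nn_integral_mono)
    fix x
    have "(w (x + z) - w x)\<^sup>2 \<le> 2 * (w (?y x + z $ 2 *\<^sub>R ?e 2) - w (?y x))\<^sup>2 + 2 * (w (x + z $ 1 *\<^sub>R ?e 1) - w x)\<^sup>2"
    proof -
      have "x + z = ?y x + z $ 2 *\<^sub>R ?e 2" by (subst z_eq) (simp only: add.assoc)
      moreover have "(a - c)\<^sup>2 \<le> 2 * (a - b)\<^sup>2 + 2 * (b - c)\<^sup>2" for a b c :: real
        using sum_squares_bound[of "a - b" "b - c"] power2_sum[of "a - b" "b - c"] by simp
      ultimately show ?thesis by metis
    qed
    then have "ennreal ((w (x + z) - w x)\<^sup>2)
        \<le> ennreal (2 * (w (?y x + z $ 2 *\<^sub>R ?e 2) - w (?y x))\<^sup>2 + 2 * (w (x + z $ 1 *\<^sub>R ?e 1) - w x)\<^sup>2)"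
      by (rule ennreal_leI)
    then show "ennreal ((w (x + z) - w x)\<^sup>2) \<le> 2 * ?f (?y x) + 2 * ?g x"
      by (simp add: ennreal_mult)
  qed
  also have "\<dots> = 2 * (\<integral>\<^sup>+x. ?f (?y x) \<partial>lborel) + 2 * (\<integral>\<^sup>+x. ?g x \<partial>lborel)"
    by (subst nn_integral_add) (auto simp: nn_integral_cmult)
  also have "(\<integral>\<^sup>+x. ?f (?y x) \<partial>lborel) = (\<integral>\<^sup>+x. ?f x \<partial>lborel)"
    by (rule nn_integral_lborel_translate) measurable
  also have "2 * (\<integral>\<^sup>+x. ?f x \<partial>lborel) + 2 * (\<integral>\<^sup>+x. ?g x \<partial>lborel)
      \<le> 2 * (ennreal (4 * h\<^sup>2) * ennreal ((l2norm \<mu> (partial_deriv 2 w))\<^sup>2))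
        + 2 * (ennreal (4 * h\<^sup>2) * ennreal ((l2norm \<mu> (partial_deriv 1 w))\<^sup>2))"
    using nn_integral_axis_translation[OF w z(2), of 2] nn_integral_axis_translation[OF w z(1), of 1]
    unfolding nn_integral_partial_deriv_sq[OF w] by (intro add_mono mult_left_mono) auto
  also have "\<dots> = ennreal (2 * (4 * h\<^sup>2 * (l2norm \<mu> (partial_deriv 2 w))\<^sup>2) + 2 * (4 * h\<^sup>2 * (l2norm \<mu> (partial_deriv 1 w))\<^sup>2))"
    by (simp add: ennreal_mult mult.assoc[symmetric])
  also have "2 * (4 * h\<^sup>2 * (l2norm \<mu> (partial_deriv 2 w))\<^sup>2) + 2 * (4 * h\<^sup>2 * (l2norm \<mu> (partial_deriv 1 w))\<^sup>2) = 8 * h\<^sup>2 * energy w"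
    by (simp add: energy_def sum_2 algebra_simps)
  finally show ?thesis .
qed

text \<open>The cell estimate is integrated over x. The constant is 64 h^6 = 2 h^2 * 8 h^2 * 4 h^2,
  from the cell estimate, the translation bound and the area of the square of shifts. After division
  by h^4 the energy carries the small factor h^2, and apart from it only the cell integrals
  matter.\<close>

lemma l2norm_grid_estimate:
  assumes w: "w \<in> C1c \<Omega>" and h: "h > 0"
    and P: "\<And>x. x \<in> \<Omega> \<Longrightarrow> \<bar>\<integral>y. w y * indicator (cell h -` {cell h x}) y \<partial>lborel\<bar> \<le> \<epsilon>"
  shows "h ^ 4 * (l2norm \<mu> w)\<^sup>2 \<le> 64 * h ^ 6 * energy w + 2 * \<epsilon>\<^sup>2 * area"
proof -
  note [measurable] = C1c_borel_measurable[OF w]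
  have [measurable]: "(\<lambda>x::real^2. x $ i) \<in> borel_measurable borel" for i
    by (intro borel_measurable_continuous_onI continuous_intros)
  have [measurable]: "\<Omega> \<in> sets borel" using open_domain by simp
  define Z where "Z = {z::real^2. \<bar>z $ 1\<bar> \<le> h \<and> \<bar>z $ 2\<bar> \<le> h}"
  have Z_eq: "Z = {z::real^2. z $ 1 \<in> {-h..h} \<and> z $ 2 \<in> {-h..h}}" by (auto simp: Z_def)
  have [measurable]: "Z \<in> sets borel" unfolding Z_eq by (intro emeasure_lborel_vec2_rect) auto
  have Ze: "emeasure lborel Z = ennreal (4 * h\<^sup>2)"
    unfolding Z_eq using h by (subst emeasure_lborel_vec2_rect) (auto simp: ennreal_mult[symmetric] power2_eq_square)
  define K where "K x = (\<integral>\<^sup>+z. ennreal ((w (x + z) - w x)\<^sup>2) * indicator Z z \<partial>lborel)" for x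
  have [measurable]: "K \<in> borel_measurable borel" unfolding K_def by measurable
  have area: "emeasure lborel \<Omega> = ennreal area"
  proof -
    have "emeasure lborel \<Omega> < \<infinity>" by (rule emeasure_bounded_finite[OF bounded_domain])
    moreover have "area = measure lborel \<Omega>"
      using open_domain by (simp add: measure_restrict_space measure_completion)
    ultimately show ?thesis by (simp add: emeasure_eq_ennreal_measure less_top[symmetric])
  qed
  have w2: "(l2norm \<mu> w)\<^sup>2 = (\<integral>x. (w x)\<^sup>2 \<partial>lborel)" "integrable lborel (\<lambda>x. (w x)\<^sup>2)"
    using lebesgue_on_zero_outside[OF open_domain, of "\<lambda>x. (w x)\<^sup>2"] C1c_zero_outside[OF w]
      sq_integrable_sq[OF C1c_sq_integrable[OF w]] by (auto simp: l2norm_sq)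
  have "ennreal (h ^ 4 * (l2norm \<mu> w)\<^sup>2) = (\<integral>\<^sup>+x. ennreal (h ^ 4 * (w x)\<^sup>2) \<partial>lborel)"
    using w2 by (subst nn_integral_eq_integral) auto
  also have "\<dots> \<le> (\<integral>\<^sup>+x. ennreal (2 * h\<^sup>2) * K x + ennreal (2 * \<epsilon>\<^sup>2) * indicator \<Omega> x \<partial>lborel)"
  proof (rule nn_integral_mono)
    fix x
    show "ennreal (h ^ 4 * (w x)\<^sup>2) \<le> ennreal (2 * h\<^sup>2) * K x + ennreal (2 * \<epsilon>\<^sup>2) * indicator \<Omega> x"
    proof (cases "x \<in> \<Omega>")
      case True
      then show ?thesis using cell_mean_estimate[OF w h P[OF True]] by (simp add: K_def Z_def)
    next
      case False
      then show ?thesis using C1c_zero_outside[OF w False] by simp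
    qed
  qed
  also have "\<dots> = ennreal (2 * h\<^sup>2) * (\<integral>\<^sup>+x. K x \<partial>lborel) + ennreal (2 * \<epsilon>\<^sup>2) * ennreal area"
    by (subst nn_integral_add) (auto simp: nn_integral_cmult area)
  also have "(\<integral>\<^sup>+x. K x \<partial>lborel) = (\<integral>\<^sup>+z. \<integral>\<^sup>+x. ennreal ((w (x + z) - w x)\<^sup>2) * indicator Z z \<partial>lborel \<partial>lborel)"
    unfolding K_def by (rule lborel_pair.Fubini'[symmetric]) measurable
  also have "\<dots> \<le> (\<integral>\<^sup>+z. ennreal (8 * h\<^sup>2 * energy w) * indicator Z z \<partial>lborel)"
  proof (rule nn_integral_mono)
    fix z
    have "(\<integral>\<^sup>+x. ennreal ((w (x + z) - w x)\<^sup>2) * indicator Z z \<partial>lborel)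
        = (\<integral>\<^sup>+x. ennreal ((w (x + z) - w x)\<^sup>2) \<partial>lborel) * indicator Z z"
      by (rule nn_integral_multc) measurable
    then show "(\<integral>\<^sup>+x. ennreal ((w (x + z) - w x)\<^sup>2) * indicator Z z \<partial>lborel) \<le> ennreal (8 * h\<^sup>2 * energy w) * indicator Z z"
      using nn_integral_translation[OF w, of z h] by (auto simp: indicator_def Z_def)
  qed
  also have "\<dots> = ennreal (8 * h\<^sup>2 * energy w) * ennreal (4 * h\<^sup>2)"
    by (simp add: nn_integral_cmult Ze)
  also have "ennreal (2 * h\<^sup>2) * (ennreal (8 * h\<^sup>2 * energy w) * ennreal (4 * h\<^sup>2)) + ennreal (2 * \<epsilon>\<^sup>2) * ennreal area
      = ennreal (64 * h ^ 6 * energy w + 2 * \<epsilon>\<^sup>2 * area)"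
  proof -
    have "ennreal a * (ennreal b * ennreal c) + ennreal d * ennreal e = ennreal (a * (b * c) + d * e)"
      if "a \<ge> 0" "b \<ge> 0" "c \<ge> 0" "d \<ge> 0" "e \<ge> 0" for a b c d e
      using that by (simp add: ennreal_mult)
    then have "ennreal (2 * h\<^sup>2) * (ennreal (8 * h\<^sup>2 * energy w) * ennreal (4 * h\<^sup>2)) + ennreal (2 * \<epsilon>\<^sup>2) * ennreal area
        = ennreal (2 * h\<^sup>2 * (8 * h\<^sup>2 * energy w * (4 * h\<^sup>2)) + 2 * \<epsilon>\<^sup>2 * area)"
      using energy_nonneg[of w] by simp
    also have "2 * h\<^sup>2 * (8 * h\<^sup>2 * energy w * (4 * h\<^sup>2)) = 64 * h ^ 6 * energy w"
      by (simp add: numeral_eq_Suc mult_ac)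
    finally show ?thesis .
  qed
  finally have "ennreal (h ^ 4 * (l2norm \<mu> w)\<^sup>2) \<le> ennreal (64 * h ^ 6 * energy w + 2 * \<epsilon>\<^sup>2 * area)"
    by (auto intro: order_trans simp: add_right_mono mult_left_mono)
  then show ?thesis
    using energy_nonneg[of w] by (subst (asm) ennreal_le_iff) auto
qed

end

section \<open>Energy identities, Rellich's theorem and strong approximation\<close>

context planar_domain
begin

lemma energy_cmult: "w \<in> C1c \<Omega> \<Longrightarrow> energy (\<lambda>x. c * w x) = c\<^sup>2 * energy w"
  by (simp add: energy_def C1c_partial_cmult l2norm_cmult power_mult_distrib sum_distrib_left)

lemma energy_parallelogram:
  assumes u: "u \<in> C1c \<Omega>" and v: "v \<in> C1c \<Omega>"
  shows "energy (\<lambda>x. u x + v x) + energy (\<lambda>x. u x - v x) = 2 * energy u + 2 * energy v"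
proof -
  have "(l2norm \<mu> (partial_deriv i (\<lambda>x. u x + v x)))\<^sup>2 + (l2norm \<mu> (partial_deriv i (\<lambda>x. u x - v x)))\<^sup>2
      = 2 * (l2norm \<mu> (partial_deriv i u))\<^sup>2 + 2 * (l2norm \<mu> (partial_deriv i v))\<^sup>2" for i
  proof -
    let ?a = "partial_deriv i u" and ?b = "partial_deriv i v"
    note s = C1c_partial_sq_integrable[OF u, of i] C1c_partial_sq_integrable[OF v, of i]
    have "(\<integral>x. (?a x + ?b x)\<^sup>2 \<partial>\<mu>) + (\<integral>x. (?a x - ?b x)\<^sup>2 \<partial>\<mu>) = (\<integral>x. (?a x + ?b x)\<^sup>2 + (?a x - ?b x)\<^sup>2 \<partial>\<mu>)"
      by (intro Bochner_Integration.integral_add[symmetric] sq_integrable_sq sq_integrable_add sq_integrable_diff s)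
    also have "\<dots> = (\<integral>x. 2 * (?a x)\<^sup>2 + 2 * (?b x)\<^sup>2 \<partial>\<mu>)"
      by (intro arg_cong[of _ _ "lebesgue_integral \<mu>"] ext) (simp add: power2_sum power2_diff)
    also have "\<dots> = 2 * (\<integral>x. (?a x)\<^sup>2 \<partial>\<mu>) + 2 * (\<integral>x. (?b x)\<^sup>2 \<partial>\<mu>)"
      using sq_integrable_sq[OF s(1)] sq_integrable_sq[OF s(2)] by simp
    finally show ?thesis
      unfolding C1c_partial_add[OF u v] C1c_partial_diff[OF u v] l2norm_sq .
  qed
  then show ?thesis unfolding energy_def by (simp add: sum.distrib[symmetric] sum_distrib_left)
qed

lemma energy_diff_le:
  assumes "u \<in> C1c \<Omega>" "v \<in> C1c \<Omega>"
  shows "energy (\<lambda>x. u x - v x) \<le> 2 * energy u + 2 * energy v"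
  using energy_parallelogram[OF assms] energy_nonneg[of "\<lambda>x. u x + v x"] by simp

text \<open>There are countably many cells of meshes 1/(k+1), so along one subsequence the integrals
  over all of them converge. For a fixed mesh only finitely many cells meet the bounded domain; the
  convergence is therefore uniform over them, and the grid estimate makes the subsequence Cauchy in
  L2.\<close>

lemma Rellich:
  assumes u: "\<And>n. u n \<in> C1c \<Omega>" and bound: "\<And>n. energy (u n) \<le> M"
  shows "\<exists>r v. strict_mono (r::nat\<Rightarrow>nat) \<and> sq_integrable \<mu> v \<and> (\<lambda>n. l2norm \<mu> (\<lambda>x. u (r n) x - v x)) \<longlonglongrightarrow> 0"
proof -
  have M0: "M \<ge> 0" using bound[of 0] energy_nonneg[of "u 0"] by simp
  define P where "P n q = (\<integral>y. u n y * indicator (cell (1 / real (Suc (fst q))) -` {snd q}) y \<partial>lborel)"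
    for n and q :: "nat \<times> int \<times> int"
  note bm = C1c_borel_measurable[OF u]
  have int: "integrable lborel (u n)" for n
    using lebesgue_on_zero_outside(2)[OF open_domain bm C1c_zero_outside[OF u]] l1_le_l2norm(1)[OF C1c_sq_integrable[OF u]] by blast
  have int_cell: "integrable lborel (\<lambda>y. u n y * indicator (cell h -` {a}) y)" if "h > 0" for n h a
    using integrable_mult_indicator[OF _ int[of n], of "cell h -` {a}"] emeasure_cell(1)[OF that] by (simp add: mult.commute)
  have "\<exists>B. \<forall>n. \<bar>P n q\<bar> \<le> B" for q
  proof (intro exI allI)
    fix n
    have "\<bar>P n q\<bar> \<le> (\<integral>y. \<bar>u n y\<bar> \<partial>lborel)"
      unfolding P_def
      by (rule order_trans[OF integral_abs_bound integral_mono])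
        (use int[of n] int_cell in \<open>auto simp: indicator_def\<close>)
    also have "\<dots> = (\<integral>y. \<bar>u n y\<bar> \<partial>\<mu>)"
      using bm C1c_zero_outside[OF u] by (intro lebesgue_on_zero_outside(1)[OF open_domain, symmetric]) auto
    also have "\<dots> \<le> sqrt area * l2norm \<mu> (u n)" by (rule l1_le_l2norm(2)[OF C1c_sq_integrable[OF u]])
    also have "l2norm \<mu> (u n) \<le> sqrt (area * M)"
    proof (rule real_le_rsqrt)
      have "area * energy (u n) \<le> area * M" by (intro mult_left_mono bound) simp
      then show "(l2norm \<mu> (u n))\<^sup>2 \<le> area * M" using Poincare[OF u[of n]] by linarith
    qed
    finally show "\<bar>P n q\<bar> \<le> sqrt area * sqrt (area * M)" by (simp add: mult_left_mono)
  qed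
  then obtain r where r: "strict_mono (r::nat\<Rightarrow>nat)" "\<And>q. convergent (\<lambda>n. P (r n) q)"
    using bounded_family_convergent_subseq[of P] by blast
  have "\<exists>v. sq_integrable \<mu> v \<and> (\<lambda>n. l2norm \<mu> (\<lambda>x. u (r n) x - v x)) \<longlonglongrightarrow> 0"
  proof (rule sq_integrable_complete)
    show "sq_integrable \<mu> (u (r n))" for n by (rule C1c_sq_integrable[OF u])
    fix e :: real assume e: "e > 0"
    \<comment> \<open>A difference of two members has energy at most 4 M, and 64 * 4 M = 256 M; the
      summand 1 makes room for the cell integrals.\<close>
    obtain k where k: "256 * M + 1 < real (Suc k) * e\<^sup>2"
    proof -
      obtain k where "real k > (256 * M + 1) / e\<^sup>2" using reals_Archimedean2 by blast
      then have "real (Suc k) * e\<^sup>2 > 256 * M + 1" using e by (simp add: field_simps add_strict_increasing2)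
      with that show ?thesis by blast
    qed
    define h where "h = 1 / real (Suc k)"
    have h: "h > 0" "h \<le> 1" by (auto simp: h_def)
    have hk: "h * (256 * M + 1) < e\<^sup>2" using k by (simp add: h_def field_simps)
    \<comment> \<open>Chosen so that the cell term of the grid estimate is at most h^5, that is h
      after division by h^4; the added 1 keeps the denominator positive.\<close>
    define \<epsilon> where "\<epsilon> = sqrt (h ^ 5 / (2 * area + 1))"
    have \<epsilon>: "\<epsilon> > 0" unfolding \<epsilon>_def using h by (intro real_sqrt_gt_zero divide_pos_pos) (auto intro: add_nonneg_pos)
    have \<epsilon>2: "2 * \<epsilon>\<^sup>2 * area \<le> h ^ 5"
    proof -
      have "\<epsilon>\<^sup>2 = h ^ 5 / (2 * area + 1)" unfolding \<epsilon>_def using h by (intro real_sqrt_pow2 divide_nonneg_nonneg) auto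
      moreover have "h ^ 5 / (2 * area + 1) * (2 * area) \<le> h ^ 5 / (2 * area + 1) * (2 * area + 1)"
        using h by (intro mult_left_mono divide_nonneg_nonneg) auto
      moreover have "2 * area + 1 > 0" by (intro add_nonneg_pos) auto
      ultimately show ?thesis by (simp add: mult_ac)
    qed
    have "finite (cell h ` \<Omega>)" by (rule finite_cell_image[OF bounded_domain h(1)])
    moreover have "\<exists>N. \<forall>m\<ge>N. \<forall>n\<ge>N. \<bar>P (r m) (k, a) - P (r n) (k, a)\<bar> \<le> \<epsilon>" for a
    proof -
      have "Cauchy (\<lambda>n. P (r n) (k, a))" using r(2) by (rule convergent_Cauchy)
      from CauchyD[OF this \<epsilon>] show ?thesis by (auto intro: less_imp_le)
    qed
    then obtain N where N: "\<And>a m n. m \<ge> N a \<Longrightarrow> n \<ge> N a \<Longrightarrow> \<bar>P (r m) (k, a) - P (r n) (k, a)\<bar> \<le> \<epsilon>" by metis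
    ultimately have "finite (N ` cell h ` \<Omega>)" by simp
    then obtain N0 where N0: "\<forall>n\<in>N ` cell h ` \<Omega>. n \<le> N0"
      unfolding finite_nat_set_iff_bounded_le by blast
    have "l2norm \<mu> (\<lambda>x. u (r m) x - u (r n) x) < e" if mn: "m \<ge> N0" "n \<ge> N0" for m n
    proof -
      let ?w = "\<lambda>x. u (r m) x - u (r n) x"
      have w: "?w \<in> C1c \<Omega>" by (rule C1c_diff[OF u u])
      have "h ^ 4 * (l2norm \<mu> ?w)\<^sup>2 \<le> 64 * h ^ 6 * energy ?w + 2 * \<epsilon>\<^sup>2 * area"
      proof (rule l2norm_grid_estimate[OF w h(1)])
        fix x assume "x \<in> \<Omega>"
        then have "N (cell h x) \<le> N0" using N0 by blast
        then have "\<bar>P (r m) (k, cell h x) - P (r n) (k, cell h x)\<bar> \<le> \<epsilon>" using mn by (intro N) auto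
        also have "P (r m) (k, cell h x) - P (r n) (k, cell h x) = (\<integral>y. ?w y * indicator (cell h -` {cell h x}) y \<partial>lborel)"
          unfolding P_def fst_conv snd_conv h_def[symmetric] left_diff_distrib
          by (rule Bochner_Integration.integral_diff[symmetric, OF int_cell[OF h(1)] int_cell[OF h(1)]])
        finally show "\<bar>\<integral>y. ?w y * indicator (cell h -` {cell h x}) y \<partial>lborel\<bar> \<le> \<epsilon>" .
      qed
      also have "\<dots> \<le> 64 * h ^ 6 * (4 * M) + h ^ 5"
        using energy_diff_le[OF u u, of "r m" "r n"] bound[of "r m"] bound[of "r n"] h \<epsilon>2
        by (intro add_mono mult_left_mono) auto
      also have "\<dots> \<le> h ^ 4 * (h * (256 * M + 1))"
      proof -
        have "h ^ 6 * M \<le> h ^ 5 * M" using h M0 by (intro mult_right_mono power_decreasing) auto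
        then show ?thesis by (simp add: algebra_simps numeral_eq_Suc)
      qed
      also have "\<dots> < h ^ 4 * e\<^sup>2" using hk h by simp
      finally have "(l2norm \<mu> ?w)\<^sup>2 < e\<^sup>2" using h by simp
      then show ?thesis by (rule power2_less_imp_less) (use e in simp)
    qed
    then show "\<exists>N. \<forall>m\<ge>N. \<forall>n\<ge>N. l2norm \<mu> (\<lambda>x. u (r m) x - u (r n) x) < e" by blast
  qed
  with r(1) show ?thesis by blast
qed

text \<open>Dyadic convex combinations. The parallelogram law compares two functions only with their
  midpoint, so closure under midpoints can replace the convex hull.\<close>

inductive_set midpoint_hull :: "('i \<Rightarrow> 'a \<Rightarrow> real) \<Rightarrow> 'i set \<Rightarrow> ('a \<Rightarrow> real) set" for u I where
  base: "i \<in> I \<Longrightarrow> u i \<in> midpoint_hull u I"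
| mid: "f \<in> midpoint_hull u I \<Longrightarrow> g \<in> midpoint_hull u I \<Longrightarrow> (\<lambda>x. 1/2 * f x + 1/2 * g x) \<in> midpoint_hull u I"

lemma midpoint_hull_mono:
  assumes "I \<subseteq> J" "f \<in> midpoint_hull u I" shows "f \<in> midpoint_hull u J"
  using assms(2)
proof induction
  case (base i) then show ?case using assms(1) by (intro midpoint_hull.base) auto
next
  case (mid f g) show ?case by (rule midpoint_hull.mid[OF mid.IH])
qed

lemma midpoint_hull_test_functions:
  assumes "\<And>i. u i \<in> test_functions \<Omega>" "f \<in> midpoint_hull u I"
  shows "f \<in> test_functions \<Omega>"
  using assms(2)
proof induction
  case (mid f g)
  show ?case by (rule test_functions_add[OF test_functions_cmult[OF mid.IH(1)] test_functions_cmult[OF mid.IH(2)]])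
qed (rule assms(1))

text \<open>Balls are convex, so the hull of a tail of the sequence stays as close to the limit as
  the tail itself.\<close>

lemma midpoint_hull_l2norm_le:
  assumes "\<And>i. u i \<in> test_functions \<Omega>" "sq_integrable \<mu> v"
    and "\<And>i. i \<in> I \<Longrightarrow> l2norm \<mu> (\<lambda>x. u i x - v x) \<le> d" and "f \<in> midpoint_hull u I"
  shows "l2norm \<mu> (\<lambda>x. f x - v x) \<le> d"
  using assms(4)
proof induction
  case (mid f g)
  have s: "sq_integrable \<mu> f" "sq_integrable \<mu> g"
    using mid.hyps midpoint_hull_test_functions[of u] assms(1) C1c_sq_integrable[OF test_functionsD] by blast+
  have "(\<lambda>x. (1/2 * f x + 1/2 * g x) - v x) = (\<lambda>x. 1/2 * (f x - v x) + 1/2 * (g x - v x))"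
    by (auto simp: field_simps)
  then have "l2norm \<mu> (\<lambda>x. (1/2 * f x + 1/2 * g x) - v x)
      \<le> l2norm \<mu> (\<lambda>x. 1/2 * (f x - v x)) + l2norm \<mu> (\<lambda>x. 1/2 * (g x - v x))"
    using l2norm_triangle[OF sq_integrable_cmult[OF sq_integrable_diff[OF s(1) assms(2)], of "1/2"]
        sq_integrable_cmult[OF sq_integrable_diff[OF s(2) assms(2)], of "1/2"]] by metis
  also have "\<dots> \<le> d" using mid.IH unfolding l2norm_cmult by simp
  finally show ?case .
qed (rule assms(3))

text \<open>
  Near-minimizers of the energy over the midpoint hulls of the tails form a Cauchy sequence by the
  parallelogram law.
\<close>

lemma strong_approximation:
  assumes u: "\<And>n. u n \<in> test_functions \<Omega>" and bound: "\<And>n. energy (u n) \<le> M"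
    and v: "sq_integrable \<mu> v" and lim: "(\<lambda>n. l2norm \<mu> (\<lambda>x. u n x - v x)) \<longlonglongrightarrow> 0"
  shows "\<exists>y. (\<forall>n. y n \<in> test_functions \<Omega>) \<and> (\<forall>n. energy (y n) \<le> M + 1) \<and> v \<in> H10 \<Omega> \<and>
    (\<lambda>n. l2norm \<mu> (\<lambda>x. y n x - v x)) \<longlonglongrightarrow> 0 \<and>
    (\<forall>i. (\<lambda>n. l2norm \<mu> (\<lambda>x. partial_deriv i (y n) x - weak_deriv \<Omega> i v x)) \<longlonglongrightarrow> 0)"
proof -
  define K where "K n = midpoint_hull u {n::nat..}" for n
  have Kne: "u n \<in> K n" for n unfolding K_def by (rule midpoint_hull.base) simp
  have Kmono: "K m \<subseteq> K n" if "n \<le> m" for m n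
    using midpoint_hull_mono[of "{m..}" "{n..}" _ u] that unfolding K_def by auto
  have Kt: "f \<in> test_functions \<Omega>" if "f \<in> K n" for f n
    by (rule midpoint_hull_test_functions[of u, OF u that[unfolded K_def]])
  define d where "d n = Inf (energy ` K n)" for n
  have bdd: "bdd_below (energy ` K n)" for n by (rule bdd_belowI[of _ 0]) (auto simp: energy_nonneg)
  have d_le: "d n \<le> energy f" if "f \<in> K n" for f n
    unfolding d_def using that by (intro cInf_lower bdd) auto
  have d_mono: "d n \<le> d m" if "n \<le> m" for m n
    unfolding d_def using Kmono[OF that] Kne by (intro cInf_superset_mono bdd) auto
  have dM: "d n \<le> M" for n using d_le[OF Kne] bound order_trans by blast
  have "\<exists>f. f \<in> K n \<and> energy f < d n + 1 / real (Suc n)" for n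
  proof -
    have "energy ` K n \<noteq> {}" using Kne by blast
    then show ?thesis
      using cInf_lessD[of "energy ` K n" "d n + 1 / real (Suc n)"] unfolding d_def by auto
  qed
  then obtain y where y: "\<And>n. y n \<in> K n" "\<And>n. energy (y n) < d n + 1 / real (Suc n)" by metis
  have yt: "y n \<in> test_functions \<Omega>" for n using Kt y by blast
  note yc = test_functionsD[OF yt]
  \<comment> \<open>The hulls of the tails shrink, so their infima increase; being bounded by M they
    form a Cauchy sequence.\<close>
  have "incseq d" using d_mono by (auto simp: incseq_def)
  then obtain L where "d \<longlonglongrightarrow> L" using incseq_convergent[of d M] dM by blast
  then have "convergent d" by (auto simp: convergent_def)
  then have Cd: "Cauchy d" by (rule convergent_Cauchy)
  \<comment> \<open>The midpoint of \<open>y m\<close> and \<open>y n\<close> lies in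
    \<open>K n\<close> and has energy at least \<open>d n\<close>. In the parallelogram law only the
    increase of the infima and the defects of the two near-minimizers are left for the
    difference.\<close>
  have diff: "energy (\<lambda>x. y m x - y n x) \<le> 2 * (d m - d n) + 4 / real (Suc n)" if "n \<le> m" for m n
  proof -
    have "y m \<in> K n" "y n \<in> K n" using y(1) Kmono[OF that] by blast+
    then have "(\<lambda>x. 1/2 * y m x + 1/2 * y n x) \<in> K n" unfolding K_def by (rule midpoint_hull.mid)
    then have "d n \<le> energy (\<lambda>x. 1/2 * y m x + 1/2 * y n x)" by (rule d_le)
    also have "(\<lambda>x. 1/2 * y m x + 1/2 * y n x) = (\<lambda>x. 1/2 * (y m x + y n x))" by (auto simp: field_simps)
    also have "energy \<dots> = (1/2)\<^sup>2 * energy (\<lambda>x. y m x + y n x)" by (rule energy_cmult[OF C1c_add[OF yc yc]])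
    finally have "4 * d n \<le> energy (\<lambda>x. y m x + y n x)" by (simp add: power2_eq_square)
    moreover have "1 / real (Suc m) \<le> 1 / real (Suc n)" using that by (simp add: frac_le)
    moreover have "e' \<le> 2 * (a - b) + 4 * q" if "4 * b \<le> s" "p \<le> q" "s + e' = 2 * c + 2 * d" "c < a + p" "d < b + q"
      for a b c d e' p q s :: real using that by (simp add: algebra_simps)
    ultimately have "energy (\<lambda>x. y m x - y n x) \<le> 2 * (d m - d n) + 4 * (1 / real (Suc n))"
      using energy_parallelogram[OF yc yc, of m n] y(2)[of m] y(2)[of n] by blast
    then show ?thesis by simp
  qed
  have CauchyE: "\<exists>N. \<forall>m\<ge>N. \<forall>n\<ge>N. energy (\<lambda>x. y m x - y n x) < e" if "e > 0" for e
  proof -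
    obtain N1 where N1: "\<And>m n. m \<ge> N1 \<Longrightarrow> n \<ge> N1 \<Longrightarrow> \<bar>d m - d n\<bar> < e / 4"
      using CauchyD[OF Cd, of "e / 4"] \<open>e > 0\<close> unfolding real_norm_def by (metis divide_pos_pos zero_less_numeral)
    obtain N2 where N2: "real N2 > 8 / e" using reals_Archimedean2 by blast
    have small: "energy (\<lambda>x. y m x - y n x) < e" if "n \<ge> max N1 N2" "n \<le> m" for m n
    proof -
      have "8 / e < real (Suc n)" using N2 that(1) by simp
      then have "4 / real (Suc n) < e / 2" using \<open>e > 0\<close> by (simp add: field_simps)
      moreover have "\<bar>d m - d n\<bar> < e / 4" using that by (intro N1) auto
      then have "d m - d n < e / 4" by (rule le_less_trans[OF abs_ge_self])
      then have "2 * (d m - d n) < e / 2" by (simp add: field_simps)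
      ultimately have "2 * (d m - d n) + 4 / real (Suc n) < e / 2 + e / 2" by (rule add_strict_mono[rotated])
      with diff[OF that(2)] show ?thesis by simp
    qed
    have "energy (\<lambda>x. y m x - y n x) < e" if "m \<ge> max N1 N2" "n \<ge> max N1 N2" for m n
    proof (cases "n \<le> m")
      case True then show ?thesis using small that by blast
    next
      case False
      have "(\<lambda>x. y m x - y n x) = (\<lambda>x. -1 * (y n x - y m x))" by auto
      then have "energy (\<lambda>x. y m x - y n x) = energy (\<lambda>x. y n x - y m x)"
        using energy_cmult[OF C1c_diff[OF yc yc], of "-1" n m] by simp
      then show ?thesis using small[of m n] that False by simp
    qed
    then show ?thesis by blast
  qed
  have "\<exists>g. sq_integrable \<mu> g \<and> (\<lambda>n. l2norm \<mu> (\<lambda>x. partial_deriv i (y n) x - g x)) \<longlonglongrightarrow> 0" for i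
  proof (rule sq_integrable_complete)
    show "sq_integrable \<mu> (partial_deriv i (y n))" for n by (rule C1c_partial_sq_integrable[OF yc])
    fix e :: real assume e: "e > 0"
    obtain N where N: "\<And>m n. m \<ge> N \<Longrightarrow> n \<ge> N \<Longrightarrow> energy (\<lambda>x. y m x - y n x) < e\<^sup>2"
      using CauchyE[of "e\<^sup>2"] e by auto
    have "l2norm \<mu> (\<lambda>x. partial_deriv i (y m) x - partial_deriv i (y n) x) < e" if "m \<ge> N" "n \<ge> N" for m n
    proof (rule power2_less_imp_less)
      show "(l2norm \<mu> (\<lambda>x. partial_deriv i (y m) x - partial_deriv i (y n) x))\<^sup>2 < e\<^sup>2"
        using l2norm_partial_sq_le_energy[of i "\<lambda>x. y m x - y n x"] N[OF that]
        unfolding C1c_partial_diff[OF yc yc] by linarith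
    qed (use e in simp)
    then show "\<exists>N. \<forall>m\<ge>N. \<forall>n\<ge>N. l2norm \<mu> (\<lambda>x. partial_deriv i (y m) x - partial_deriv i (y n) x) < e" by blast
  qed
  then have "\<exists>g. \<forall>i. sq_integrable \<mu> (g i) \<and> (\<lambda>n. l2norm \<mu> (\<lambda>x. partial_deriv i (y n) x - g i x)) \<longlonglongrightarrow> 0"
    by (intro choice allI)
  then obtain g where g: "\<And>i. sq_integrable \<mu> (g i)"
    "\<And>i. (\<lambda>n. l2norm \<mu> (\<lambda>x. partial_deriv i (y n) x - g i x)) \<longlonglongrightarrow> 0" by blast
  have ylim: "(\<lambda>n. l2norm \<mu> (\<lambda>x. y n x - v x)) \<longlonglongrightarrow> 0"
  proof (rule LIMSEQ_I)
    fix e :: real assume e: "e > 0"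
    obtain N where N: "\<And>n. n \<ge> N \<Longrightarrow> l2norm \<mu> (\<lambda>x. u n x - v x) < e / 2"
      using LIMSEQ_D[OF lim, of "e / 2"] e by fastforce
    have "norm (l2norm \<mu> (\<lambda>x. y n x - v x) - 0) < e" if "n \<ge> N" for n
    proof -
      have "l2norm \<mu> (\<lambda>x. y n x - v x) \<le> e / 2"
      proof (rule midpoint_hull_l2norm_le[where u=u and I="{n..}"])
        show "u i \<in> test_functions \<Omega>" for i by (rule u)
        show "l2norm \<mu> (\<lambda>x. u i x - v x) \<le> e / 2" if "i \<in> {n..}" for i
          using N[of i] that \<open>n \<ge> N\<close> by simp
        show "y n \<in> midpoint_hull u {n..}" using y(1)[of n] by (simp only: K_def)
      qed (rule v)
      then show ?thesis using e by simp
    qed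
    then show "\<exists>no. \<forall>n\<ge>no. norm (l2norm \<mu> (\<lambda>x. y n x - v x) - 0) < e" by blast
  qed
  \<comment> \<open>Here the limits of the gradients are identified with the weak derivatives of
    \<open>v\<close>, which also puts \<open>v\<close> into \<open>H10\<close>.\<close>
  note H = H10I[OF yt v g(1) ylim g(2)]
  have "(\<lambda>n. l2norm \<mu> (\<lambda>x. partial_deriv i (y n) x - weak_deriv \<Omega> i v x)) \<longlonglongrightarrow> 0" for i
  proof -
    have "l2norm \<mu> (\<lambda>x. partial_deriv i (y n) x - weak_deriv \<Omega> i v x) = l2norm \<mu> (\<lambda>x. partial_deriv i (y n) x - g i x)" for n
    proof (rule l2norm_cong_AE)
      show "AE x in \<mu>. partial_deriv i (y n) x - weak_deriv \<Omega> i v x = partial_deriv i (y n) x - g i x"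
        using H(2)[of i] by eventually_elim simp
    qed (intro sq_integrable_measurable sq_integrable_diff C1c_partial_sq_integrable yc H1_weak_deriv H10_H1 H g)+
    with g(2)[of i] show ?thesis by simp
  qed
  moreover have "energy (y n) \<le> M + 1" for n
    using y(2)[of n] dM[of n] by (rule order_trans[OF less_imp_le add_mono]) simp
  ultimately show ?thesis using yt H(1) ylim by blast
qed

end

section \<open>Separability\<close>

text \<open>Grid functions with rational values, coded by a mesh index and a finite list. The codes
  form a countable type and can be enumerated by \<open>from_nat\<close>.\<close>

definition step_fun :: "nat \<Rightarrow> ((int \<times> int) \<times> rat) list \<Rightarrow> real^2 \<Rightarrow> real" where
  "step_fun k l x = (case map_of l (cell (1 / real (Suc k)) x) of None \<Rightarrow> 0 | Some q \<Rightarrow> of_rat q)"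

text \<open>By uniform continuity all sufficiently fine meshes work, so that a common mesh can be
  taken for a function and both of its partial derivatives.\<close>

lemma step_fun_approximation:
  assumes g: "continuous_on UNIV g" and S: "bounded S" and e: "e > 0"
  shows "\<exists>K. \<forall>k\<ge>K. \<exists>l. \<forall>x\<in>S. \<bar>g x - step_fun k l x\<bar> \<le> e"
proof -
  have "compact (closure S)" using S by (simp add: compact_closure)
  then have "uniformly_continuous_on (closure S) g"
    by (intro compact_uniformly_continuous continuous_on_subset[OF g]) auto
  then obtain d where d: "d > 0" "\<And>x y. x \<in> closure S \<Longrightarrow> y \<in> closure S \<Longrightarrow> dist y x < d \<Longrightarrow> dist (g y) (g x) < e / 2"
    unfolding uniformly_continuous_on_def using e by (metis half_gt_zero)
  \<comment> \<open>Points of one cell of side h are at distance at most 2 h, by summing the two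
    coordinate differences.\<close>
  obtain K where K: "real K > 2 / d" using reals_Archimedean2 by blast
  have "\<exists>l. \<forall>x\<in>S. \<bar>g x - step_fun k l x\<bar> \<le> e" if k: "k \<ge> K" for k
  proof -
    define h where "h = 1 / real (Suc k)"
    have h: "h > 0" by (simp add: h_def)
    have "2 / d < real (Suc k)" using K k by simp
    then have hd: "2 * h < d" using d(1) by (simp add: h_def field_simps)
    obtain xs where xs: "set xs = cell h ` S" using finite_cell_image[OF S h] finite_list by blast
    have "\<exists>q::rat. \<forall>x\<in>S. cell h x = a \<longrightarrow> \<bar>g x - of_rat q\<bar> \<le> e" for a
    proof (cases "\<exists>x\<in>S. cell h x = a")
      case True
      then obtain y where y: "y \<in> S" "cell h y = a" by blast
      obtain q where q: "g y - e / 2 < of_rat q" "of_rat q < g y"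
        using of_rat_dense[of "g y - e / 2" "g y"] e by auto
      have "\<bar>g x - of_rat q\<bar> \<le> e" if x: "x \<in> S" "cell h x = a" for x
      proof -
        have "dist y x \<le> (\<Sum>i\<in>UNIV. \<bar>(y - x) $ i\<bar>)" unfolding dist_norm by (rule norm_le_l1_cart)
        also have "\<dots> \<le> (\<Sum>i\<in>(UNIV::2 set). h)"
          using cell_eq_imp_close[OF h, of x y] x(2) y(2) by (intro sum_mono) simp
        also have "\<dots> < d" using hd by simp
        finally have "dist (g y) (g x) < e / 2"
          using d(2)[of x y] x(1) y(1) closure_subset[of S] by blast
        then have "\<bar>g y - g x\<bar> < e / 2" by (simp only: dist_real_def)
        then show ?thesis using q by linarith
      qed
      then show ?thesis by blast
    qed blast
    then obtain q :: "int \<times> int \<Rightarrow> rat" where q: "\<And>x. x \<in> S \<Longrightarrow> \<bar>g x - of_rat (q (cell h x))\<bar> \<le> e" by metis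
    have "step_fun k (map (\<lambda>a. (a, q a)) xs) x = of_rat (q (cell h x))" if "x \<in> S" for x
      unfolding step_fun_def h_def[symmetric] using that xs by (simp add: map_of_map_restrict)
    then show ?thesis using q by (intro exI[of _ "map (\<lambda>a. (a, q a)) xs"]) simp
  qed
  then show ?thesis by blast
qed

context planar_domain
begin

text \<open>
  A countable family of triples of step functions approximates all \<open>(\<phi>, \<partial>\<^sub>1\<phi>, \<partial>\<^sub>2\<phi>)\<close>,
  and for each triple one nearby test function is selected.
\<close>

lemma countable_dense_test_functions:
  "\<exists>w::nat \<Rightarrow> real^2 \<Rightarrow> real. (\<forall>j. w j \<in> test_functions \<Omega>) \<and>
    (\<forall>\<phi>\<in>test_functions \<Omega>. \<forall>e>0. \<exists>j. \<forall>x\<in>\<Omega>. \<bar>\<phi> x - w j x\<bar> \<le> e \<and> (\<forall>i. \<bar>partial_deriv i \<phi> x - partial_deriv i (w j) x\<bar> \<le> e))"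
proof -
  define close where "close \<phi> c \<longleftrightarrow> (case c of (k, l0, l1, l2, m) \<Rightarrow>
      \<forall>x\<in>\<Omega>. \<bar>\<phi> x - step_fun k l0 x\<bar> \<le> 1 / real (Suc m) \<and>
        \<bar>partial_deriv 1 \<phi> x - step_fun k l1 x\<bar> \<le> 1 / real (Suc m) \<and>
        \<bar>partial_deriv 2 \<phi> x - step_fun k l2 x\<bar> \<le> 1 / real (Suc m))"
    for \<phi> :: "real^2 \<Rightarrow> real" and c :: "nat \<times> ((int \<times> int) \<times> rat) list \<times> ((int \<times> int) \<times> rat) list \<times> ((int \<times> int) \<times> rat) list \<times> nat"
  \<comment> \<open>Step functions are not admissible themselves, so every code that is close to
    some test function selects one. The default 0 keeps the whole family inside the test
    functions.\<close>
  define W where "W c = (if \<exists>\<phi>\<in>test_functions \<Omega>. close \<phi> c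
      then SOME \<phi>. \<phi> \<in> test_functions \<Omega> \<and> close \<phi> c else (\<lambda>x. 0))" for c
  have W: "W c \<in> test_functions \<Omega> \<and> close (W c) c" if "\<exists>\<phi>\<in>test_functions \<Omega>. close \<phi> c" for c
  proof -
    have "\<exists>\<phi>. \<phi> \<in> test_functions \<Omega> \<and> close \<phi> c" using that by blast
    from someI_ex[OF this] show ?thesis using that by (simp add: W_def)
  qed
  define w :: "nat \<Rightarrow> real^2 \<Rightarrow> real" where "w j = W (from_nat j)" for j
  have "w j \<in> test_functions \<Omega>" for j
  proof (cases "\<exists>\<phi>\<in>test_functions \<Omega>. close \<phi> (from_nat j)")
    case True then show ?thesis using W unfolding w_def by blast
  next
    case False then show ?thesis using test_functions_zero unfolding w_def W_def by simp
  qed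
  moreover have "\<exists>j. \<forall>x\<in>\<Omega>. \<bar>\<phi> x - w j x\<bar> \<le> e \<and> (\<forall>i. \<bar>partial_deriv i \<phi> x - partial_deriv i (w j) x\<bar> \<le> e)"
    if \<phi>: "\<phi> \<in> test_functions \<Omega>" and e: "e > 0" for \<phi> e
  proof -
    obtain m where "real m > 2 / e" using reals_Archimedean2 by blast
    \<comment> \<open>The factor 2 arises because \<phi> and the selected function are both compared
      with the same step functions.\<close>
    then have m: "2 * (1 / real (Suc m)) \<le> e" using e by (simp add: field_simps)
    have pos: "1 / real (Suc m) > 0" by simp
    note c = test_functionsD[OF \<phi>]
    obtain K0 where K0: "\<And>k. k \<ge> K0 \<Longrightarrow> \<exists>l. \<forall>x\<in>\<Omega>. \<bar>\<phi> x - step_fun k l x\<bar> \<le> 1 / real (Suc m)"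
      using step_fun_approximation[OF C1c_continuous[OF c] bounded_domain pos] by blast
    obtain K1 where K1: "\<And>k. k \<ge> K1 \<Longrightarrow> \<exists>l. \<forall>x\<in>\<Omega>. \<bar>partial_deriv 1 \<phi> x - step_fun k l x\<bar> \<le> 1 / real (Suc m)"
      using step_fun_approximation[OF C1c_continuous_partial[OF c] bounded_domain pos, of 1] by blast
    obtain K2 where K2: "\<And>k. k \<ge> K2 \<Longrightarrow> \<exists>l. \<forall>x\<in>\<Omega>. \<bar>partial_deriv 2 \<phi> x - step_fun k l x\<bar> \<le> 1 / real (Suc m)"
      using step_fun_approximation[OF C1c_continuous_partial[OF c] bounded_domain pos, of 2] by blast
    define k where "k = max K0 (max K1 K2)"
    have k: "k \<ge> K0" "k \<ge> K1" "k \<ge> K2" by (auto simp: k_def)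
    obtain l0 where l0: "\<forall>x\<in>\<Omega>. \<bar>\<phi> x - step_fun k l0 x\<bar> \<le> 1 / real (Suc m)" using K0[OF k(1)] by blast
    obtain l1 where l1: "\<forall>x\<in>\<Omega>. \<bar>partial_deriv 1 \<phi> x - step_fun k l1 x\<bar> \<le> 1 / real (Suc m)" using K1[OF k(2)] by blast
    obtain l2 where l2: "\<forall>x\<in>\<Omega>. \<bar>partial_deriv 2 \<phi> x - step_fun k l2 x\<bar> \<le> 1 / real (Suc m)" using K2[OF k(3)] by blast
    let ?c = "(k, l0, l1, l2, m)"
    have cl: "close \<phi> ?c" using l0 l1 l2 by (simp add: close_def)
    then have cW: "close (W ?c) ?c" using W \<phi> by blast
    have tri: "\<bar>a - b\<bar> \<le> e" if "\<bar>a - s\<bar> \<le> 1 / real (Suc m)" "\<bar>b - s\<bar> \<le> 1 / real (Suc m)" for a b s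
    proof -
      have "\<bar>a - b\<bar> \<le> \<bar>a - s\<bar> + \<bar>b - s\<bar>" by linarith
      also have "\<dots> \<le> 2 * (1 / real (Suc m))" using add_mono[OF that] by (simp only: mult_2)
      finally show ?thesis using m by (rule order_trans)
    qed
    have "\<bar>\<phi> x - W ?c x\<bar> \<le> e \<and> (\<forall>i. \<bar>partial_deriv i \<phi> x - partial_deriv i (W ?c) x\<bar> \<le> e)" if "x \<in> \<Omega>" for x
    proof (intro conjI allI)
      have f: "\<bar>\<phi> x - step_fun k l0 x\<bar> \<le> 1 / real (Suc m)" "\<bar>partial_deriv 1 \<phi> x - step_fun k l1 x\<bar> \<le> 1 / real (Suc m)"
        "\<bar>partial_deriv 2 \<phi> x - step_fun k l2 x\<bar> \<le> 1 / real (Suc m)"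
        using cl that unfolding close_def prod.case by blast+
      have g: "\<bar>W ?c x - step_fun k l0 x\<bar> \<le> 1 / real (Suc m)" "\<bar>partial_deriv 1 (W ?c) x - step_fun k l1 x\<bar> \<le> 1 / real (Suc m)"
        "\<bar>partial_deriv 2 (W ?c) x - step_fun k l2 x\<bar> \<le> 1 / real (Suc m)"
        using cW that unfolding close_def prod.case by blast+
      show "\<bar>\<phi> x - W ?c x\<bar> \<le> e" by (rule tri[OF f(1) g(1)])
      show "\<bar>partial_deriv i \<phi> x - partial_deriv i (W ?c) x\<bar> \<le> e" for i
        using exhaust_2[of i] tri[OF f(2) g(2)] tri[OF f(3) g(3)] by metis
    qed
    then have "\<forall>x\<in>\<Omega>. \<bar>\<phi> x - w (to_nat ?c) x\<bar> \<le> e \<and> (\<forall>i. \<bar>partial_deriv i \<phi> x - partial_deriv i (w (to_nat ?c)) x\<bar> \<le> e)"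
      by (simp add: w_def)
    then show ?thesis by blast
  qed
  ultimately show ?thesis by blast
qed

end

section \<open>Nonlinearities of polynomial growth\<close>

text \<open>A natural exponent dominates every real \<delta> and fits the integer moments of
  \<open>moment_bound\<close>. The class is closed under sums, products and antiderivatives, which
  are the operations needed for the equation.\<close>

definition poly_growth :: "(real \<Rightarrow> real) \<Rightarrow> bool" where
  "poly_growth \<Phi> \<longleftrightarrow> continuous_on UNIV \<Phi> \<and> (\<exists>C m. \<forall>s. \<bar>\<Phi> s\<bar> \<le> C * (1 + \<bar>s\<bar>) ^ m)"

lemma poly_growthI: "continuous_on UNIV \<Phi> \<Longrightarrow> (\<And>s. \<bar>\<Phi> s\<bar> \<le> C * (1 + \<bar>s\<bar>) ^ m) \<Longrightarrow> poly_growth \<Phi>"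
  unfolding poly_growth_def by blast

lemma poly_growthE:
  assumes "poly_growth \<Phi>"
  obtains C m where "C \<ge> 0" "\<And>s. \<bar>\<Phi> s\<bar> \<le> C * (1 + \<bar>s\<bar>) ^ m"
proof -
  obtain C m where C: "\<And>s. \<bar>\<Phi> s\<bar> \<le> C * (1 + \<bar>s\<bar>) ^ m" using assms unfolding poly_growth_def by blast
  have "C \<ge> 0" using C[of 0] by (auto intro: order_trans[OF abs_ge_zero])
  with C that show ?thesis by blast
qed

lemma poly_growth_const: "poly_growth (\<lambda>s. c)"
  by (rule poly_growthI[of _ "\<bar>c\<bar>" 0]) auto

lemma poly_growth_ident: "poly_growth (\<lambda>s. s)"
  by (rule poly_growthI[of _ 1 1]) auto

lemma poly_growth_mult:
  assumes "poly_growth \<Phi>" "poly_growth \<Psi>" shows "poly_growth (\<lambda>s. \<Phi> s * \<Psi> s)"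
proof -
  obtain C m where C: "C \<ge> 0" "\<And>s. \<bar>\<Phi> s\<bar> \<le> C * (1 + \<bar>s\<bar>) ^ m" using poly_growthE[OF assms(1)] by blast
  obtain D k where D: "D \<ge> 0" "\<And>s. \<bar>\<Psi> s\<bar> \<le> D * (1 + \<bar>s\<bar>) ^ k" using poly_growthE[OF assms(2)] by blast
  show ?thesis
  proof (rule poly_growthI[of _ "C * D" "m + k"])
    show "\<bar>\<Phi> s * \<Psi> s\<bar> \<le> C * D * (1 + \<bar>s\<bar>) ^ (m + k)" for s
      using mult_mono[OF C(2)[of s] D(2)[of s]] C(1) by (simp add: abs_mult power_add mult_ac)
  qed (use assms in \<open>auto simp: poly_growth_def intro!: continuous_intros\<close>)
qed

lemma poly_growth_add:
  assumes "poly_growth \<Phi>" "poly_growth \<Psi>" shows "poly_growth (\<lambda>s. \<Phi> s + \<Psi> s)"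
proof -
  obtain C m where C: "C \<ge> 0" "\<And>s. \<bar>\<Phi> s\<bar> \<le> C * (1 + \<bar>s\<bar>) ^ m" using poly_growthE[OF assms(1)] by blast
  obtain D k where D: "D \<ge> 0" "\<And>s. \<bar>\<Psi> s\<bar> \<le> D * (1 + \<bar>s\<bar>) ^ k" using poly_growthE[OF assms(2)] by blast
  show ?thesis
  proof (rule poly_growthI[of _ "C + D" "m + k"])
    fix s :: real
    have "(1 + \<bar>s\<bar>) ^ m \<le> (1 + \<bar>s\<bar>) ^ (m + k)" "(1 + \<bar>s\<bar>) ^ k \<le> (1 + \<bar>s\<bar>) ^ (m + k)"
      by (intro power_increasing; simp)+
    then have "C * (1 + \<bar>s\<bar>) ^ m + D * (1 + \<bar>s\<bar>) ^ k \<le> (C + D) * (1 + \<bar>s\<bar>) ^ (m + k)"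
      using C(1) D(1) by (auto simp: distrib_right intro!: add_mono mult_left_mono)
    then show "\<bar>\<Phi> s + \<Psi> s\<bar> \<le> (C + D) * (1 + \<bar>s\<bar>) ^ (m + k)" using C(2)[of s] D(2)[of s] by linarith
  qed (use assms in \<open>auto simp: poly_growth_def intro!: continuous_intros\<close>)
qed

lemma poly_growth_diff: "poly_growth \<Phi> \<Longrightarrow> poly_growth \<Psi> \<Longrightarrow> poly_growth (\<lambda>s. \<Phi> s - \<Psi> s)"
  using poly_growth_add[of \<Phi> "\<lambda>s. -1 * \<Psi> s"] poly_growth_mult[OF poly_growth_const[of "-1"], of \<Psi>] by simp

lemma poly_growth_power: "poly_growth (\<lambda>s. s ^ m)"
  by (induction m) (auto intro: poly_growth_const poly_growth_mult poly_growth_ident)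

text \<open>Supplies the primitives that turn convection integrands into exact derivatives: of
  s^\<delta> for the weak form, and of s^\<delta> s for the energy estimate.\<close>

lemma poly_growth_antiderivative:
  assumes "poly_growth \<Phi>"
  shows "\<exists>\<Gamma>. \<Gamma> 0 = 0 \<and> (\<forall>t. (\<Gamma> has_real_derivative \<Phi> t) (at t)) \<and> poly_growth \<Gamma>"
proof -
  have cont: "continuous_on UNIV \<Phi>" using assms by (simp add: poly_growth_def)
  define \<Gamma> where "\<Gamma> t = (LBINT y=ereal 0..ereal t. \<Phi> y)" for t :: real
  have deriv: "(\<Gamma> has_real_derivative \<Phi> t) (at t)" for t
  proof -
    \<comment> \<open>The fundamental theorem is applied on a compact interval; this one has t in
      its interior, so the derivative within it is the full derivative.\<close>
    have "((\<lambda>u. LBINT y=ereal 0..ereal u. \<Phi> y) has_vector_derivative \<Phi> t) (at t within {min 0 t - 1..max 0 t + 1})"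
      by (rule interval_integral_FTC2) (auto intro: continuous_on_subset[OF cont])
    moreover have "at t within {min 0 t - 1..max 0 t + 1} = at t"
      by (rule at_within_Icc_at) auto
    ultimately show ?thesis
      by (simp add: \<Gamma>_def[abs_def] has_real_derivative_iff_has_vector_derivative)
  qed
  have \<Gamma>0: "\<Gamma> 0 = 0" by (simp add: \<Gamma>_def)
  obtain C m where C: "C \<ge> 0" "\<And>s. \<bar>\<Phi> s\<bar> \<le> C * (1 + \<bar>s\<bar>) ^ m" using poly_growthE[OF assms] by blast
  have "poly_growth \<Gamma>"
  proof (rule poly_growthI[of _ C "Suc m"])
    show "continuous_on UNIV \<Gamma>" using deriv DERIV_isCont continuous_at_imp_continuous_on by blast
    fix s :: real
    have "norm (\<Gamma> s - \<Gamma> 0) \<le> (C * (1 + \<bar>s\<bar>) ^ m) * norm (s - 0)"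
    proof (rule field_differentiable_bound[of "{min 0 s..max 0 s}" \<Gamma> \<Phi>])
      show "(\<Gamma> has_real_derivative \<Phi> z) (at z within {min 0 s..max 0 s})" for z
        using deriv by (rule has_field_derivative_at_within)
      fix z assume "z \<in> {min 0 s..max 0 s}"
      then have "\<bar>z\<bar> \<le> \<bar>s\<bar>" by (auto simp: min_def max_def split: if_splits)
      then have "C * (1 + \<bar>z\<bar>) ^ m \<le> C * (1 + \<bar>s\<bar>) ^ m" using C(1) by (intro mult_left_mono power_mono) auto
      then show "norm (\<Phi> z) \<le> C * (1 + \<bar>s\<bar>) ^ m" using C(2)[of z] by simp
    qed auto
    also have "\<dots> \<le> (C * (1 + \<bar>s\<bar>) ^ m) * (1 + \<bar>s\<bar>)" using C(1) by (intro mult_left_mono) auto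
    finally show "\<bar>\<Gamma> s\<bar> \<le> C * (1 + \<bar>s\<bar>) ^ Suc m" using \<Gamma>0 by (simp add: mult_ac)
  qed
  with deriv \<Gamma>0 show ?thesis by blast
qed

section \<open>Growth and sign of the power and reaction terms\<close>

lemma gpow_int:
  assumes "\<delta> \<in> \<int>" "\<delta> \<ge> 1" shows "gpow s \<delta> = s ^ nat \<lfloor>\<delta>\<rfloor>"
proof -
  have "\<lfloor>\<delta>\<rfloor> \<ge> 0" using assms(2) by simp
  then show ?thesis using assms(1) by (simp add: gpow_def power_int_def)
qed

text \<open>The two conventions in \<open>gpow\<close> agree up to sign, so size estimates such as
  that in \<open>reaction_mult_le\<close> need no case distinction.\<close>

lemma abs_gpow:
  assumes "\<delta> \<ge> 1" shows "\<bar>gpow s \<delta>\<bar> = \<bar>s\<bar> powr \<delta>"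
proof (cases "\<delta> \<in> \<int>")
  case True
  then obtain k where k: "\<delta> = of_int k" by (auto elim: Ints_cases)
  then have "nat k > 0" "\<delta> = real (nat k)" using assms by auto
  then show ?thesis
    using gpow_int[OF True assms, of s] k by (cases "s = 0") (simp_all add: power_abs powr_realpow[symmetric])
next
  case False then show ?thesis by (simp add: gpow_def)
qed

lemma poly_growth_gpow:
  assumes "\<delta> \<ge> 1" shows "poly_growth (\<lambda>s. gpow s \<delta>)"
proof (cases "\<delta> \<in> \<int>")
  case True
  then show ?thesis using gpow_int[OF True assms] poly_growth_power by simp
next
  case False
  show ?thesis
  proof (rule poly_growthI[of _ 1 "nat \<lceil>\<delta>\<rceil>"])
    have "continuous_on UNIV (\<lambda>s::real. \<bar>s\<bar> powr \<delta>)"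
      using assms by (intro continuous_on_powr' continuous_intros) auto
    then show "continuous_on UNIV (\<lambda>s. gpow s \<delta>)" using False by (simp add: gpow_def)
    fix s :: real
    have "\<bar>gpow s \<delta>\<bar> = \<bar>s\<bar> powr \<delta>" by (rule abs_gpow[OF assms])
    also have "\<dots> \<le> (1 + \<bar>s\<bar>) powr \<delta>" using assms by (intro powr_mono2) auto
    also have "\<dots> \<le> (1 + \<bar>s\<bar>) powr real (nat \<lceil>\<delta>\<rceil>)" using assms by (intro powr_mono) linarith+
    also have "\<dots> = (1 + \<bar>s\<bar>) ^ nat \<lceil>\<delta>\<rceil>" by (intro powr_realpow) simp
    finally show "\<bar>gpow s \<delta>\<bar> \<le> 1 * (1 + \<bar>s\<bar>) ^ nat \<lceil>\<delta>\<rceil>" by simp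
  qed
qed

definition reaction :: "real \<Rightarrow> real \<Rightarrow> real \<Rightarrow> real" where
  "reaction \<delta> \<gamma> s = s * (1 - gpow s \<delta>) * (gpow s \<delta> - \<gamma>)"

lemma poly_growth_reaction: "\<delta> \<ge> 1 \<Longrightarrow> poly_growth (reaction \<delta> \<gamma>)"
  unfolding reaction_def[abs_def]
  by (intro poly_growth_mult poly_growth_diff poly_growth_ident poly_growth_const poly_growth_gpow)

text \<open>The product is positive only for \<open>\<gamma> < gpow s \<delta> < 1\<close>, and then \<open>\<bar>s\<bar> < 1\<close>.\<close>

lemma reaction_mult_le:
  assumes "\<delta> \<ge> 1" "0 < \<gamma>" "\<gamma> < 1" shows "reaction \<delta> \<gamma> s * s \<le> 1"
proof -
  define w where "w = gpow s \<delta>"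
  have eq: "reaction \<delta> \<gamma> s * s = s\<^sup>2 * ((1 - w) * (w - \<gamma>))"
    by (simp add: reaction_def w_def power2_eq_square)
  show ?thesis
  proof (cases "\<gamma> < w \<and> w < 1")
    case True
    then have "\<bar>s\<bar> powr \<delta> < 1" using abs_gpow[OF assms(1), of s] assms(2) by (simp add: w_def)
    then have "\<bar>s\<bar> < 1" using assms(1) ge_one_powr_ge_zero[of "\<bar>s\<bar>" \<delta>] by (cases "\<bar>s\<bar> < 1") auto
    then have "s\<^sup>2 \<le> 1" by (simp add: abs_square_le_1)
    moreover have "(1 - w) * (w - \<gamma>) \<le> 1 * 1" using True assms by (intro mult_mono) auto
    moreover have "(1 - w) * (w - \<gamma>) \<ge> 0" using True by simp
    ultimately have "s\<^sup>2 * ((1 - w) * (w - \<gamma>)) \<le> 1 * 1" by (intro mult_mono) auto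
    then show ?thesis by (simp add: eq)
  next
    case False
    then consider "w \<le> \<gamma>" | "1 \<le> w" by linarith
    then have "(1 - w) * (w - \<gamma>) \<le> 0"
      using assms by cases (auto intro: mult_nonneg_nonpos mult_nonpos_nonneg)
    then have "s\<^sup>2 * ((1 - w) * (w - \<gamma>)) \<le> 0" by (rule mult_nonneg_nonpos[OF zero_le_power2])
    then show ?thesis by (simp add: eq)
  qed
qed

text \<open>The even exponent lets the absolute value be dropped, which leads to the moments of
  \<open>moment_bound\<close>.\<close>

lemma one_plus_power_le:
  fixes a :: real assumes "a \<ge> 0" shows "(1 + a) ^ k \<le> 2 ^ k * (1 + a ^ (2 * k))"
proof (cases "a \<le> 1")
  case True
  then have "(1 + a) ^ k \<le> 2 ^ k" using assms by (intro power_mono) auto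
  also have "\<dots> \<le> 2 ^ k * (1 + a ^ (2 * k))" using assms by simp
  finally show ?thesis .
next
  case False
  have "(1 + a) ^ k \<le> (2 * a) ^ k" using False by (intro power_mono) auto
  also have "\<dots> = 2 ^ k * a ^ k" by (rule power_mult_distrib)
  also have "\<dots> \<le> 2 ^ k * (1 + a ^ (2 * k))"
  proof (intro mult_left_mono)
    have "a ^ k \<le> a ^ (2 * k)" using False by (intro power_increasing) auto
    then show "a ^ k \<le> 1 + a ^ (2 * k)" by simp
  qed simp
  finally show ?thesis .
qed

section \<open>Convergence of nonlinearities along sequences of bounded energy\<close>

context planar_domain
begin

lemma poly_growth_measurable:
  "poly_growth \<Phi> \<Longrightarrow> u \<in> borel_measurable \<mu> \<Longrightarrow> (\<lambda>x. \<Phi> (u x)) \<in> borel_measurable \<mu>"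
  by (rule measurable_compose[of u _ borel]) (auto simp: poly_growth_def borel_measurable_continuous_onI)

lemma poly_growth_C1c_sq_integrable:
  assumes "poly_growth \<Phi>" "y \<in> C1c \<Omega>" shows "sq_integrable \<mu> (\<lambda>x. \<Phi> (y x))"
proof -
  obtain B where B: "\<And>x. \<bar>y x\<bar> \<le> B" using C1c_bounded[OF assms(2)] by blast
  obtain C m where C: "C \<ge> 0" "\<And>s. \<bar>\<Phi> s\<bar> \<le> C * (1 + \<bar>s\<bar>) ^ m" using poly_growthE[OF assms(1)] by blast
  show ?thesis
  proof (rule sq_integrable_bounded)
    show "(\<lambda>x. \<Phi> (y x)) \<in> borel_measurable \<mu>"
      by (rule poly_growth_measurable[OF assms(1) sq_integrable_measurable[OF C1c_sq_integrable[OF assms(2)]]])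
    show "\<bar>\<Phi> (y x)\<bar> \<le> C * (1 + B) ^ m" for x
      using C(2)[of "y x"] mult_left_mono[OF power_mono[of "1 + \<bar>y x\<bar>" "1 + B" m] C(1)] B[of x] by force
  qed
qed

text \<open>The bound depends on \<open>y\<close> only through its energy. Squaring doubles the
  growth exponent m to k = 2 m, and \<open>one_plus_power_le\<close> leads to the moment of order 2
  k.\<close>

lemma poly_growth_integral_bound:
  assumes "poly_growth \<Phi>"
  shows "\<exists>B. \<forall>y\<in>C1c \<Omega>. energy y \<le> M \<longrightarrow> (\<integral>x. (\<Phi> (y x))\<^sup>2 \<partial>\<mu>) \<le> B"
proof -
  obtain C m where C: "C \<ge> 0" "\<And>s. \<bar>\<Phi> s\<bar> \<le> C * (1 + \<bar>s\<bar>) ^ m" using poly_growthE[OF assms] by blast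
  define k where "k = 2 * m"
  have bound: "(\<Phi> s)\<^sup>2 \<le> C\<^sup>2 * 2 ^ k + C\<^sup>2 * 2 ^ k * s ^ (2 * k)" for s
  proof -
    have "(\<Phi> s)\<^sup>2 \<le> (C * (1 + \<bar>s\<bar>) ^ m)\<^sup>2" using power_mono[OF C(2)[of s], of 2] by simp
    also have "\<dots> = C\<^sup>2 * (1 + \<bar>s\<bar>) ^ k" by (simp add: power_mult_distrib k_def power_mult[symmetric] mult.commute)
    also have "\<dots> \<le> C\<^sup>2 * (2 ^ k * (1 + \<bar>s\<bar> ^ (2 * k)))" by (intro mult_left_mono one_plus_power_le) auto
    also have "\<bar>s\<bar> ^ (2 * k) = s ^ (2 * k)" by (simp add: power_even_abs)
    finally show ?thesis by (simp add: algebra_simps)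
  qed
  have "(\<integral>x. (\<Phi> (y x))\<^sup>2 \<partial>\<mu>) \<le> C\<^sup>2 * 2 ^ k * area + C\<^sup>2 * 2 ^ k * (area * (fact k)\<^sup>2 * M ^ k)"
    if y: "y \<in> C1c \<Omega>" and E: "energy y \<le> M" for y
  proof -
    have iy: "integrable \<mu> (\<lambda>x. y x ^ (2 * k))"
      using sq_integrable_sq[OF C1c_power_sq_integrable[OF y, of k]] by (simp add: power_mult[symmetric] mult.commute)
    have "(\<integral>x. (\<Phi> (y x))\<^sup>2 \<partial>\<mu>) \<le> (\<integral>x. C\<^sup>2 * 2 ^ k + C\<^sup>2 * 2 ^ k * y x ^ (2 * k) \<partial>\<mu>)"
      using iy by (intro integral_mono sq_integrable_sq poly_growth_C1c_sq_integrable assms y bound) auto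
    also have "\<dots> = C\<^sup>2 * 2 ^ k * area + C\<^sup>2 * 2 ^ k * (\<integral>x. y x ^ (2 * k) \<partial>\<mu>)"
      using iy by simp
    also have "\<dots> \<le> C\<^sup>2 * 2 ^ k * area + C\<^sup>2 * 2 ^ k * (area * (fact k)\<^sup>2 * energy y ^ k)"
      by (intro add_left_mono mult_left_mono moment_bound y) auto
    also have "\<dots> \<le> C\<^sup>2 * 2 ^ k * area + C\<^sup>2 * 2 ^ k * (area * (fact k)\<^sup>2 * M ^ k)"
      using E energy_nonneg[of y] by (intro add_left_mono mult_left_mono power_mono) auto
    finally show ?thesis .
  qed
  then show ?thesis by blast
qed

lemma poly_growth_limit_sq_integrable:
  assumes \<Phi>: "poly_growth \<Phi>" and y: "\<And>n. y n \<in> C1c \<Omega>" "\<And>n. energy (y n) \<le> M"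
    and lim: "AE x in \<mu>. (\<lambda>n. y n x) \<longlonglongrightarrow> u x" and u: "u \<in> borel_measurable \<mu>"
  shows "sq_integrable \<mu> (\<lambda>x. \<Phi> (u x))"
proof -
  obtain B where B: "\<And>n. (\<integral>x. (\<Phi> (y n x))\<^sup>2 \<partial>\<mu>) \<le> B" using poly_growth_integral_bound[OF \<Phi>, of M] y by blast
  have m: "(\<lambda>x. \<Phi> (u x)) \<in> borel_measurable \<mu>" by (rule poly_growth_measurable[OF \<Phi> u])
  have "integrable \<mu> (\<lambda>x. (\<Phi> (u x))\<^sup>2)"
  proof (rule integral_Fatou_bound(1)[where f="\<lambda>n x. (\<Phi> (y n x))\<^sup>2" and C=B and N=0])
    show "integrable \<mu> (\<lambda>x. (\<Phi> (y n x))\<^sup>2)" for n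
      by (rule sq_integrable_sq[OF poly_growth_C1c_sq_integrable[OF \<Phi> y(1)]])
    show "AE x in \<mu>. (\<lambda>n. (\<Phi> (y n x))\<^sup>2) \<longlonglongrightarrow> (\<Phi> (u x))\<^sup>2"
      using lim
    proof eventually_elim
      case (elim x)
      have "isCont \<Phi> (u x)" using \<Phi> by (simp add: poly_growth_def continuous_on_eq_continuous_at)
      then show ?case using elim by (intro tendsto_power isCont_tendsto_compose[of _ \<Phi>])
    qed
    show "(\<lambda>x. (\<Phi> (u x))\<^sup>2) \<in> borel_measurable \<mu>" using m by measurable
  qed (auto intro: B)
  with m show ?thesis by (simp add: sq_integrable_def)
qed

text \<open>The square of \<Phi> has polynomial growth too, so the squared differences are bounded
  in L2. They tend to zero almost everywhere, hence in L1 by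
  \<open>l1_tendsto_0_of_l2_bounded\<close>, and this is L2 convergence of the differences.\<close>

lemma poly_growth_limit_tendsto:
  assumes \<Phi>: "poly_growth \<Phi>" and y: "\<And>n. y n \<in> C1c \<Omega>" "\<And>n. energy (y n) \<le> M"
    and lim: "AE x in \<mu>. (\<lambda>n. y n x) \<longlonglongrightarrow> u x" and u: "u \<in> borel_measurable \<mu>"
  shows "(\<lambda>n. l2norm \<mu> (\<lambda>x. \<Phi> (y n x) - \<Phi> (u x))) \<longlonglongrightarrow> 0"
proof -
  have \<Phi>2: "poly_growth (\<lambda>s. \<Phi> s * \<Phi> s)" by (rule poly_growth_mult[OF \<Phi> \<Phi>])
  obtain B where B: "\<And>n. (\<integral>x. (\<Phi> (y n x) * \<Phi> (y n x))\<^sup>2 \<partial>\<mu>) \<le> B"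
    using poly_growth_integral_bound[OF \<Phi>2, of M] y by blast
  have su: "sq_integrable \<mu> (\<lambda>x. \<Phi> (u x) * \<Phi> (u x))" by (rule poly_growth_limit_sq_integrable[OF \<Phi>2 y lim u])
  have sy: "sq_integrable \<mu> (\<lambda>x. \<Phi> (y n x) * \<Phi> (y n x))" for n by (rule poly_growth_C1c_sq_integrable[OF \<Phi>2 y(1)])
  have mu: "(\<lambda>x. \<Phi> (u x)) \<in> borel_measurable \<mu>" by (rule poly_growth_measurable[OF \<Phi> u])
  have my: "(\<lambda>x. \<Phi> (y n x)) \<in> borel_measurable \<mu>" for n
    by (rule sq_integrable_measurable[OF poly_growth_C1c_sq_integrable[OF \<Phi> y(1)]])
  define h where "h n x = (\<Phi> (y n x) - \<Phi> (u x))\<^sup>2" for n x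
  have hm: "h n \<in> borel_measurable \<mu>" for n unfolding h_def using mu my[of n] by measurable
  have h2: "(h n x)\<^sup>2 \<le> 8 * (\<Phi> (y n x) * \<Phi> (y n x))\<^sup>2 + 8 * (\<Phi> (u x) * \<Phi> (u x))\<^sup>2" for n x
  proof -
    have ab: "(a - b)\<^sup>2 \<le> 2 * (a * a) + 2 * (b * b)" for a b :: real
      using sum_squares_bound[of a "- b"] by (simp add: power2_eq_square algebra_simps)
    have ab': "(a + b)\<^sup>2 \<le> 2 * a\<^sup>2 + 2 * b\<^sup>2" for a b :: real
      using sum_squares_bound[of a b] by (simp add: power2_sum)
    have "(h n x)\<^sup>2 \<le> (2 * (\<Phi> (y n x) * \<Phi> (y n x)) + 2 * (\<Phi> (u x) * \<Phi> (u x)))\<^sup>2"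
      unfolding h_def by (intro power_mono ab) auto
    also have "\<dots> \<le> 2 * (2 * (\<Phi> (y n x) * \<Phi> (y n x)))\<^sup>2 + 2 * (2 * (\<Phi> (u x) * \<Phi> (u x)))\<^sup>2" by (rule ab')
    also have "\<dots> = 8 * (\<Phi> (y n x) * \<Phi> (y n x))\<^sup>2 + 8 * (\<Phi> (u x) * \<Phi> (u x))\<^sup>2"
      by (simp only: power_mult_distrib) simp
    finally show ?thesis .
  qed
  have i2: "integrable \<mu> (\<lambda>x. 8 * (\<Phi> (y n x) * \<Phi> (y n x))\<^sup>2 + 8 * (\<Phi> (u x) * \<Phi> (u x))\<^sup>2)" for n
    using sq_integrable_sq[OF su] sq_integrable_sq[OF sy[of n]] by (intro Bochner_Integration.integrable_add integrable_mult_right)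
  have hs: "sq_integrable \<mu> (h n)" for n
    unfolding sq_integrable_def
  proof
    show "integrable \<mu> (\<lambda>x. (h n x)\<^sup>2)"
    proof (rule Bochner_Integration.integrable_bound[OF i2[of n]])
      show "(\<lambda>x. (h n x)\<^sup>2) \<in> borel_measurable \<mu>" using hm[of n] by measurable
      have "norm ((h n x)\<^sup>2) \<le> norm (8 * (\<Phi> (y n x) * \<Phi> (y n x))\<^sup>2 + 8 * (\<Phi> (u x) * \<Phi> (u x))\<^sup>2)" for x
        unfolding real_norm_def abs_power2 by (rule order_trans[OF h2 abs_ge_self])
      then show "AE x in \<mu>. norm ((h n x)\<^sup>2) \<le> norm (8 * (\<Phi> (y n x) * \<Phi> (y n x))\<^sup>2 + 8 * (\<Phi> (u x) * \<Phi> (u x))\<^sup>2)"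
        by (intro AE_I2)
    qed
  qed (rule hm)
  have "(\<lambda>n. \<integral>x. \<bar>h n x\<bar> \<partial>\<mu>) \<longlonglongrightarrow> 0"
  proof (rule l1_tendsto_0_of_l2_bounded[OF hs])
    show "(\<integral>x. (h n x)\<^sup>2 \<partial>\<mu>) \<le> 8 * B + 8 * (\<integral>x. (\<Phi> (u x) * \<Phi> (u x))\<^sup>2 \<partial>\<mu>)" for n
    proof -
      have "(\<integral>x. (h n x)\<^sup>2 \<partial>\<mu>) \<le> (\<integral>x. 8 * (\<Phi> (y n x) * \<Phi> (y n x))\<^sup>2 + 8 * (\<Phi> (u x) * \<Phi> (u x))\<^sup>2 \<partial>\<mu>)"
        by (intro integral_mono sq_integrable_sq hs i2 h2)
      also have "\<dots> = 8 * (\<integral>x. (\<Phi> (y n x) * \<Phi> (y n x))\<^sup>2 \<partial>\<mu>) + 8 * (\<integral>x. (\<Phi> (u x) * \<Phi> (u x))\<^sup>2 \<partial>\<mu>)"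
        using sq_integrable_sq[OF su] sq_integrable_sq[OF sy[of n]]
        by (subst Bochner_Integration.integral_add) (auto simp del: power_mult_distrib)
      finally show ?thesis using B[of n] by linarith
    qed
    show "AE x in \<mu>. (\<lambda>n. h n x) \<longlonglongrightarrow> 0"
      using lim
    proof eventually_elim
      case (elim x)
      have "isCont \<Phi> (u x)" using \<Phi> by (simp add: poly_growth_def continuous_on_eq_continuous_at)
      then have "(\<lambda>n. \<Phi> (y n x)) \<longlonglongrightarrow> \<Phi> (u x)" by (rule isCont_tendsto_compose[OF _ elim])
      then have "(\<lambda>n. (\<Phi> (y n x) - \<Phi> (u x))\<^sup>2) \<longlonglongrightarrow> (\<Phi> (u x) - \<Phi> (u x))\<^sup>2" by (intro tendsto_intros)
      then show ?case by (simp add: h_def)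
    qed
  qed
  then have "(\<lambda>n. sqrt (\<integral>x. \<bar>h n x\<bar> \<partial>\<mu>)) \<longlonglongrightarrow> sqrt 0" by (rule tendsto_real_sqrt)
  then show ?thesis by (simp add: l2norm_def h_def)
qed

lemma l2norm_convergent_bounded:
  assumes "\<And>n. sq_integrable \<mu> (f n)" "sq_integrable \<mu> g" "(\<lambda>n::nat. l2norm \<mu> (\<lambda>x. f n x - g x)) \<longlonglongrightarrow> 0"
  shows "\<exists>B. \<forall>n. l2norm \<mu> (f n) \<le> B"
proof -
  obtain K where K: "\<And>n. norm (l2norm \<mu> (\<lambda>x. f n x - g x)) \<le> K"
    using convergent_imp_Bseq[of "\<lambda>n. l2norm \<mu> (\<lambda>x. f n x - g x)"] assms(3) by (auto simp: convergent_def Bseq_def)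
  have "l2norm \<mu> (f n) \<le> K + l2norm \<mu> g" for n
    using l2norm_triangle_sub[OF assms(1,2), of n] K[of n] by simp
  then show ?thesis by blast
qed

lemma energy_bounded_of_convergent:
  assumes y: "\<And>n. y n \<in> C1c \<Omega>" and g: "\<And>i. sq_integrable \<mu> (g i)"
    and lim: "\<And>i. (\<lambda>n::nat. l2norm \<mu> (\<lambda>x. partial_deriv i (y n) x - g i x)) \<longlonglongrightarrow> 0"
  shows "\<exists>M. \<forall>n. energy (y n) \<le> M"
proof -
  have "\<exists>B. \<forall>n. l2norm \<mu> (partial_deriv i (y n)) \<le> B" for i
    by (rule l2norm_convergent_bounded[OF C1c_partial_sq_integrable[OF y] g lim])
  then obtain B where B: "\<And>i n. l2norm \<mu> (partial_deriv i (y n)) \<le> B i" by metis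
  have "energy (y n) \<le> (\<Sum>i\<in>UNIV. (B i)\<^sup>2)" for n
    unfolding energy_def by (intro sum_mono power_mono B) simp
  then show ?thesis by blast
qed

text \<open>Brings an arbitrary element of \<open>H10\<close> into the form required by the limit
  lemmas for nonlinearities: approximation almost everywhere with bounded energy.\<close>

lemma H10_AE_approx:
  assumes u: "u \<in> H10 \<Omega>"
  shows "\<exists>y M. (\<forall>n::nat. y n \<in> test_functions \<Omega>) \<and> (\<forall>n. energy (y n) \<le> M) \<and> (AE x in \<mu>. (\<lambda>n. y n x) \<longlonglongrightarrow> u x) \<and>
    (\<forall>i. (\<lambda>n. l2norm \<mu> (\<lambda>x. partial_deriv i (y n) x - weak_deriv \<Omega> i u x)) \<longlonglongrightarrow> 0)"
proof -
  obtain \<phi> where \<phi>: "\<And>n::nat. \<phi> n \<in> test_functions \<Omega>" "(\<lambda>n. l2norm \<mu> (\<lambda>x. \<phi> n x - u x)) \<longlonglongrightarrow> 0"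
    "\<And>i. (\<lambda>n. l2norm \<mu> (\<lambda>x. partial_deriv i (\<phi> n) x - weak_deriv \<Omega> i u x)) \<longlonglongrightarrow> 0"
    using H10_approx[OF u] by blast
  note c = test_functionsD[OF \<phi>(1)]
  have "sq_integrable \<mu> (\<lambda>x. \<phi> n x - u x)" for n
    by (intro sq_integrable_diff C1c_sq_integrable c H1_sq_integrable H10_H1 u)
  from l2norm_tendsto_0_AE_subseq[OF this \<phi>(2)]
  obtain r :: "nat \<Rightarrow> nat" where r: "strict_mono r" "AE x in \<mu>. (\<lambda>n. \<phi> (r n) x - u x) \<longlonglongrightarrow> 0" by blast
  have "AE x in \<mu>. (\<lambda>n. \<phi> (r n) x) \<longlonglongrightarrow> u x" using r(2) by eventually_elim (simp add: LIM_zero_iff)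
  moreover obtain M where "\<And>n. energy (\<phi> n) \<le> M"
    using energy_bounded_of_convergent[of \<phi> "\<lambda>i. weak_deriv \<Omega> i u", OF c H1_weak_deriv(1)[OF H10_H1[OF u]] \<phi>(3)] by blast
  moreover have "(\<lambda>n. l2norm \<mu> (\<lambda>x. partial_deriv i (\<phi> (r n)) x - weak_deriv \<Omega> i u x)) \<longlonglongrightarrow> 0" for i
    using LIMSEQ_subseq_LIMSEQ[OF \<phi>(3)[of i] r(1)] by (simp add: o_def)
  ultimately show ?thesis using \<phi>(1) by (intro exI[of _ "\<lambda>n. \<phi> (r n)"] exI[of _ M]) blast
qed

lemma H10_poly_growth:
  assumes "u \<in> H10 \<Omega>" "poly_growth \<Phi>" shows "sq_integrable \<mu> (\<lambda>x. \<Phi> (u x))"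
proof -
  obtain y M where y: "\<And>n::nat. y n \<in> test_functions \<Omega>" "\<And>n. energy (y n) \<le> M" "AE x in \<mu>. (\<lambda>n. y n x) \<longlonglongrightarrow> u x"
    using H10_AE_approx[OF assms(1)] by blast
  show ?thesis
    by (rule poly_growth_limit_sq_integrable[OF assms(2) test_functionsD[OF y(1)] y(2,3)
        sq_integrable_measurable[OF H1_sq_integrable[OF H10_H1[OF assms(1)]]]])
qed

lemma sq_integrable_mult_of_squares:
  assumes "sq_integrable \<mu> (\<lambda>x. a x * a x)" "sq_integrable \<mu> (\<lambda>x. b x * b x)"
    "a \<in> borel_measurable \<mu>" "b \<in> borel_measurable \<mu>"
  shows "sq_integrable \<mu> (\<lambda>x. a x * b x)"
proof -
  have "(\<lambda>x. (a x * b x)\<^sup>2) = (\<lambda>x. (a x * a x) * (b x * b x))" by (auto simp: power2_eq_square)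
  then show ?thesis using sq_integrable_mult[OF assms(1,2)] assms(3,4) by (simp add: sq_integrable_def)
qed

text \<open>Neither factor need be bounded, but the squares of both are again nonlinearities of
  polynomial growth and hence square-integrable.\<close>

lemma H10_poly_growth_mult:
  assumes u: "u \<in> H10 \<Omega>" and v: "v \<in> H10 \<Omega>" and \<Phi>: "poly_growth \<Phi>" and \<Psi>: "poly_growth \<Psi>"
  shows "sq_integrable \<mu> (\<lambda>x. \<Phi> (u x) * \<Psi> (v x))"
  by (rule sq_integrable_mult_of_squares[OF
      H10_poly_growth[OF u poly_growth_mult[OF \<Phi> \<Phi>]] H10_poly_growth[OF v poly_growth_mult[OF \<Psi> \<Psi>]]
      sq_integrable_measurable[OF H10_poly_growth[OF u \<Phi>]] sq_integrable_measurable[OF H10_poly_growth[OF v \<Psi>]]])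

lemma
  assumes "sq_integrable \<mu> a" "w \<in> C1c \<Omega>"
  shows sq_integrable_mult_bounded: "sq_integrable \<mu> (\<lambda>x. a x * w x)"
    and l2norm_mult_bounded: "(\<And>x. \<bar>w x\<bar> \<le> B) \<Longrightarrow> l2norm \<mu> (\<lambda>x. a x * w x) \<le> B * l2norm \<mu> a"
proof -
  have le: "(a x * w x)\<^sup>2 \<le> B\<^sup>2 * (a x)\<^sup>2" if "\<And>x. \<bar>w x\<bar> \<le> B" for B x
    using mult_right_mono[OF power_mono[OF that[of x], of 2], of "(a x)\<^sup>2"] by (simp add: power_mult_distrib mult.commute)
  have m: "(\<lambda>x. a x * w x) \<in> borel_measurable \<mu>"
    by (rule borel_measurable_times[OF sq_integrable_measurable[OF assms(1)]
        sq_integrable_measurable[OF C1c_sq_integrable[OF assms(2)]]])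
  have i: "integrable \<mu> (\<lambda>x. (a x * w x)\<^sup>2)" if B: "\<And>x. \<bar>w x\<bar> \<le> B" for B
  proof (rule Bochner_Integration.integrable_bound[where f="\<lambda>x. B\<^sup>2 * (a x)\<^sup>2"])
    show "integrable \<mu> (\<lambda>x. B\<^sup>2 * (a x)\<^sup>2)" using sq_integrable_sq[OF assms(1)] by simp
    show "(\<lambda>x. (a x * w x)\<^sup>2) \<in> borel_measurable \<mu>" using m by measurable
    show "AE x in \<mu>. norm ((a x * w x)\<^sup>2) \<le> norm (B\<^sup>2 * (a x)\<^sup>2)"
      using le[OF B] by (intro AE_I2) simp
  qed
  show "sq_integrable \<mu> (\<lambda>x. a x * w x)"
  proof -
    obtain B where "\<And>x. \<bar>w x\<bar> \<le> B" using C1c_bounded[OF assms(2)] by blast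
    from i[OF this] m show ?thesis by (simp add: sq_integrable_def)
  qed
  assume B: "\<And>x. \<bar>w x\<bar> \<le> B"
  have B0: "B \<ge> 0" using B[of 0] by (rule order_trans[OF abs_ge_zero])
  show "l2norm \<mu> (\<lambda>x. a x * w x) \<le> B * l2norm \<mu> a"
  proof (rule power2_le_imp_le)
    have "(\<integral>x. (a x * w x)\<^sup>2 \<partial>\<mu>) \<le> (\<integral>x. B\<^sup>2 * (a x)\<^sup>2 \<partial>\<mu>)"
      using sq_integrable_sq[OF assms(1)] by (intro integral_mono i[OF B] le[OF B]) auto
    then show "(l2norm \<mu> (\<lambda>x. a x * w x))\<^sup>2 \<le> (B * l2norm \<mu> a)\<^sup>2"
      by (simp add: power_mult_distrib l2norm_sq)
  qed (use B0 in simp)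
qed

end

section \<open>Existence of weak solutions\<close>

locale elliptic_problem = planar_domain \<Omega> for \<Omega> :: "(real^2) set" +
  fixes \<nu> \<alpha> \<beta> \<delta> \<gamma> :: real and f :: "(real^2 \<Rightarrow> real) \<Rightarrow> real"
  assumes \<nu>: "\<nu> > 0" and \<beta>: "\<beta> > 0" and \<delta>: "\<delta> \<ge> 1" and \<gamma>: "0 < \<gamma>" "\<gamma> < 1"
    and f: "f \<in> H_minus1 \<Omega>"
begin

abbreviation R :: "real \<Rightarrow> real" where "R \<equiv> reaction \<delta> \<gamma>"

lemmas gpow_growth = poly_growth_gpow[OF \<delta>]
lemmas reaction_growth = poly_growth_reaction[OF \<delta>, of \<gamma>]

definition \<Gamma> :: "real \<Rightarrow> real" where
  "\<Gamma> = (SOME \<Gamma>. \<Gamma> 0 = 0 \<and> (\<forall>t. (\<Gamma> has_real_derivative gpow t \<delta>) (at t)) \<and> poly_growth \<Gamma>)"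

lemma \<Gamma>: "\<Gamma> 0 = 0" "(\<Gamma> has_real_derivative gpow t \<delta>) (at t)" "poly_growth \<Gamma>"
proof -
  have "\<Gamma> 0 = 0 \<and> (\<forall>t. (\<Gamma> has_real_derivative gpow t \<delta>) (at t)) \<and> poly_growth \<Gamma>"
    unfolding \<Gamma>_def by (rule someI_ex[OF poly_growth_antiderivative[OF gpow_growth]])
  then show "\<Gamma> 0 = 0" "(\<Gamma> has_real_derivative gpow t \<delta>) (at t)" "poly_growth \<Gamma>" by blast+
qed

text \<open>The gradients are separate arguments, so that the same form serves classical partial
  derivatives of test functions and weak derivatives of elements of \<open>H10\<close>.\<close>

definition form :: "(real^2 \<Rightarrow> real) \<Rightarrow> (2 \<Rightarrow> real^2 \<Rightarrow> real) \<Rightarrow> (real^2 \<Rightarrow> real) \<Rightarrow> (2 \<Rightarrow> real^2 \<Rightarrow> real) \<Rightarrow> real" where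
  "form u g v dv = \<nu> * (\<Sum>i\<in>UNIV. \<integral>x. g i x * dv i x \<partial>\<mu>)
    + \<alpha> * (\<integral>x. (\<Sum>i\<in>UNIV. g i x) * (gpow (u x) \<delta> * v x) \<partial>\<mu>) - \<beta> * (\<integral>x. R (u x) * v x \<partial>\<mu>)"

abbreviation D :: "(real^2 \<Rightarrow> real) \<Rightarrow> 2 \<Rightarrow> real^2 \<Rightarrow> real" where "D u \<equiv> \<lambda>i. partial_deriv i u"

text \<open>All derivatives are moved to the test function; \<open>\<Gamma>\<close> is the antiderivative of the convection nonlinearity.\<close>

definition weak_form :: "(real^2 \<Rightarrow> real) \<Rightarrow> (real^2 \<Rightarrow> real) \<Rightarrow> real" where
  "weak_form u w = \<nu> * (\<Sum>i\<in>UNIV. - (\<integral>x. u x * D (D w i) i x \<partial>\<mu>))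
    + \<alpha> * (\<Sum>i\<in>UNIV. - (\<integral>x. \<Gamma> (u x) * D w i x \<partial>\<mu>)) - \<beta> * (\<integral>x. R (u x) * w x \<partial>\<mu>)"

text \<open>By the chain rule the convection integrand is a derivative of \<Gamma>(y), and
  integration by parts is applied to it and to the diffusion term. The test function must be smooth
  because its second derivatives appear, while for \<open>y\<close> the C1 class is enough.\<close>

lemma form_eq_weak_form:
  assumes y: "y \<in> C1c \<Omega>" and w: "w \<in> test_functions \<Omega>"
  shows "form y (D y) w (D w) = weak_form y w"
proof -
  note wc = test_functionsD[OF w] and Dc = test_functionsD[OF test_functions_partial_deriv[OF w]]
  have cont: "continuous_on UNIV (\<lambda>t. gpow t \<delta>)" using gpow_growth by (simp add: poly_growth_def)
  note \<Gamma>c = C1c_chain[OF y \<Gamma>(2) cont \<Gamma>(1)]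
  have diff: "(\<integral>x. D y i x * D w i x \<partial>\<mu>) = - (\<integral>x. y x * D (D w i) i x \<partial>\<mu>)" for i
    using integration_by_parts[OF y Dc, of i i] by simp
  have s: "sq_integrable \<mu> (\<lambda>x. gpow (y x) \<delta> * w x)"
    by (rule sq_integrable_mult_bounded[OF poly_growth_C1c_sq_integrable[OF gpow_growth y] wc])
  have "(\<integral>x. (\<Sum>i\<in>UNIV. D y i x) * (gpow (y x) \<delta> * w x) \<partial>\<mu>)
      = (\<Sum>i\<in>UNIV. \<integral>x. D y i x * (gpow (y x) \<delta> * w x) \<partial>\<mu>)"
    unfolding sum_distrib_right
    by (rule Bochner_Integration.integral_sum) (rule sq_integrable_mult[OF C1c_partial_sq_integrable[OF y] s])
  also have "\<dots> = (\<Sum>i\<in>UNIV. - (\<integral>x. \<Gamma> (y x) * D w i x \<partial>\<mu>))"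
  proof (rule sum.cong)
    fix i :: 2
    have "(\<integral>x. D y i x * (gpow (y x) \<delta> * w x) \<partial>\<mu>) = (\<integral>x. partial_deriv i (\<lambda>x. \<Gamma> (y x)) x * w x \<partial>\<mu>)"
      unfolding \<Gamma>c(2) by (simp only: mult_ac)
    also have "\<dots> = - (\<integral>x. \<Gamma> (y x) * D w i x \<partial>\<mu>)"
      using integration_by_parts[OF \<Gamma>c(1) wc, of i] by simp
    finally show "(\<integral>x. D y i x * (gpow (y x) \<delta> * w x) \<partial>\<mu>) = - (\<integral>x. \<Gamma> (y x) * D w i x \<partial>\<mu>)" .
  qed simp
  finally show ?thesis unfolding form_def weak_form_def diff by simp
qed

text \<open>Requires strongly convergent gradients. It serves the continuity of the
  finite-dimensional Galerkin field and the limit along the energy-minimizing midpoints.\<close>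

lemma form_tendsto:
  assumes y: "\<And>n. y n \<in> C1c \<Omega>" and lim: "AE x in \<mu>. (\<lambda>n. y n x) \<longlonglongrightarrow> u x" and u: "u \<in> borel_measurable \<mu>"
    and g: "\<And>i. sq_integrable \<mu> (g i)" and limg: "\<And>i. (\<lambda>n. l2norm \<mu> (\<lambda>x. D (y n) i x - g i x)) \<longlonglongrightarrow> 0"
    and w: "w \<in> C1c \<Omega>"
  shows "(\<lambda>n. form (y n) (D (y n)) w (D w)) \<longlonglongrightarrow> form u g w (D w)"
proof -
  obtain M where M: "\<And>n. energy (y n) \<le> M" using energy_bounded_of_convergent[OF y g limg] by blast
  note ws = C1c_sq_integrable[OF w] and wps = C1c_partial_sq_integrable[OF w] and yps = C1c_partial_sq_integrable[OF y]
  have zero: "(\<lambda>n::nat. l2norm \<mu> (\<lambda>x. h x - h x)) \<longlonglongrightarrow> 0" for h :: "real^2 \<Rightarrow> real" by (simp add: l2norm_def)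
  note lims = poly_growth_limit_sq_integrable[OF _ y M lim u] and limt = poly_growth_limit_tendsto[OF _ y M lim u]
  have 1: "(\<lambda>n. \<integral>x. D (y n) i x * D w i x \<partial>\<mu>) \<longlonglongrightarrow> (\<integral>x. g i x * D w i x \<partial>\<mu>)" for i
    by (rule integral_mult_tendsto[OF yps g wps wps limg zero])
  have 3: "(\<lambda>n. \<integral>x. R (y n x) * w x \<partial>\<mu>) \<longlonglongrightarrow> (\<integral>x. R (u x) * w x \<partial>\<mu>)"
    by (rule integral_mult_tendsto[OF poly_growth_C1c_sq_integrable[OF reaction_growth y] lims[OF reaction_growth] ws ws limt[OF reaction_growth] zero])
  obtain B where B: "\<And>x. \<bar>w x\<bar> \<le> B" using C1c_bounded[OF w] by blast
  have Glim: "(\<lambda>n. l2norm \<mu> (\<lambda>x. gpow (y n x) \<delta> * w x - gpow (u x) \<delta> * w x)) \<longlonglongrightarrow> 0"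
  proof (rule nonneg_tendsto_0)
    show "l2norm \<mu> (\<lambda>x. gpow (y n x) \<delta> * w x - gpow (u x) \<delta> * w x) \<le> B * l2norm \<mu> (\<lambda>x. gpow (y n x) \<delta> - gpow (u x) \<delta>)" for n
      using l2norm_mult_bounded[OF sq_integrable_diff[OF poly_growth_C1c_sq_integrable[OF gpow_growth y[of n]] lims[OF gpow_growth]] w B]
      by (simp only: left_diff_distrib)
    show "(\<lambda>n. B * l2norm \<mu> (\<lambda>x. gpow (y n x) \<delta> - gpow (u x) \<delta>)) \<longlonglongrightarrow> 0"
      using tendsto_mult[OF tendsto_const[of B] limt[OF gpow_growth]] by simp
  qed simp
  have Dlim: "(\<lambda>n. l2norm \<mu> (\<lambda>x. (\<Sum>i\<in>UNIV. D (y n) i x) - (\<Sum>i\<in>UNIV. g i x))) \<longlonglongrightarrow> 0"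
  proof (rule nonneg_tendsto_0)
    show "l2norm \<mu> (\<lambda>x. (\<Sum>i\<in>UNIV. D (y n) i x) - (\<Sum>i\<in>UNIV. g i x))
        \<le> l2norm \<mu> (\<lambda>x. D (y n) 1 x - g 1 x) + l2norm \<mu> (\<lambda>x. D (y n) 2 x - g 2 x)" for n
    proof -
      have "(\<lambda>x. (\<Sum>i\<in>UNIV. D (y n) i x) - (\<Sum>i\<in>UNIV. g i x)) = (\<lambda>x. (D (y n) 1 x - g 1 x) + (D (y n) 2 x - g 2 x))"
        by (auto simp: sum_2)
      then show ?thesis
        using l2norm_triangle[OF sq_integrable_diff[OF yps[of 1 n] g[of 1]] sq_integrable_diff[OF yps[of 2 n] g[of 2]]] by simp
    qed
    show "(\<lambda>n. l2norm \<mu> (\<lambda>x. D (y n) 1 x - g 1 x) + l2norm \<mu> (\<lambda>x. D (y n) 2 x - g 2 x)) \<longlonglongrightarrow> 0"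
      using tendsto_add[OF limg[of 1] limg[of 2]] by simp
  qed simp
  have 2: "(\<lambda>n. \<integral>x. (\<Sum>i\<in>UNIV. D (y n) i x) * (gpow (y n x) \<delta> * w x) \<partial>\<mu>)
      \<longlonglongrightarrow> (\<integral>x. (\<Sum>i\<in>UNIV. g i x) * (gpow (u x) \<delta> * w x) \<partial>\<mu>)"
    by (rule integral_mult_tendsto[OF sq_integrable_sum[OF yps] sq_integrable_sum[OF g]
        sq_integrable_mult_bounded[OF poly_growth_C1c_sq_integrable[OF gpow_growth y] w]
        sq_integrable_mult_bounded[OF lims[OF gpow_growth] w] Dlim Glim])
  show ?thesis
    unfolding form_def by (intro tendsto_diff tendsto_add tendsto_mult tendsto_const tendsto_sum 1 2 3)
qed

text \<open>No convergence of gradients is required, only an energy bound; this is the limit that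
  the Galerkin solutions admit.\<close>

lemma weak_form_tendsto:
  assumes y: "\<And>n. y n \<in> C1c \<Omega>" "\<And>n. energy (y n) \<le> M" and lim: "AE x in \<mu>. (\<lambda>n. y n x) \<longlonglongrightarrow> u x"
    and u: "u \<in> borel_measurable \<mu>" and w: "w \<in> test_functions \<Omega>"
  shows "(\<lambda>n. weak_form (y n) w) \<longlonglongrightarrow> weak_form u w"
proof -
  have lim: "(\<lambda>n. \<integral>x. \<Phi> (y n x) * h x \<partial>\<mu>) \<longlonglongrightarrow> (\<integral>x. \<Phi> (u x) * h x \<partial>\<mu>)"
    if \<Phi>: "poly_growth \<Phi>" and h: "h \<in> test_functions \<Omega>" for \<Phi> h
  proof -
    have zero: "(\<lambda>n::nat. l2norm \<mu> (\<lambda>x. h x - h x)) \<longlonglongrightarrow> 0" by (simp add: l2norm_def)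
    note hs = C1c_sq_integrable[OF test_functionsD[OF h]]
    show ?thesis
      by (rule integral_mult_tendsto[OF poly_growth_C1c_sq_integrable[OF \<Phi> y(1)]
          poly_growth_limit_sq_integrable[OF \<Phi> y lim u] hs hs poly_growth_limit_tendsto[OF \<Phi> y lim u] zero])
  qed
  note wd = test_functions_partial_deriv[OF w]
  show ?thesis
    unfolding weak_form_def
    by (intro tendsto_diff tendsto_add tendsto_mult tendsto_const tendsto_sum tendsto_minus
        lim[OF poly_growth_ident test_functions_partial_deriv[OF wd]] lim[OF \<Gamma>(3) wd] lim[OF reaction_growth w])
qed

lemma form_coercive:
  assumes u: "u \<in> C1c \<Omega>"
  shows "form u (D u) u (D u) \<ge> \<nu> * energy u - \<beta> * area"
proof -
  have pg: "poly_growth (\<lambda>s. gpow s \<delta> * s)" by (intro poly_growth_mult gpow_growth poly_growth_ident)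
  \<comment> \<open>The convection integrand tested with u is the sum of the partial derivatives of
    H(u), a compactly supported C1 function, so its integral vanishes.\<close>
  obtain H where H: "H 0 = 0" "\<And>t. (H has_real_derivative gpow t \<delta> * t) (at t)"
    using poly_growth_antiderivative[OF pg] by blast
  have cont: "continuous_on UNIV (\<lambda>t. gpow t \<delta> * t)" using pg by (simp add: poly_growth_def)
  note Hc = C1c_chain[OF u H(2) cont H(1)]
  have "(\<integral>x. (\<Sum>i\<in>UNIV. D u i x) * (gpow (u x) \<delta> * u x) \<partial>\<mu>)
      = (\<Sum>i\<in>UNIV. \<integral>x. D u i x * (gpow (u x) \<delta> * u x) \<partial>\<mu>)"
    unfolding sum_distrib_right
    by (rule Bochner_Integration.integral_sum)
      (rule sq_integrable_mult[OF C1c_partial_sq_integrable[OF u] poly_growth_C1c_sq_integrable[OF pg u]])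
  also have "\<dots> = 0"
  proof (rule sum.neutral, rule ballI)
    fix i :: 2
    have "(\<integral>x. D u i x * (gpow (u x) \<delta> * u x) \<partial>\<mu>) = (\<integral>x. partial_deriv i (\<lambda>x. H (u x)) x \<partial>\<mu>)"
      unfolding Hc(2) by (simp only: mult_ac)
    then show "(\<integral>x. D u i x * (gpow (u x) \<delta> * u x) \<partial>\<mu>) = 0"
      using integral_partial_deriv_eq_0[OF Hc(1)] by simp
  qed
  finally have conv: "(\<integral>x. (\<Sum>i\<in>UNIV. D u i x) * (gpow (u x) \<delta> * u x) \<partial>\<mu>) = 0" .
  have "(\<integral>x. R (u x) * u x \<partial>\<mu>) \<le> (\<integral>x. 1 \<partial>\<mu>)"
    by (intro integral_mono sq_integrable_mult poly_growth_C1c_sq_integrable[OF reaction_growth u] C1c_sq_integrable[OF u]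
        reaction_mult_le \<delta> \<gamma>) simp
  then have "(\<integral>x. R (u x) * u x \<partial>\<mu>) \<le> area" by simp
  then have "\<beta> * (\<integral>x. R (u x) * u x \<partial>\<mu>) \<le> \<beta> * area" using \<beta> by (intro mult_left_mono) auto
  moreover have "(\<Sum>i\<in>UNIV. \<integral>x. D u i x * D u i x \<partial>\<mu>) = energy u"
    unfolding energy_def l2norm_sq by (simp add: power2_eq_square)
  ultimately show ?thesis unfolding form_def conv by simp
qed

lemma integral_mult_sum:
  assumes "sq_integrable \<mu> h" "\<And>j. j \<in> J \<Longrightarrow> sq_integrable \<mu> (w j)"
  shows "(\<integral>x. h x * (\<Sum>j\<in>J. c j * w j x) \<partial>\<mu>) = (\<Sum>j\<in>J. c j * (\<integral>x. h x * w j x \<partial>\<mu>))"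
proof -
  have "(\<integral>x. h x * (\<Sum>j\<in>J. c j * w j x) \<partial>\<mu>) = (\<integral>x. (\<Sum>j\<in>J. c j * (h x * w j x)) \<partial>\<mu>)"
    by (intro arg_cong[of _ _ "lebesgue_integral \<mu>"] ext) (simp add: sum_distrib_left mult_ac)
  also have "\<dots> = (\<Sum>j\<in>J. c j * (\<integral>x. h x * w j x \<partial>\<mu>))"
    using sq_integrable_mult[OF assms(1,2)] by (subst Bochner_Integration.integral_sum) auto
  finally show ?thesis .
qed

lemma form_sum:
  assumes u: "u \<in> C1c \<Omega>" and w: "\<And>j. w j \<in> C1c \<Omega>"
  shows "form u (D u) (\<lambda>x. \<Sum>j\<in>J. c j * w j x) (D (\<lambda>x. \<Sum>j\<in>J. c j * w j x)) = (\<Sum>j\<in>J. c j * form u (D u) (w j) (D (w j)))"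
proof -
  define a where "a j i = (\<integral>x. D u i x * D (w j) i x \<partial>\<mu>)" for i j
  define b where "b j = (\<integral>x. (\<Sum>i\<in>UNIV. D u i x) * (gpow (u x) \<delta> * w j x) \<partial>\<mu>)" for j
  define d where "d j = (\<integral>x. R (u x) * w j x \<partial>\<mu>)" for j
  note us = C1c_partial_sq_integrable[OF u]
  have 1: "(\<integral>x. D u i x * D (\<lambda>x. \<Sum>j\<in>J. c j * w j x) i x \<partial>\<mu>) = (\<Sum>j\<in>J. c j * a j i)" for i
    unfolding a_def C1c_partial_sum[OF w]
    by (rule integral_mult_sum[OF us C1c_partial_sq_integrable[OF w]])
  have 2: "(\<integral>x. (\<Sum>i\<in>UNIV. D u i x) * (gpow (u x) \<delta> * (\<Sum>j\<in>J. c j * w j x)) \<partial>\<mu>) = (\<Sum>j\<in>J. c j * b j)"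
  proof -
    have eq: "gpow (u x) \<delta> * (\<Sum>j\<in>J. c j * w j x) = (\<Sum>j\<in>J. c j * (gpow (u x) \<delta> * w j x))" for x
      by (simp add: sum_distrib_left mult_ac)
    show ?thesis
      unfolding eq b_def
      by (rule integral_mult_sum[OF sq_integrable_sum[OF us]
          sq_integrable_mult_bounded[OF poly_growth_C1c_sq_integrable[OF gpow_growth u] w]])
  qed
  have 3: "(\<integral>x. R (u x) * (\<Sum>j\<in>J. c j * w j x) \<partial>\<mu>) = (\<Sum>j\<in>J. c j * d j)"
    unfolding d_def by (rule integral_mult_sum[OF poly_growth_C1c_sq_integrable[OF reaction_growth u] C1c_sq_integrable[OF w]])
  have "(\<Sum>i\<in>UNIV. \<Sum>j\<in>J. c j * a j i) = (\<Sum>j\<in>J. c j * (\<Sum>i\<in>UNIV. a j i))"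
    unfolding sum_distrib_left by (rule sum.swap)
  then have "form u (D u) (\<lambda>x. \<Sum>j\<in>J. c j * w j x) (D (\<lambda>x. \<Sum>j\<in>J. c j * w j x))
      = \<nu> * (\<Sum>j\<in>J. c j * (\<Sum>i\<in>UNIV. a j i)) + \<alpha> * (\<Sum>j\<in>J. c j * b j) - \<beta> * (\<Sum>j\<in>J. c j * d j)"
    unfolding form_def 1 2 3 by simp
  also have "\<dots> = (\<Sum>j\<in>J. c j * (\<nu> * (\<Sum>i\<in>UNIV. a j i) + \<alpha> * b j - \<beta> * d j))"
    by (simp add: sum_distrib_left sum.distrib sum_subtractf algebra_simps)
  finally show ?thesis unfolding form_def a_def b_def d_def .
qed

section \<open>The functional on the right-hand side\<close>

lemma f_linear: "u \<in> H10 \<Omega> \<Longrightarrow> v \<in> H10 \<Omega> \<Longrightarrow> f (\<lambda>x. a * u x + b * v x) = a * f u + b * f v"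
  using f unfolding H_minus1_def by blast

lemma f_sum:
  fixes n :: nat
  assumes w: "\<And>j. w j \<in> test_functions \<Omega>"
  shows "f (\<lambda>x. \<Sum>j<n. c j * w j x) = (\<Sum>j<n. c j * f (w j))"
proof (induction n)
  case 0
  \<comment> \<open>That the functional vanishes on the zero function follows from linearity with
    both coefficients 0.\<close>
  show ?case using f_linear[OF test_functions_H10[OF w[of 0]] test_functions_H10[OF w[of 0]], of 0 0] by simp
next
  case (Suc n)
  have "(\<lambda>x. \<Sum>j<n. c j * w j x) \<in> test_functions \<Omega>" by (rule test_functions_sum[OF w])
  from f_linear[OF test_functions_H10[OF this] test_functions_H10[OF w[of n]], of 1 "c n"] Suc
  show ?case by simp
qed

lemma f_bound: "\<exists>C\<ge>0. \<forall>u\<in>H10 \<Omega>. \<bar>f u\<bar> \<le> C * H1_norm \<Omega> u"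
proof -
  obtain C where C: "\<And>u. u \<in> H10 \<Omega> \<Longrightarrow> \<bar>f u\<bar> \<le> C * H1_norm \<Omega> u"
    using f unfolding H_minus1_def by blast
  have "\<bar>f u\<bar> \<le> \<bar>C\<bar> * H1_norm \<Omega> u" if "u \<in> H10 \<Omega>" for u
    using C[OF that] mult_right_mono[OF abs_ge_self[of C] H1_norm_nonneg[of u]] by linarith
  then show ?thesis by (intro exI[of _ "\<bar>C\<bar>"]) auto
qed

text \<open>For test functions the Poincare inequality controls the full H1 norm by the energy, at
  the cost of the factor \<open>sqrt (area + 1)\<close>. Coercivity can then absorb the
  functional.\<close>

lemma f_energy_bound: "\<exists>C\<ge>0. \<forall>\<phi>\<in>test_functions \<Omega>. \<bar>f \<phi>\<bar> \<le> C * sqrt (energy \<phi>)"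
proof -
  obtain C where C: "C \<ge> 0" "\<And>u. u \<in> H10 \<Omega> \<Longrightarrow> \<bar>f u\<bar> \<le> C * H1_norm \<Omega> u" using f_bound by blast
  have "\<bar>f \<phi>\<bar> \<le> C * sqrt (area + 1) * sqrt (energy \<phi>)" if \<phi>: "\<phi> \<in> test_functions \<Omega>" for \<phi>
  proof -
    note c = test_functionsD[OF \<phi>]
    have "l2norm \<mu> (weak_deriv \<Omega> i \<phi>) = l2norm \<mu> (partial_deriv i \<phi>)" for i
      by (rule l2norm_cong_AE[OF C1c_H1(2)[OF c]
          sq_integrable_measurable[OF H1_weak_deriv(1)[OF C1c_H1(1)[OF c]]]
          sq_integrable_measurable[OF C1c_partial_sq_integrable[OF c]]])
    then have "H1_norm \<Omega> \<phi> = sqrt ((l2norm \<mu> \<phi>)\<^sup>2 + energy \<phi>)"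
      unfolding H1_norm_eq energy_def by simp
    also have "\<dots> \<le> sqrt ((area + 1) * energy \<phi>)"
      using Poincare[OF c] by (simp add: distrib_right)
    finally have "C * H1_norm \<Omega> \<phi> \<le> C * (sqrt (area + 1) * sqrt (energy \<phi>))"
      using C(1) by (intro mult_left_mono) (simp_all add: real_sqrt_mult)
    then show ?thesis using C(2)[OF test_functions_H10[OF \<phi>]] by (simp add: mult.assoc)
  qed
  then show ?thesis using C(1) by (intro exI[of _ "C * sqrt (area + 1)"]) auto
qed

lemma l2norm_sum_le:
  fixes n :: nat
  assumes "\<And>j. sq_integrable \<mu> (h j)"
  shows "l2norm \<mu> (\<lambda>x. \<Sum>j<n. c j * h j x) \<le> (\<Sum>j<n. \<bar>c j\<bar> * l2norm \<mu> (h j))"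
proof (induction n)
  case 0 then show ?case by (simp add: l2norm_def)
next
  case (Suc n)
  have "l2norm \<mu> (\<lambda>x. (\<Sum>j<n. c j * h j x) + c n * h n x)
      \<le> l2norm \<mu> (\<lambda>x. \<Sum>j<n. c j * h j x) + l2norm \<mu> (\<lambda>x. c n * h n x)"
    by (rule l2norm_triangle[OF sq_integrable_sum[OF sq_integrable_cmult[OF assms]] sq_integrable_cmult[OF assms]])
  then show ?case using Suc by (simp add: l2norm_cmult)
qed

end

section \<open>Galerkin solutions and the passage to the limit\<close>

context elliptic_problem
begin

text \<open>
  The term \<open>c j / (n + 1)\<close> makes the field outward on a large sphere even when the \<open>w j\<close> are
  linearly dependent, and it vanishes in the limit.
\<close>

lemma Galerkin:
  "\<exists>K\<ge>0. \<forall>w n. (\<forall>j. w j \<in> test_functions \<Omega>) \<longrightarrow> (\<exists>u\<in>test_functions \<Omega>. energy u \<le> K \<and>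
    (\<forall>j<n. \<bar>form u (D u) (w j) (D (w j)) - f (w j)\<bar> \<le> sqrt (K / real (Suc n))))"
proof -
  obtain C where C: "C \<ge> 0" "\<And>\<phi>. \<phi> \<in> test_functions \<Omega> \<Longrightarrow> \<bar>f \<phi>\<bar> \<le> C * sqrt (energy \<phi>)"
    using f_energy_bound by blast
  \<comment> \<open>\<open>\<beta> * area\<close> is the loss in coercivity,
    \<open>C\<^sup>2 / (2 * \<nu>)\<close> comes from Young's inequality for the functional, and 1
    makes the radius of the sphere positive.\<close>
  define K0 where "K0 = \<beta> * area + C\<^sup>2 / (2 * \<nu>) + 1"
  have K0: "K0 > 0" unfolding K0_def using \<beta> \<nu> by (intro add_nonneg_pos add_nonneg_nonneg) auto
  \<comment> \<open>\<open>2 * K0 / \<nu>\<close> bounds the energy and K0 enters the bound on the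
    coefficients. One constant serves both and depends neither on the family \<open>w\<close> nor on
    n.\<close>
  define K where "K = max K0 (2 * K0 / \<nu>)"
  have K: "K \<ge> 0" "K0 \<le> K" "2 * K0 / \<nu> \<le> K" using K0 by (auto simp: K_def)
  have "\<exists>u\<in>test_functions \<Omega>. energy u \<le> K \<and>
      (\<forall>j<n. \<bar>form u (D u) (w j) (D (w j)) - f (w j)\<bar> \<le> sqrt (K / real (Suc n)))"
    if w: "\<And>j. w j \<in> test_functions \<Omega>" for w and n :: nat
  proof -
    note wc = test_functionsD[OF w]
    define U where "U c = (\<lambda>x. \<Sum>i<n. c i * w i x)" for c :: "nat \<Rightarrow> real"
    define F where "F c j = form (U c) (D (U c)) (w j) (D (w j)) - f (w j) + c j / real (Suc n)" for c j
    have Ut: "U c \<in> test_functions \<Omega>" for c unfolding U_def by (rule test_functions_sum[OF w])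
    note Uc = test_functionsD[OF Ut]
    have DU: "D (U c) i = (\<lambda>x. \<Sum>j<n. c j * D (w j) i x)" for c i
      unfolding U_def by (rule C1c_partial_sum[OF wc])
    have key: "(\<Sum>i<n. F c i * c i) \<ge> \<nu> / 2 * energy (U c) - K0 + (\<Sum>i<n. (c i)\<^sup>2) / real (Suc n)" for c
    proof -
      have "(\<Sum>i<n. F c i * c i) = (\<Sum>i<n. c i * form (U c) (D (U c)) (w i) (D (w i))) - (\<Sum>i<n. c i * f (w i))
          + (\<Sum>i<n. (c i)\<^sup>2) / real (Suc n)"
        unfolding sum_divide_distrib sum_subtractf[symmetric] sum.distrib[symmetric]
        by (intro sum.cong) (simp_all add: F_def algebra_simps power2_eq_square del: of_nat_Suc)
      also have "(\<Sum>i<n. c i * form (U c) (D (U c)) (w i) (D (w i))) = form (U c) (D (U c)) (U c) (D (U c))"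
        using form_sum[where w=w and J="{..<n}" and c=c, OF Uc[of c] wc] unfolding U_def[of c, symmetric] by simp
      also have "(\<Sum>i<n. c i * f (w i)) = f (U c)" unfolding U_def by (rule f_sum[OF w, symmetric])
      finally have eq: "(\<Sum>i<n. F c i * c i) = form (U c) (D (U c)) (U c) (D (U c)) - f (U c) + (\<Sum>i<n. (c i)\<^sup>2) / real (Suc n)" .
      have "f (U c) \<le> C * sqrt (energy (U c))" using C(2)[OF Ut[of c]] by linarith
      also have "\<dots> \<le> \<nu> / 2 * energy (U c) + C\<^sup>2 / (2 * \<nu>)"
      proof -
        \<comment> \<open>Young's inequality, weighted so that half of the coercive term
          remains.\<close>
        have "0 \<le> (\<nu> * sqrt (energy (U c)) - C)\<^sup>2" by simp
        also have "\<dots> = \<nu>\<^sup>2 * energy (U c) - 2 * \<nu> * C * sqrt (energy (U c)) + C\<^sup>2"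
          using energy_nonneg[of "U c"] by (simp add: power2_diff power_mult_distrib)
        finally have "2 * \<nu> * (C * sqrt (energy (U c))) \<le> \<nu>\<^sup>2 * energy (U c) + C\<^sup>2"
          by (simp add: mult.assoc)
        also have "\<dots> = 2 * \<nu> * (\<nu> / 2 * energy (U c) + C\<^sup>2 / (2 * \<nu>))"
          using \<nu> by (simp add: field_simps power2_eq_square)
        finally have "2 * \<nu> * (C * sqrt (energy (U c))) \<le> 2 * \<nu> * (\<nu> / 2 * energy (U c) + C\<^sup>2 / (2 * \<nu>))" .
        then show ?thesis using \<nu> by (simp only: mult_le_cancel_left_pos mult_pos_pos zero_less_numeral)
      qed
      finally have "f (U c) \<le> \<nu> / 2 * energy (U c) + C\<^sup>2 / (2 * \<nu>)" .
      then have fU: "f (U c) \<le> \<nu> * energy (U c) / 2 + C\<^sup>2 / (2 * \<nu>)" by simp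
      have "e / 2 - (b + q + 1) + z \<le> fo - fu + z" if "e - b \<le> fo" "fu \<le> e / 2 + q" for e b q z fo fu :: real
        using that by linarith
      from this[OF form_coercive[OF Uc[of c]] fU] show ?thesis unfolding eq K0_def by simp
    qed
    have cont: "(\<lambda>k. F (c k) j) \<longlonglongrightarrow> F l j"
      if c: "\<And>i. i < n \<Longrightarrow> (\<lambda>k::nat. c k i) \<longlonglongrightarrow> l i" and j: "j < n" for c l j
    proof -
      have "(\<lambda>k. form (U (c k)) (D (U (c k))) (w j) (D (w j))) \<longlonglongrightarrow> form (U l) (D (U l)) (w j) (D (w j))"
      proof (rule form_tendsto)
        show "U (c k) \<in> C1c \<Omega>" for k by (rule Uc)
        show "AE x in \<mu>. (\<lambda>k. U (c k) x) \<longlonglongrightarrow> U l x"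
          unfolding U_def by (intro AE_I2 tendsto_sum tendsto_mult tendsto_const c) simp
        show "U l \<in> borel_measurable \<mu>" by (rule sq_integrable_measurable[OF C1c_sq_integrable[OF Uc]])
        show "sq_integrable \<mu> (D (U l) i)" for i by (rule C1c_partial_sq_integrable[OF Uc])
        show "(\<lambda>k. l2norm \<mu> (\<lambda>x. D (U (c k)) i x - D (U l) i x)) \<longlonglongrightarrow> 0" for i
        proof (rule nonneg_tendsto_0)
          show "l2norm \<mu> (\<lambda>x. D (U (c k)) i x - D (U l) i x) \<le> (\<Sum>m<n. \<bar>c k m - l m\<bar> * l2norm \<mu> (D (w m) i))" for k
          proof -
            have "(\<lambda>x. D (U (c k)) i x - D (U l) i x) = (\<lambda>x. \<Sum>m<n. (c k m - l m) * D (w m) i x)"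
              unfolding DU by (simp add: sum_subtractf left_diff_distrib)
            then show ?thesis
              using l2norm_sum_le[where h="\<lambda>m. D (w m) i" and n=n and c="\<lambda>m. c k m - l m", OF C1c_partial_sq_integrable[OF wc]] by simp
          qed
          have "(\<lambda>k. \<Sum>m<n. \<bar>c k m - l m\<bar> * l2norm \<mu> (D (w m) i)) \<longlonglongrightarrow> (\<Sum>m<n. \<bar>l m - l m\<bar> * l2norm \<mu> (D (w m) i))"
            by (intro tendsto_sum tendsto_mult tendsto_const tendsto_rabs tendsto_diff c) simp
          then show "(\<lambda>k. \<Sum>m<n. \<bar>c k m - l m\<bar> * l2norm \<mu> (D (w m) i)) \<longlonglongrightarrow> 0" by simp
        qed simp
      qed (rule wc)
      then show ?thesis
        unfolding F_def by (intro tendsto_add tendsto_diff tendsto_const tendsto_divide c j) simp_all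
    qed
    \<comment> \<open>On the sphere of this radius the added term contributes exactly K0 and cancels
      the negative constant in \<open>key\<close>.\<close>
    define \<rho> where "\<rho> = sqrt (real (Suc n) * K0)"
    have \<rho>: "\<rho> > 0" "\<rho>\<^sup>2 = real (Suc n) * K0" using K0 by (auto simp: \<rho>_def)
    have outward: "(\<Sum>i<n. F c i * c i) \<ge> 0" if "(\<Sum>i<n. (c i)\<^sup>2) = \<rho>\<^sup>2" for c
    proof -
      have "(\<Sum>i<n. (c i)\<^sup>2) / real (Suc n) = K0" unfolding that \<rho>(2) by simp
      moreover have "\<nu> / 2 * energy (U c) \<ge> 0" using \<nu> energy_nonneg by simp
      ultimately show ?thesis using key[of c] by linarith
    qed
    obtain c where c: "(\<Sum>i<n. (c i)\<^sup>2) \<le> \<rho>\<^sup>2" "\<And>i. i < n \<Longrightarrow> F c i = 0"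
      using zero_of_outward_field[of n F \<rho>, OF cont \<rho>(1) outward] by blast
    have "energy (U c) \<le> K"
    proof -
      have "(\<Sum>i<n. F c i * c i) = 0" using c(2) by simp
      moreover have "(\<Sum>i<n. (c i)\<^sup>2) / real (Suc n) \<ge> 0" by (intro divide_nonneg_nonneg sum_nonneg) auto
      ultimately have "\<nu> / 2 * energy (U c) \<le> K0" using key[of c] by linarith
      then have "energy (U c) \<le> 2 * K0 / \<nu>" using \<nu> by (simp add: field_simps)
      then show ?thesis using K(3) by linarith
    qed
    moreover have "\<bar>form (U c) (D (U c)) (w j) (D (w j)) - f (w j)\<bar> \<le> sqrt (K / real (Suc n))" if j: "j < n" for j
    proof -
      have "form (U c) (D (U c)) (w j) (D (w j)) - f (w j) = - (c j / real (Suc n))"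
        using c(2)[OF j] unfolding F_def by linarith
      moreover have "\<bar>c j / real (Suc n)\<bar> \<le> sqrt (K / real (Suc n))"
      proof (rule real_le_rsqrt)
        have "(c j)\<^sup>2 \<le> (\<Sum>i<n. (c i)\<^sup>2)" using j by (intro member_le_sum) auto
        also have "\<dots> \<le> real (Suc n) * K" using c(1) mult_left_mono[OF K(2) of_nat_0_le_iff[of "Suc n"]] unfolding \<rho>(2) by (rule order_trans)
        finally have "(c j)\<^sup>2 / (real (Suc n))\<^sup>2 \<le> real (Suc n) * K / (real (Suc n))\<^sup>2"
          by (rule divide_right_mono) simp
        then show "\<bar>c j / real (Suc n)\<bar>\<^sup>2 \<le> K / real (Suc n)"
          by (simp add: power_divide power2_eq_square del: of_nat_Suc)
      qed
      ultimately show ?thesis by simp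
    qed
    ultimately show ?thesis using Ut by blast
  qed
  then show ?thesis using K(1) by blast
qed

text \<open>Two sequences share the limit \<open>v\<close>. The Galerkin solutions satisfy the
  equation asymptotically, but only their weak form can be passed to the limit. The
  energy-minimizing midpoints solve no equation, but their gradients converge strongly, so that both
  forms pass to the limit and must agree at \<open>v\<close>.\<close>

lemma exists_solution_on_dense_family:
  assumes w: "\<And>j::nat. w j \<in> test_functions \<Omega>"
  shows "\<exists>u\<in>H10 \<Omega>. \<forall>j. form u (\<lambda>i. weak_deriv \<Omega> i u) (w j) (D (w j)) = f (w j)"
proof -
  obtain K where K: "\<And>n. \<exists>u\<in>test_functions \<Omega>. energy u \<le> K \<and>
    (\<forall>j<n. \<bar>form u (D u) (w j) (D (w j)) - f (w j)\<bar> \<le> sqrt (K / real (Suc n)))"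
    using Galerkin w by blast
  obtain U where U: "\<And>n. U n \<in> test_functions \<Omega>" "\<And>n. energy (U n) \<le> K"
    "\<And>n j. j < n \<Longrightarrow> \<bar>form (U n) (D (U n)) (w j) (D (w j)) - f (w j)\<bar> \<le> sqrt (K / real (Suc n))"
    using K by metis
  obtain r v where rv: "strict_mono (r::nat\<Rightarrow>nat)" "sq_integrable \<mu> v" "(\<lambda>n. l2norm \<mu> (\<lambda>x. U (r n) x - v x)) \<longlonglongrightarrow> 0"
    using Rellich[of U K, OF test_functionsD[OF U(1)] U(2)] by blast
  have "sq_integrable \<mu> (\<lambda>x. U (r n) x - v x)" for n
    by (rule sq_integrable_diff[OF C1c_sq_integrable[OF test_functionsD[OF U(1)]] rv(2)])
  from l2norm_tendsto_0_AE_subseq[OF this rv(3)]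
  obtain s :: "nat \<Rightarrow> nat" where s: "strict_mono s" "AE x in \<mu>. (\<lambda>n. U (r (s n)) x - v x) \<longlonglongrightarrow> 0" by blast
  define t where "t = r \<circ> s"
  have t: "strict_mono t" unfolding t_def by (rule strict_mono_o[OF rv(1) s(1)])
  have tlim: "AE x in \<mu>. (\<lambda>n. U (t n) x) \<longlonglongrightarrow> v x" using s(2) by eventually_elim (simp add: LIM_zero_iff t_def)
  note vm = sq_integrable_measurable[OF rv(2)]
  obtain y where y: "\<And>n. y n \<in> test_functions \<Omega>" "\<And>n. energy (y n) \<le> K + 1" "v \<in> H10 \<Omega>"
    "(\<lambda>n. l2norm \<mu> (\<lambda>x. y n x - v x)) \<longlonglongrightarrow> 0"
    "\<And>i. (\<lambda>n. l2norm \<mu> (\<lambda>x. partial_deriv i (y n) x - weak_deriv \<Omega> i v x)) \<longlonglongrightarrow> 0"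
    using strong_approximation[of "\<lambda>n. U (r n)" K v, OF U(1) U(2) rv(2,3)] by blast
  have "sq_integrable \<mu> (\<lambda>x. y n x - v x)" for n
    by (rule sq_integrable_diff[OF C1c_sq_integrable[OF test_functionsD[OF y(1)]] rv(2)])
  from l2norm_tendsto_0_AE_subseq[OF this y(4)]
  obtain q :: "nat \<Rightarrow> nat" where q: "strict_mono q" "AE x in \<mu>. (\<lambda>n. y (q n) x - v x) \<longlonglongrightarrow> 0" by blast
  have qlim: "AE x in \<mu>. (\<lambda>n. y (q n) x) \<longlonglongrightarrow> v x" using q(2) by eventually_elim (simp add: LIM_zero_iff)
  have qD: "(\<lambda>n. l2norm \<mu> (\<lambda>x. D (y (q n)) i x - weak_deriv \<Omega> i v x)) \<longlonglongrightarrow> 0" for i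
    using LIMSEQ_subseq_LIMSEQ[OF y(5)[of i] q(1)] by (simp add: o_def)
  have "form v (\<lambda>i. weak_deriv \<Omega> i v) (w j) (D (w j)) = f (w j)" for j
  proof -
    have "(\<lambda>n. form (y (q n)) (D (y (q n))) (w j) (D (w j))) \<longlonglongrightarrow> form v (\<lambda>i. weak_deriv \<Omega> i v) (w j) (D (w j))"
      by (rule form_tendsto[OF test_functionsD[OF y(1)] qlim vm H1_weak_deriv(1)[OF H10_H1[OF y(3)]] qD test_functionsD[OF w]])
    moreover have "(\<lambda>n. form (y (q n)) (D (y (q n))) (w j) (D (w j))) \<longlonglongrightarrow> weak_form v (w j)"
      unfolding form_eq_weak_form[OF test_functionsD[OF y(1)] w]
      by (rule weak_form_tendsto[OF test_functionsD[OF y(1)] y(2) qlim vm w])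
    ultimately have eq: "form v (\<lambda>i. weak_deriv \<Omega> i v) (w j) (D (w j)) = weak_form v (w j)" by (rule LIMSEQ_unique)
    have "(\<lambda>n. form (U (t n)) (D (U (t n))) (w j) (D (w j))) \<longlonglongrightarrow> weak_form v (w j)"
      unfolding form_eq_weak_form[OF test_functionsD[OF U(1)] w]
      by (rule weak_form_tendsto[OF test_functionsD[OF U(1)] U(2) tlim vm w])
    moreover have "(\<lambda>n. form (U (t n)) (D (U (t n))) (w j) (D (w j))) \<longlonglongrightarrow> f (w j)"
    proof (rule LIM_zero_cancel, rule Lim_null_comparison)
      have "(\<lambda>n. K / real (Suc n)) \<longlonglongrightarrow> 0" by (rule LIMSEQ_Suc[OF lim_const_over_n])
      from tendsto_real_sqrt[OF LIMSEQ_subseq_LIMSEQ[OF this t]]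
      show "(\<lambda>n. sqrt (K / real (Suc (t n)))) \<longlonglongrightarrow> 0" by (simp add: o_def)
      show "\<forall>\<^sub>F n in sequentially. norm (form (U (t n)) (D (U (t n))) (w j) (D (w j)) - f (w j)) \<le> sqrt (K / real (Suc (t n)))"
        using eventually_gt_at_top[of j]
      proof eventually_elim
        case (elim n)
        \<comment> \<open>A strictly increasing \<open>t\<close> satisfies n \<le> t n, so
          \<open>w j\<close> is among the functions against which the approximation of index t n is
          tested.\<close>
        then have "j < t n" using seq_suble[OF t, of n] by linarith
        then show ?case using U(3)[of j "t n"] by (simp only: real_norm_def)
      qed
    qed
    ultimately have "weak_form v (w j) = f (w j)" by (rule LIMSEQ_unique)
    with eq show ?thesis by simp
  qed
  with y(3) show ?thesis by blast
qed

text \<open>The k-th test function approximating \<open>v\<close> is replaced by a member of the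
  family that is within 1/(k+1) of it in the C1 norm on \<Omega>; finite area makes this error small
  in L2.\<close>

lemma dense_family_approx:
  assumes w: "\<And>j::nat. w j \<in> test_functions \<Omega>"
    and dense: "\<And>\<phi> e. \<phi> \<in> test_functions \<Omega> \<Longrightarrow> e > 0 \<Longrightarrow>
      \<exists>j. \<forall>x\<in>\<Omega>. \<bar>\<phi> x - w j x\<bar> \<le> e \<and> (\<forall>i. \<bar>partial_deriv i \<phi> x - partial_deriv i (w j) x\<bar> \<le> e)"
    and v: "v \<in> H10 \<Omega>"
  shows "\<exists>s. (\<lambda>k::nat. l2norm \<mu> (\<lambda>x. w (s k) x - v x)) \<longlonglongrightarrow> 0 \<and>
    (\<forall>i. (\<lambda>k. l2norm \<mu> (\<lambda>x. D (w (s k)) i x - weak_deriv \<Omega> i v x)) \<longlonglongrightarrow> 0)"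
proof -
  obtain \<phi> where \<phi>: "\<And>n::nat. \<phi> n \<in> test_functions \<Omega>" "(\<lambda>n. l2norm \<mu> (\<lambda>x. \<phi> n x - v x)) \<longlonglongrightarrow> 0"
    "\<And>i. (\<lambda>n. l2norm \<mu> (\<lambda>x. partial_deriv i (\<phi> n) x - weak_deriv \<Omega> i v x)) \<longlonglongrightarrow> 0"
    using H10_approx[OF v] by blast
  have "\<exists>j. \<forall>x\<in>\<Omega>. \<bar>\<phi> k x - w j x\<bar> \<le> 1 / real (Suc k) \<and> (\<forall>i. \<bar>partial_deriv i (\<phi> k) x - partial_deriv i (w j) x\<bar> \<le> 1 / real (Suc k))" for k
    by (rule dense[OF \<phi>(1)]) simp
  then obtain s where s: "\<And>k x. x \<in> \<Omega> \<Longrightarrow> \<bar>\<phi> k x - w (s k) x\<bar> \<le> 1 / real (Suc k)"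
    "\<And>k x i. x \<in> \<Omega> \<Longrightarrow> \<bar>partial_deriv i (\<phi> k) x - partial_deriv i (w (s k)) x\<bar> \<le> 1 / real (Suc k)" by metis
  have main: "(\<lambda>k. l2norm \<mu> (\<lambda>x. b k x - g x)) \<longlonglongrightarrow> 0"
    if sq: "\<And>k. sq_integrable \<mu> (a k)" "\<And>k. sq_integrable \<mu> (b k)" "sq_integrable \<mu> g"
      and lim: "(\<lambda>k. l2norm \<mu> (\<lambda>x. a k x - g x)) \<longlonglongrightarrow> 0"
      and close: "\<And>k x. x \<in> \<Omega> \<Longrightarrow> \<bar>a k x - b k x\<bar> \<le> 1 / real (Suc k)" for a b g
  proof (rule nonneg_tendsto_0)
    show "l2norm \<mu> (\<lambda>x. b k x - g x) \<le> 1 / real (Suc k) * sqrt area + l2norm \<mu> (\<lambda>x. a k x - g x)" for k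
    proof -
      have "l2norm \<mu> (\<lambda>x. a k x - b k x) \<le> 1 / real (Suc k) * sqrt area"
      proof (rule power2_le_imp_le)
        have "(\<integral>x. (a k x - b k x)\<^sup>2 \<partial>\<mu>) \<le> (\<integral>x. (1 / real (Suc k))\<^sup>2 \<partial>\<mu>)"
        proof (rule integral_mono)
          show "integrable \<mu> (\<lambda>x. (a k x - b k x)\<^sup>2)" by (rule sq_integrable_sq[OF sq_integrable_diff[OF sq(1,2)]])
          fix x assume "x \<in> space \<mu>"
          then have "\<bar>a k x - b k x\<bar> \<le> 1 / real (Suc k)" by (intro close) simp
          from power_mono[OF this, of 2] show "(a k x - b k x)\<^sup>2 \<le> (1 / real (Suc k))\<^sup>2" by simp
        qed simp
        then show "(l2norm \<mu> (\<lambda>x. a k x - b k x))\<^sup>2 \<le> (1 / real (Suc k) * sqrt area)\<^sup>2"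
          by (simp add: l2norm_sq power_mult_distrib power_divide mult.commute)
      qed simp
      then show ?thesis
        using l2norm_triangle_diff[OF sq(2)[of k] sq(1)[of k] sq(3)] l2norm_minus_commute[of \<mu> "b k" "a k"] by linarith
    qed
    have "(\<lambda>k. 1 / real (Suc k)) \<longlonglongrightarrow> 0" by (rule lim_inverse_n'[THEN LIMSEQ_Suc])
    from tendsto_add[OF tendsto_mult[OF this tendsto_const[of "sqrt area"]] lim]
    show "(\<lambda>k. 1 / real (Suc k) * sqrt area + l2norm \<mu> (\<lambda>x. a k x - g x)) \<longlonglongrightarrow> 0" by simp
  qed simp
  note c = test_functionsD[OF \<phi>(1)] and wc = test_functionsD[OF w]
  have "(\<lambda>k. l2norm \<mu> (\<lambda>x. w (s k) x - v x)) \<longlonglongrightarrow> 0"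
    by (rule main[OF C1c_sq_integrable[OF c] C1c_sq_integrable[OF wc] H1_sq_integrable[OF H10_H1[OF v]] \<phi>(2) s(1)])
  moreover have "(\<lambda>k. l2norm \<mu> (\<lambda>x. D (w (s k)) i x - weak_deriv \<Omega> i v x)) \<longlonglongrightarrow> 0" for i
    by (rule main[OF C1c_partial_sq_integrable[OF c] C1c_partial_sq_integrable[OF wc] H1_weak_deriv(1)[OF H10_H1[OF v]] \<phi>(3) s(2)])
  ultimately show ?thesis by blast
qed

text \<open>Convergence in H1 gives no uniform bound on \<open>z k\<close>, so the factor in u
  cannot simply be pulled out. Cauchy-Schwarz pairs its square with the squared difference of
  \<open>z k\<close> and v, and the latter tends to zero in L2.\<close>

lemma l2norm_gpow_mult_tendsto:
  assumes u: "u \<in> H10 \<Omega>" and v: "v \<in> H10 \<Omega>" and z: "\<And>k::nat. z k \<in> C1c \<Omega>" "\<And>k. energy (z k) \<le> M"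
    and lim: "AE x in \<mu>. (\<lambda>k. z k x) \<longlonglongrightarrow> v x"
  shows "(\<lambda>k. l2norm \<mu> (\<lambda>x. gpow (u x) \<delta> * z k x - gpow (u x) \<delta> * v x)) \<longlonglongrightarrow> 0"
proof -
  define p where "p k x = (z k x - v x)\<^sup>2" for k x
  have vm: "v \<in> borel_measurable \<mu>" by (rule sq_integrable_measurable[OF H1_sq_integrable[OF H10_H1[OF v]]])
  have zm: "z k \<in> borel_measurable \<mu>" for k by (rule sq_integrable_measurable[OF C1c_sq_integrable[OF z(1)]])
  have pm: "p k \<in> borel_measurable \<mu>" for k unfolding p_def using vm zm[of k] by measurable
  \<comment> \<open>The squared L2 norm of \<open>p k\<close> is an integral of fourth powers of the
    difference. Its convergence by \<open>l1_tendsto_0_of_l2_bounded\<close> needs a bound on the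
    squares of these, that is, on eighth powers.\<close>
  note pg4 = poly_growth_power[of 4]
  obtain B where B: "\<And>k. (\<integral>x. (z k x ^ 4)\<^sup>2 \<partial>\<mu>) \<le> B" using poly_growth_integral_bound[OF pg4, of M] z by blast
  have i: "integrable \<mu> (\<lambda>x. 128 * (z k x ^ 4)\<^sup>2 + 128 * (v x ^ 4)\<^sup>2)" for k
    by (intro Bochner_Integration.integrable_add integrable_mult_right sq_integrable_sq
        poly_growth_C1c_sq_integrable[OF pg4 z(1)] H10_poly_growth[OF v pg4])
  \<comment> \<open>The inequality (a + b)^2 \<le> 2 a^2 + 2 b^2 is applied three times, with
    constants 2, then 8, then 2 * 8^2 = 128.\<close>
  have le: "((p k x)\<^sup>2)\<^sup>2 \<le> 128 * (z k x ^ 4)\<^sup>2 + 128 * (v x ^ 4)\<^sup>2" for k x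
  proof -
    have sq: "(a + b)\<^sup>2 \<le> 2 * a\<^sup>2 + 2 * b\<^sup>2" for a b :: real
      using sum_squares_bound[of a b] by (simp add: power2_sum)
    have "p k x \<le> 2 * (z k x)\<^sup>2 + 2 * (v x)\<^sup>2" unfolding p_def using sq[of "z k x" "- v x"] by simp
    then have "(p k x)\<^sup>2 \<le> (2 * (z k x)\<^sup>2 + 2 * (v x)\<^sup>2)\<^sup>2" by (rule power_mono) (simp add: p_def)
    also have "\<dots> \<le> 2 * (2 * (z k x)\<^sup>2)\<^sup>2 + 2 * (2 * (v x)\<^sup>2)\<^sup>2" by (rule sq)
    also have "\<dots> = 8 * z k x ^ 4 + 8 * v x ^ 4" by (simp add: power_mult_distrib power_mult[symmetric])
    finally have "((p k x)\<^sup>2)\<^sup>2 \<le> (8 * z k x ^ 4 + 8 * v x ^ 4)\<^sup>2" by (rule power_mono) simp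
    also have "\<dots> \<le> 2 * (8 * z k x ^ 4)\<^sup>2 + 2 * (8 * v x ^ 4)\<^sup>2" by (rule sq)
    finally show ?thesis by (simp add: power_mult_distrib)
  qed
  have sq2: "sq_integrable \<mu> (\<lambda>x. (p k x)\<^sup>2)" for k
    unfolding sq_integrable_def
  proof
    show "(\<lambda>x. (p k x)\<^sup>2) \<in> borel_measurable \<mu>" using pm[of k] by measurable
    show "integrable \<mu> (\<lambda>x. ((p k x)\<^sup>2)\<^sup>2)"
    proof (rule Bochner_Integration.integrable_bound[OF i[of k]])
      show "(\<lambda>x. ((p k x)\<^sup>2)\<^sup>2) \<in> borel_measurable \<mu>" using pm[of k] by measurable
      have "norm (((p k x)\<^sup>2)\<^sup>2) \<le> norm (128 * (z k x ^ 4)\<^sup>2 + 128 * (v x ^ 4)\<^sup>2)" for x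
        unfolding real_norm_def abs_power2 by (rule order_trans[OF le abs_ge_self])
      then show "AE x in \<mu>. norm (((p k x)\<^sup>2)\<^sup>2) \<le> norm (128 * (z k x ^ 4)\<^sup>2 + 128 * (v x ^ 4)\<^sup>2)" by (intro AE_I2)
    qed
  qed
  have sp: "sq_integrable \<mu> (p k)" for k
    using l1_le_l2norm(1)[OF sq2[of k]] pm[of k] by (simp add: sq_integrable_def)
  have "(\<lambda>k. \<integral>x. \<bar>(p k x)\<^sup>2\<bar> \<partial>\<mu>) \<longlonglongrightarrow> 0"
  proof (rule l1_tendsto_0_of_l2_bounded[OF sq2])
    show "(\<integral>x. ((p k x)\<^sup>2)\<^sup>2 \<partial>\<mu>) \<le> 128 * B + 128 * (\<integral>x. (v x ^ 4)\<^sup>2 \<partial>\<mu>)" for k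
    proof -
      have "(\<integral>x. ((p k x)\<^sup>2)\<^sup>2 \<partial>\<mu>) \<le> (\<integral>x. 128 * (z k x ^ 4)\<^sup>2 + 128 * (v x ^ 4)\<^sup>2 \<partial>\<mu>)"
        by (intro integral_mono i le sq_integrable_sq[OF sq2])
      also have "\<dots> = 128 * (\<integral>x. (z k x ^ 4)\<^sup>2 \<partial>\<mu>) + 128 * (\<integral>x. (v x ^ 4)\<^sup>2 \<partial>\<mu>)"
        using sq_integrable_sq[OF poly_growth_C1c_sq_integrable[OF pg4 z(1)[of k]]] sq_integrable_sq[OF H10_poly_growth[OF v pg4]]
        by (subst Bochner_Integration.integral_add) auto
      finally show ?thesis using B[of k] by linarith
    qed
    show "AE x in \<mu>. (\<lambda>k. (p k x)\<^sup>2) \<longlonglongrightarrow> 0"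
      using lim
    proof eventually_elim
      case (elim x)
      have "(\<lambda>k. ((z k x - v x)\<^sup>2)\<^sup>2) \<longlonglongrightarrow> ((v x - v x)\<^sup>2)\<^sup>2" by (intro tendsto_intros elim)
      then show ?case by (simp add: p_def)
    qed
  qed
  then have "(\<lambda>k. sqrt (\<integral>x. \<bar>(p k x)\<^sup>2\<bar> \<partial>\<mu>)) \<longlonglongrightarrow> sqrt 0" by (rule tendsto_real_sqrt)
  then have plim: "(\<lambda>k. l2norm \<mu> (p k)) \<longlonglongrightarrow> 0" by (simp add: l2norm_def)
  have sG: "sq_integrable \<mu> (\<lambda>x. gpow (u x) \<delta> * gpow (u x) \<delta>)" by (rule H10_poly_growth[OF u poly_growth_mult[OF gpow_growth gpow_growth]])
  define b where "b = l2norm \<mu> (\<lambda>x. gpow (u x) \<delta> * gpow (u x) \<delta>)"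
  show ?thesis
  proof (rule nonneg_tendsto_0)
    show "l2norm \<mu> (\<lambda>x. gpow (u x) \<delta> * z k x - gpow (u x) \<delta> * v x) \<le> sqrt (b * l2norm \<mu> (p k))" for k
    proof (rule real_le_rsqrt)
      have "(l2norm \<mu> (\<lambda>x. gpow (u x) \<delta> * z k x - gpow (u x) \<delta> * v x))\<^sup>2 = (\<integral>x. (gpow (u x) \<delta> * gpow (u x) \<delta>) * p k x \<partial>\<mu>)"
        unfolding l2norm_sq p_def right_diff_distrib[symmetric] power_mult_distrib by (simp only: power2_eq_square)
      also have "\<dots> \<le> b * l2norm \<mu> (p k)"
        unfolding b_def by (rule order_trans[OF abs_ge_self Cauchy_Schwarz_integral[OF sG sp]])
      finally show "(l2norm \<mu> (\<lambda>x. gpow (u x) \<delta> * z k x - gpow (u x) \<delta> * v x))\<^sup>2 \<le> b * l2norm \<mu> (p k)" .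
    qed
    show "(\<lambda>k. sqrt (b * l2norm \<mu> (p k))) \<longlonglongrightarrow> 0"
      using tendsto_real_sqrt[OF tendsto_mult[OF tendsto_const[of b] plim]] by simp
  qed simp
qed

text \<open>Both sides are continuous in the test function along the approximating members of the
  family: the functional by its norm bound, the form because each of its terms pairs
  square-integrable factors.\<close>

lemma form_eq_on_H10:
  assumes w: "\<And>j::nat. w j \<in> test_functions \<Omega>"
    and dense: "\<And>\<phi> e. \<phi> \<in> test_functions \<Omega> \<Longrightarrow> e > 0 \<Longrightarrow>
      \<exists>j. \<forall>x\<in>\<Omega>. \<bar>\<phi> x - w j x\<bar> \<le> e \<and> (\<forall>i. \<bar>partial_deriv i \<phi> x - partial_deriv i (w j) x\<bar> \<le> e)"
    and u: "u \<in> H10 \<Omega>" and eq: "\<And>j. form u (\<lambda>i. weak_deriv \<Omega> i u) (w j) (D (w j)) = f (w j)"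
    and v: "v \<in> H10 \<Omega>"
  shows "form u (\<lambda>i. weak_deriv \<Omega> i u) v (\<lambda>i. weak_deriv \<Omega> i v) = f v"
proof -
  obtain s where s: "(\<lambda>k::nat. l2norm \<mu> (\<lambda>x. w (s k) x - v x)) \<longlonglongrightarrow> 0"
    "\<And>i. (\<lambda>k. l2norm \<mu> (\<lambda>x. D (w (s k)) i x - weak_deriv \<Omega> i v x)) \<longlonglongrightarrow> 0"
    using dense_family_approx[OF w dense v] by blast
  note wc = test_functionsD[OF w]
  note v1 = H10_H1[OF v] and u1 = H10_H1[OF u]
  have "sq_integrable \<mu> (\<lambda>x. w (s k) x - v x)" for k
    by (rule sq_integrable_diff[OF C1c_sq_integrable[OF wc] H1_sq_integrable[OF v1]])
  from l2norm_tendsto_0_AE_subseq[OF this s(1)]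
  obtain r :: "nat \<Rightarrow> nat" where r: "strict_mono r" "AE x in \<mu>. (\<lambda>k. w (s (r k)) x - v x) \<longlonglongrightarrow> 0" by blast
  define z where "z k = w (s (r k))" for k
  have zc: "z k \<in> C1c \<Omega>" for k unfolding z_def by (rule wc)
  have zlim: "AE x in \<mu>. (\<lambda>k. z k x) \<longlonglongrightarrow> v x" using r(2) by eventually_elim (simp add: LIM_zero_iff z_def)
  have z0: "(\<lambda>k. l2norm \<mu> (\<lambda>x. z k x - v x)) \<longlonglongrightarrow> 0"
    using LIMSEQ_subseq_LIMSEQ[OF s(1) r(1)] by (simp add: o_def z_def)
  have zD: "(\<lambda>k. l2norm \<mu> (\<lambda>x. D (z k) i x - weak_deriv \<Omega> i v x)) \<longlonglongrightarrow> 0" for i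
    using LIMSEQ_subseq_LIMSEQ[OF s(2)[of i] r(1)] by (simp add: o_def z_def)
  obtain M where M: "\<And>k. energy (z k) \<le> M"
    using energy_bounded_of_convergent[of z "\<lambda>i. weak_deriv \<Omega> i v", OF zc H1_weak_deriv(1)[OF v1] zD] by blast
  have zero: "(\<lambda>n::nat. l2norm \<mu> (\<lambda>x. h x - h x)) \<longlonglongrightarrow> 0" for h :: "real^2 \<Rightarrow> real" by (simp add: l2norm_def)
  note uw = H1_weak_deriv(1)[OF u1] and vw = H1_weak_deriv(1)[OF v1]
  have 1: "(\<lambda>k. \<integral>x. weak_deriv \<Omega> i u x * D (z k) i x \<partial>\<mu>) \<longlonglongrightarrow> (\<integral>x. weak_deriv \<Omega> i u x * weak_deriv \<Omega> i v x \<partial>\<mu>)" for i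
    by (rule integral_mult_tendsto[OF uw uw C1c_partial_sq_integrable[OF zc] vw zero zD])
  have 2: "(\<lambda>k. \<integral>x. (\<Sum>i\<in>UNIV. weak_deriv \<Omega> i u x) * (gpow (u x) \<delta> * z k x) \<partial>\<mu>)
      \<longlonglongrightarrow> (\<integral>x. (\<Sum>i\<in>UNIV. weak_deriv \<Omega> i u x) * (gpow (u x) \<delta> * v x) \<partial>\<mu>)"
    by (rule integral_mult_tendsto[OF sq_integrable_sum[OF uw] sq_integrable_sum[OF uw]
        sq_integrable_mult_bounded[OF H10_poly_growth[OF u gpow_growth] zc] H10_poly_growth_mult[OF u v gpow_growth poly_growth_ident]
        zero l2norm_gpow_mult_tendsto[OF u v zc M zlim]])
  have 3: "(\<lambda>k. \<integral>x. R (u x) * z k x \<partial>\<mu>) \<longlonglongrightarrow> (\<integral>x. R (u x) * v x \<partial>\<mu>)"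
    by (rule integral_mult_tendsto[OF H10_poly_growth[OF u reaction_growth] H10_poly_growth[OF u reaction_growth]
        C1c_sq_integrable[OF zc] H1_sq_integrable[OF v1] zero z0])
  have "(\<lambda>k. form u (\<lambda>i. weak_deriv \<Omega> i u) (z k) (D (z k))) \<longlonglongrightarrow> form u (\<lambda>i. weak_deriv \<Omega> i u) v (\<lambda>i. weak_deriv \<Omega> i v)"
    unfolding form_def by (intro tendsto_diff tendsto_add tendsto_mult tendsto_const tendsto_sum 1 2 3)
  then have flim: "(\<lambda>k. f (z k)) \<longlonglongrightarrow> form u (\<lambda>i. weak_deriv \<Omega> i u) v (\<lambda>i. weak_deriv \<Omega> i v)"
    unfolding z_def eq .
  obtain C where C: "C \<ge> 0" "\<And>u. u \<in> H10 \<Omega> \<Longrightarrow> \<bar>f u\<bar> \<le> C * H1_norm \<Omega> u" using f_bound by blast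
  have zH: "z k \<in> H10 \<Omega>" for k unfolding z_def by (rule test_functions_H10[OF w])
  have "(\<lambda>k. H1_norm \<Omega> (\<lambda>x. z k x - v x)) \<longlonglongrightarrow> 0"
  proof (rule H1_norm_tendsto_0[OF H1_diff(1)[OF C1c_H1(1)[OF zc] v1] z0])
    show "(\<lambda>k. l2norm \<mu> (weak_deriv \<Omega> i (\<lambda>x. z k x - v x))) \<longlonglongrightarrow> 0" for i
      using zD[of i] unfolding l2norm_partial_diff_weak_deriv[OF zc v1] .
  qed
  from tendsto_mult[OF tendsto_const[of C] this] have Clim: "(\<lambda>k. C * H1_norm \<Omega> (\<lambda>x. z k x - v x)) \<longlonglongrightarrow> 0" by simp
  have "(\<lambda>k. f (z k)) \<longlonglongrightarrow> f v"
  proof (rule LIM_zero_cancel, rule Lim_null_comparison[OF always_eventually Clim], rule allI)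
    fix k
    have "f (z k) - f v = f (\<lambda>x. z k x - v x)" using f_linear[OF zH[of k] v, of 1 "-1"] by simp
    then show "norm (f (z k) - f v) \<le> C * H1_norm \<Omega> (\<lambda>x. z k x - v x)"
      using C(2)[OF H10_diff[OF zH[of k] v]] by simp
  qed
  with flim show ?thesis by (rule LIMSEQ_unique)
qed

lemma exists_weak_solution: "\<exists>u. weak_solution \<Omega> \<nu> \<alpha> \<beta> \<delta> \<gamma> f u"
proof -
  obtain w :: "nat \<Rightarrow> real^2 \<Rightarrow> real" where w: "\<And>j. w j \<in> test_functions \<Omega>"
    and dense: "\<And>\<phi> e. \<phi> \<in> test_functions \<Omega> \<Longrightarrow> e > 0 \<Longrightarrow>
      \<exists>j. \<forall>x\<in>\<Omega>. \<bar>\<phi> x - w j x\<bar> \<le> e \<and> (\<forall>i. \<bar>partial_deriv i \<phi> x - partial_deriv i (w j) x\<bar> \<le> e)"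
    using countable_dense_test_functions by blast
  obtain u where u: "u \<in> H10 \<Omega>" "\<And>j. form u (\<lambda>i. weak_deriv \<Omega> i u) (w j) (D (w j)) = f (w j)"
    using exists_solution_on_dense_family[of w, OF w] by blast
  have "integrable \<mu> (\<lambda>x. gpow (u x) \<delta> * (\<Sum>i\<in>UNIV. weak_deriv \<Omega> i u x) * v x) \<and>
      integrable \<mu> (\<lambda>x. u x * (1 - gpow (u x) \<delta>) * (gpow (u x) \<delta> - \<gamma>) * v x) \<and>
      \<nu> * grad_inner \<Omega> u v + \<alpha> * (\<integral>x. gpow (u x) \<delta> * (\<Sum>i\<in>UNIV. weak_deriv \<Omega> i u x) * v x \<partial>\<mu>)
        - \<beta> * (\<integral>x. u x * (1 - gpow (u x) \<delta>) * (gpow (u x) \<delta> - \<gamma>) * v x \<partial>\<mu>) = f v"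
    if v: "v \<in> H10 \<Omega>" for v
  proof -
    \<comment> \<open>Regrouped as a product of two square-integrable functions, the gradient sum
      and the power times v.\<close>
    have conv: "(\<lambda>x. gpow (u x) \<delta> * (\<Sum>i\<in>UNIV. weak_deriv \<Omega> i u x) * v x)
        = (\<lambda>x. (\<Sum>i\<in>UNIV. weak_deriv \<Omega> i u x) * (gpow (u x) \<delta> * v x))" by (simp only: mult_ac)
    have reac: "(\<lambda>x. u x * (1 - gpow (u x) \<delta>) * (gpow (u x) \<delta> - \<gamma>) * v x) = (\<lambda>x. R (u x) * v x)"
      by (simp only: reaction_def)
    have "integrable \<mu> (\<lambda>x. (\<Sum>i\<in>UNIV. weak_deriv \<Omega> i u x) * (gpow (u x) \<delta> * v x))"
      by (rule sq_integrable_mult[OF sq_integrable_sum[OF H1_weak_deriv(1)[OF H10_H1[OF u(1)]]]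
          H10_poly_growth_mult[OF u(1) v gpow_growth poly_growth_ident]])
    moreover have "integrable \<mu> (\<lambda>x. R (u x) * v x)"
      by (rule sq_integrable_mult[OF H10_poly_growth[OF u(1) reaction_growth] H1_sq_integrable[OF H10_H1[OF v]]])
    moreover have "\<nu> * grad_inner \<Omega> u v + \<alpha> * (\<integral>x. (\<Sum>i\<in>UNIV. weak_deriv \<Omega> i u x) * (gpow (u x) \<delta> * v x) \<partial>\<mu>)
        - \<beta> * (\<integral>x. R (u x) * v x \<partial>\<mu>) = f v"
      using form_eq_on_H10[OF w dense u(1) u(2) v] unfolding form_def grad_inner_def L2_inner_def .
    ultimately show ?thesis unfolding conv reac by blast
  qed
  with u(1) show ?thesis unfolding weak_solution_def Let_def by blast
qed

end

theorem theorem2p1: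
  fixes \<Omega> :: "(real^2) set" and \<nu> \<alpha> \<beta> \<delta> \<gamma> :: real
    and f :: "(real^2 \<Rightarrow> real) \<Rightarrow> real"
  assumes "open \<Omega>" "\<Omega> \<noteq> {}" "bounded \<Omega>" "simply_connected \<Omega>" "lipschitz_boundary \<Omega>"
    and "\<nu> > 0" "\<alpha> > 0" "\<beta> > 0" "\<delta> \<ge> 1" "0 < \<gamma>" "\<gamma> < 1"
    and "f \<in> H_minus1 \<Omega>"
  shows "\<exists>u. weak_solution \<Omega> \<nu> \<alpha> \<beta> \<delta> \<gamma> f u"
proof -
  interpret elliptic_problem \<Omega> \<nu> \<alpha> \<beta> \<delta> \<gamma> f
    using assms by unfold_locales auto
  show ?thesis by (rule exists_weak_solution)
qed

end
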